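(* The number of random Gaussian measurements needed to guarantee, with high probability, the TV null space condition for signals with $K$-sparse gradient is at least $\frac{\pi}{16}(NK)^{\frac{1}{2}}-O(\sqrt{N})$.
   Context: Signals are one-dimensional vectors $\bm{x}\in\mathbb{R}^N$. For $\bm{x}\in\mathbb{R}^N$, $D\bm{x}\in\mathbb{R}^{N-1}$ is the finite difference (gradient) vector $[D\bm{x}]_i=x_{i+1}-x_i$, $i=1,\dots,N-1$; the signal has $K$-sparse gradient if $D\bm{x}$ has no more than $K$ nonzero entries. The number of random Gaussian measurements is the number $M$ of rows of a random measurement matrix $A\in\mathbb{R}^{M\times N}$ whose entries are i.i.d. Gaussian random variables. For $\mathcal{K}\subset\{1,\dots,N-1\}$, $\mathcal{K}^c=\{1,\dots,N-1\}\setminus\mathcal{K}$, and $(D\bm{x})_{\mathcal{K}}$ denotes the restriction of $D\bm{x}$ to the indices in $\mathcal{K}$. The TV null space condition for signals with $K$-sparse gradient is the following condition on $A$: for every nonzero $\bm{z}\in\mathbb{R}^N$ with $A\bm{z}=\bm{0}$ and every $\mathcal{K}\subset\{1,\dots,N-1\}$ with $|\mathcal{K}|\le K$, one has $\|(D\bm{z})_{\mathcal{K}}\|_1<\|(D\bm{z})_{\mathcal{K}^c}\|_1$. (This condition is equivalent to every $\bm{x}$ with $K$-sparse gradient being the unique minimizer of $\|D\bm{x}'\|_1$ over all $\bm{x}'$ with $A\bm{x}'=A\bm{x}$.) *)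

theory Defs
  imports
    "HOL-Probability.Probability"
    "HOL-Library.Landau_Symbols"
    "Jordan_Normal_Form.Matrix"
begin

hide_const (open) Finite_Cartesian_Product.vec Finite_Cartesian_Product.mat
no_notation Finite_Cartesian_Product.vec_nth (infixl "$" 90)

text \<open>Vectors and matrices are those of \<^theory>\<open>Jordan_Normal_Form.Matrix\<close>, hence indexed from
  \<open>0\<close>: the gradient of a signal of length \<open>N\<close> has the index set \<open>{..<N - 1}\<close>.\<close>

definition finite_difference :: "real vec \<Rightarrow> real vec" where
  "finite_difference x = vec (dim_vec x - 1) (\<lambda>i. x $ (i + 1) - x $ i)"

definition l1_norm_on :: "nat set \<Rightarrow> real vec \<Rightarrow> real" where
  "l1_norm_on S v = (\<Sum>i\<in>S. \<bar>v $ i\<bar>)"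

definition tv_null_space_condition :: "nat \<Rightarrow> real mat \<Rightarrow> bool" where
  "tv_null_space_condition K A \<longleftrightarrow>
     (let N = dim_col A in
      \<forall>z \<in> carrier_vec N. z \<noteq> 0\<^sub>v N \<longrightarrow> A *\<^sub>v z = 0\<^sub>v (dim_row A) \<longrightarrow>
        (\<forall>S. S \<subseteq> {..<N - 1} \<longrightarrow> card S \<le> K \<longrightarrow>
           l1_norm_on S (finite_difference z) <
           l1_norm_on ({..<N - 1} - S) (finite_difference z)))"

text \<open>The joint law of the entries of an \<open>M \<times> N\<close> matrix whose entries are i.i.d. Gaussian with
  mean \<open>\<mu>\<close> and standard deviation \<open>\<sigma>\<close>; an outcome \<open>\<omega>\<close> stands for the matrix \<open>mat M N \<omega>\<close>.\<close>

definition gaussian_entries :: "nat \<Rightarrow> nat \<Rightarrow> real \<Rightarrow> real \<Rightarrow> (nat \<times> nat \<Rightarrow> real) measure" where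
  "gaussian_entries M N \<mu> \<sigma> =
     PiM ({..<M} \<times> {..<N}) (\<lambda>_. density lborel (\<lambda>x. ennreal (normal_density \<mu> \<sigma> x)))"

text \<open>The event below is measurable: by compactness of the unit sphere, the matrices that violate
  the condition form a closed set.\<close>

definition prob_tv_null_space_condition ::
    "nat \<Rightarrow> nat \<Rightarrow> nat \<Rightarrow> real \<Rightarrow> real \<Rightarrow> real" where
  "prob_tv_null_space_condition M N K \<mu> \<sigma> =
     measure (gaussian_entries M N \<mu> \<sigma>)
       {\<omega> \<in> space (gaussian_entries M N \<mu> \<sigma>). tv_null_space_condition K (mat M N \<omega>)}"

end

theory Submission
  imports
    Defs
    "HOL-Real_Asymp.Real_Asymp"
begin

text \<open>The test signals have \<open>p\<close> (about \<open>K\<close>) alternating entries \<open>\<plusminus>1\<close>, whose jumps form the set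
  \<open>S\<close>, followed by \<open>n\<close> (about \<open>\<surd>(N K)\<close>) blocks of length \<open>l\<close> (about \<open>\<surd>(N / K)\<close>), on which they are
  \<open>\<plusminus>b\<close> with \<open>b\<close> about \<open>K / n\<close>. Every convex combination of them has at least as much variation on \<open>S\<close> as
  off \<open>S\<close>, so under the null space condition no such combination lies in the kernel of the
  Gaussian matrix \<open>G\<close>. By linear duality there is then a unit vector \<open>y\<close> with \<open>\<langle>G z, y\<rangle> \<le> 0\<close> for all test
  signals \<open>z\<close>. If \<open>R\<close> bounds the norms of the \<open>z\<close>, Gordon's comparison
  inequality replaces \<open>\<langle>G z, y\<rangle>\<close> by \<open>\<langle>z, g\<rangle> + R \<langle>h, y\<rangle>\<close> with independent standard Gaussian vectors \<open>g\<close>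
  and \<open>h\<close>; choosing the signs on the blocks according to \<open>g\<close>, the maximum over \<open>z\<close> is about
  \<open>b n \<surd>(2 l / \<pi>) - R \<surd>M\<close>, which is positive when \<open>M\<close> is below \<open>2 / (3 \<pi>) \<surd>(N K)\<close>. Since
  \<open>2 / (3 \<pi>) > \<pi> / 16\<close>, there is room for all error terms as soon as \<open>K\<close> is large; small \<open>K\<close> are absorbed by the
  \<open>O(\<surd>N)\<close> term. If \<open>2 K \<ge> N - 1\<close>, the condition on a set and its complement forces \<open>A\<close> to be injective, so
  \<open>M \<ge> N\<close>.\<close>

section \<open>Gaussian integration by parts\<close>

text \<open>The obstacle is the shape of the quantity to bound: a minimum over \<open>y\<close> of
  maxima over \<open>z\<close>. Comparison of plain maxima of Gaussian processes says nothing about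
  it; Gordon's inequality does, and in the direction needed here, but for finite index families,
  while \<open>y\<close> ranges over a sphere. A finite net of the sphere closes this gap. The net
  may be as fine as desired, because the comparison of probabilities leaves no factor depending on
  the number of indices: such factors occur only next to exponentials that vanish in the limit of
  the smoothing parameter.

  All deviations are controlled by Chebyshev's inequality alone. At failure probability of order
  \<rho> they cost a few multiples of \<open>R / sqrt \<rho>\<close>, while the expected gain is of
  order R (N K)^(1/4). So crude second-moment bounds suffice once \<open>K\<close> is large compared
  with 1 / \<rho>, and the conclusion already holds when the success probability is merely bounded
  away from 0, not only when it is close to 1.\<close>

lemma DERIV_std_normal_density:
  "(std_normal_density has_real_derivative - x * std_normal_density x) (at x)"
  unfolding std_normal_density_def
  by (auto intro!: derivative_eq_intros simp: field_simps power2_eq_square)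

lemma std_normal_density_at_top: "(std_normal_density \<longlongrightarrow> 0) at_top"
  unfolding std_normal_density_def by real_asymp

lemma std_normal_density_at_bot: "(std_normal_density \<longlongrightarrow> 0) at_bot"
  unfolding std_normal_density_def by real_asymp

text \<open>Stein's identity. With \<phi> the standard normal density, f \<phi> has derivative
  \<phi> f' - x \<phi> f and vanishes at both ends of the line because \<open>f\<close> is bounded,
  so this derivative integrates to 0.\<close>

lemma std_normal_integration_by_parts:
  fixes f f' :: "real \<Rightarrow> real"
  assumes deriv: "\<And>x. (f has_real_derivative f' x) (at x)"
    and cont: "\<And>x. isCont f' x"
    and bound: "\<And>x. \<bar>f x\<bar> \<le> B" "\<And>x. \<bar>f' x\<bar> \<le> B"
  shows "(\<integral>x. x * f x \<partial>std_normal_distribution) = (\<integral>x. f' x \<partial>std_normal_distribution)"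
proof -
  have f_cont: "isCont f x" for x
    using deriv DERIV_isCont by blast
  have [measurable]: "f \<in> borel_measurable borel" "f' \<in> borel_measurable borel"
    using cont f_cont by (auto intro!: borel_measurable_continuous_onI continuous_at_imp_continuous_on)
  let ?\<phi> = std_normal_density
  have int1: "integrable lborel (\<lambda>x. ?\<phi> x * f' x)"
  proof (rule Bochner_Integration.integrable_bound)
    show "integrable lborel (\<lambda>x. B * (?\<phi> x * \<bar>x\<bar> ^ 0))"
      by (intro integrable_mult_right integrable_std_normal_moment_abs)
    show "AE x in lborel. norm (?\<phi> x * f' x) \<le> norm (B * (?\<phi> x * \<bar>x\<bar> ^ 0))"
      using order_trans[OF bound(2) abs_ge_self]
      by (auto simp: abs_mult mult.commute intro!: AE_I2 mult_right_mono)
  qed simp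
  have int2: "integrable lborel (\<lambda>x. ?\<phi> x * (x * f x))"
  proof (rule Bochner_Integration.integrable_bound)
    show "integrable lborel (\<lambda>x. B * (?\<phi> x * \<bar>x\<bar> ^ 1))"
      by (intro integrable_mult_right integrable_std_normal_moment_abs)
    have "?\<phi> x * (\<bar>x\<bar> * \<bar>f x\<bar>) \<le> ?\<phi> x * (\<bar>x\<bar> * \<bar>B\<bar>)" for x
      by (intro mult_left_mono order_trans[OF bound(1) abs_ge_self]) auto
    then show "AE x in lborel. norm (?\<phi> x * (x * f x)) \<le> norm (B * (?\<phi> x * \<bar>x\<bar> ^ 1))"
      by (auto simp: abs_mult mult_ac)
  qed simp
  have "(LBINT x=-\<infinity>..\<infinity>. ?\<phi> x * f' x - ?\<phi> x * (x * f x)) = 0 - 0"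
  proof (rule interval_integral_FTC_integrable[where F="\<lambda>x. f x * ?\<phi> x"])
    show "((\<lambda>x. f x * ?\<phi> x) has_vector_derivative ?\<phi> x * f' x - ?\<phi> x * (x * f x)) (at x)" for x
      unfolding has_real_derivative_iff_has_vector_derivative[symmetric]
      by (auto intro!: derivative_eq_intros deriv DERIV_std_normal_density simp: algebra_simps)
    have "isCont ?\<phi> x" for x using DERIV_std_normal_density DERIV_isCont by blast
    then show "isCont (\<lambda>x. ?\<phi> x * f' x - ?\<phi> x * (x * f x)) x" for x
      by (intro continuous_intros cont f_cont)
    show "set_integrable lborel (einterval (-\<infinity>) \<infinity>) (\<lambda>x. ?\<phi> x * f' x - ?\<phi> x * (x * f x))"
      using int1 int2 by (simp add: set_integrable_def)
    have "((\<lambda>x. f x * ?\<phi> x) \<longlongrightarrow> 0) F" if "(?\<phi> \<longlongrightarrow> 0) F" for F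
    proof (rule Lim_null_comparison)
      show "((\<lambda>x. B * ?\<phi> x) \<longlongrightarrow> 0) F"
        using tendsto_mult_right_zero[OF that] .
      show "\<forall>\<^sub>F x in F. norm (f x * ?\<phi> x) \<le> B * ?\<phi> x"
        using bound(1) by (auto simp: abs_mult intro!: always_eventually mult_right_mono)
    qed
    then have "((\<lambda>x. f x * ?\<phi> x) \<longlongrightarrow> 0) at_bot" "((\<lambda>x. f x * ?\<phi> x) \<longlongrightarrow> 0) at_top"
      using std_normal_density_at_top std_normal_density_at_bot by blast+
    then show "(((\<lambda>x. f x * ?\<phi> x) \<circ> real_of_ereal) \<longlongrightarrow> 0) (at_right (-\<infinity>))"
      "(((\<lambda>x. f x * ?\<phi> x) \<circ> real_of_ereal) \<longlongrightarrow> 0) (at_left \<infinity>)"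
      unfolding ereal_tendsto_simps1 .
  qed simp
  then have "(\<integral>x. ?\<phi> x * f' x - ?\<phi> x * (x * f x) \<partial>lborel) = 0"
    by (simp add: interval_lebesgue_integral_def set_lebesgue_integral_def)
  then have "(\<integral>x. ?\<phi> x * f' x \<partial>lborel) = (\<integral>x. ?\<phi> x * (x * f x) \<partial>lborel)"
    using int1 int2 by simp
  then show ?thesis
    by (simp add: integral_density)
qed

text \<open>The mean value theorem bounds every difference quotient by \<open>g\<close>; dominated
  convergence along an arbitrary null sequence \<open>X\<close> then passes to the limit.\<close>

lemma has_real_derivative_integral:
  fixes h h' :: "real \<Rightarrow> 'a \<Rightarrow> real"
  assumes int: "\<And>t. integrable M (h t)"
    and deriv: "\<And>x t. x \<in> space M \<Longrightarrow> ((\<lambda>t. h t x) has_real_derivative h' t x) (at t)"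
    and bound: "\<And>x t. x \<in> space M \<Longrightarrow> \<bar>h' t x\<bar> \<le> g x"
    and g: "integrable M g"
    and meas: "h' \<theta> \<in> borel_measurable M"
  shows "((\<lambda>t. \<integral>x. h t x \<partial>M) has_real_derivative (\<integral>x. h' \<theta> x \<partial>M)) (at \<theta>)"
  unfolding DERIV_def
proof (subst tendsto_at_iff_sequentially, intro allI impI)
  fix X :: "nat \<Rightarrow> real" assume X: "\<forall>i. X i \<in> UNIV - {0}" "X \<longlonglongrightarrow> 0"
  have X': "filterlim X (at 0) sequentially"
    using X by (auto simp: filterlim_at)
  have "(\<lambda>i. \<integral>x. (h (\<theta> + X i) x - h \<theta> x) / X i \<partial>M) \<longlonglongrightarrow> (\<integral>x. h' \<theta> x \<partial>M)"
  proof (rule integral_dominated_convergence[where w=g])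
    show "AE x in M. (\<lambda>i. (h (\<theta> + X i) x - h \<theta> x) / X i) \<longlonglongrightarrow> h' \<theta> x"
    proof (rule AE_I2)
      fix x assume "x \<in> space M"
      then have "((\<lambda>d. (h (\<theta> + d) x - h \<theta> x) / d) \<longlongrightarrow> h' \<theta> x) (at 0)"
        using deriv unfolding DERIV_def by blast
      from filterlim_compose[OF this X'] show "(\<lambda>i. (h (\<theta> + X i) x - h \<theta> x) / X i) \<longlonglongrightarrow> h' \<theta> x" .
    qed
    show "AE x in M. norm ((h (\<theta> + X i) x - h \<theta> x) / X i) \<le> g x" for i
    proof (rule AE_I2)
      fix x assume x: "x \<in> space M"
      have "norm (h (\<theta> + X i) x - h \<theta> x) \<le> g x * norm (\<theta> + X i - \<theta>)"
        by (rule field_differentiable_bound[of UNIV "\<lambda>t. h t x" "\<lambda>t. h' t x"])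
          (use deriv[OF x] bound[OF x] in auto)
      moreover have "X i \<noteq> 0" using X by auto
      ultimately show "norm ((h (\<theta> + X i) x - h \<theta> x) / X i) \<le> g x"
        by (simp add: abs_divide divide_le_eq)
    qed
  qed (use int g meas in \<open>auto simp: borel_measurable_integrable\<close>)
  moreover have "(\<integral>x. (h (\<theta> + X i) x - h \<theta> x) / X i \<partial>M) = ((\<integral>x. h (\<theta> + X i) x \<partial>M) - (\<integral>x. h \<theta> x \<partial>M)) / X i" for i
    using int by (simp add: integral_divide_zero Bochner_Integration.integral_diff del: divide_cancel_right)
  ultimately show "((\<lambda>d. ((\<integral>x. h (\<theta> + d) x \<partial>M) - (\<integral>x. h \<theta> x \<partial>M)) / d) \<circ> X) \<longlonglongrightarrow> (\<integral>x. h' \<theta> x \<partial>M)"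
    by (simp only: o_def)
qed

section \<open>Coordinates of a product of standard normal laws\<close>

lemma measurable_std_normal_component:
  "i \<in> I \<Longrightarrow> (\<lambda>x. x i) \<in> borel_measurable (PiM I (\<lambda>_. std_normal_distribution))"
  using measurable_component_singleton[of i I "\<lambda>_. std_normal_distribution"] by simp

lemma product_prob_space_std_normal: "product_prob_space (\<lambda>_::'i. std_normal_distribution)"
  using prob_space_normal_density[of 1 0]
  by (intro product_prob_spaceI) simp

lemma prob_space_PiM_std_normal: "prob_space (PiM I (\<lambda>_. std_normal_distribution))"
  using prob_space_normal_density[of 1 0] by (intro prob_space_PiM) simp

lemma distr_PiM_std_normal_component:
  "i \<in> I \<Longrightarrow> distr (PiM I (\<lambda>_. std_normal_distribution)) borel (\<lambda>x. x i) = std_normal_distribution"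
  by (subst distr_cong[OF refl, of borel std_normal_distribution _ "\<lambda>x. x i"])
    (auto intro!: distr_PiM_component prob_space_normal_density)

lemma integrable_PiM_std_normal_component:
  assumes "i \<in> I"
  shows "integrable (PiM I (\<lambda>_. std_normal_distribution)) (\<lambda>x. x i ^ k)"
proof -
  have "integrable (distr (PiM I (\<lambda>_. std_normal_distribution)) borel (\<lambda>x. x i)) (\<lambda>x. x ^ k)"
    unfolding distr_PiM_std_normal_component[OF assms] by (rule integrable_std_normal_distribution_moment)
  then show ?thesis
    using assms by (simp add: integrable_distr_eq)
qed

text \<open>Fubini isolates the coordinate \<open>i\<close>, to which Stein's identity applies with
  all other coordinates frozen.\<close>

lemma PiM_std_normal_integration_by_parts:
  fixes f f' :: "('i \<Rightarrow> real) \<Rightarrow> real"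
  assumes I: "finite I" "i \<in> I"
    and meas: "f \<in> borel_measurable (PiM I (\<lambda>_. std_normal_distribution))"
      "f' \<in> borel_measurable (PiM I (\<lambda>_. std_normal_distribution))"
    and deriv: "\<And>x t. ((\<lambda>t. f (x(i := t))) has_real_derivative f' (x(i := t))) (at t)"
    and cont: "\<And>x t. isCont (\<lambda>t. f' (x(i := t))) t"
    and bound: "\<And>x. \<bar>f x\<bar> \<le> B" "\<And>x. \<bar>f' x\<bar> \<le> B"
  shows "(\<integral>x. x i * f x \<partial>PiM I (\<lambda>_. std_normal_distribution)) =
    (\<integral>x. f' x \<partial>PiM I (\<lambda>_. std_normal_distribution))"
proof -
  interpret product_prob_space "\<lambda>_::'i. std_normal_distribution" UNIV
    by (rule product_prob_space_std_normal)
  interpret PS: prob_space "PiM I (\<lambda>_. std_normal_distribution)"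
    by (rule prob_space_PiM_std_normal)
  define J where "J = I - {i}"
  have J: "finite J" "i \<notin> J" "insert i J = I"
    using I by (auto simp: J_def)
  have int1: "integrable (PiM I (\<lambda>_. std_normal_distribution)) (\<lambda>x. x i * f x)"
  proof (rule Bochner_Integration.integrable_bound)
    show "integrable (PiM I (\<lambda>_. std_normal_distribution)) (\<lambda>x. B * (x i)^1)"
      using integrable_PiM_std_normal_component[OF I(2), of 1] by (rule integrable_mult_right)
    show "(\<lambda>x. x i * f x) \<in> borel_measurable (PiM I (\<lambda>_. std_normal_distribution))"
      by (rule borel_measurable_times[OF measurable_std_normal_component[OF I(2)] meas(1)])
    have "\<bar>x i\<bar> * \<bar>f x\<bar> \<le> \<bar>x i\<bar> * \<bar>B\<bar>" for x
      by (intro mult_left_mono order_trans[OF bound(1) abs_ge_self]) auto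
    then show "AE x in PiM I (\<lambda>_. std_normal_distribution). norm (x i * f x) \<le> norm (B * x i ^ 1)"
      by (auto simp: abs_mult mult.commute intro!: AE_I2)
  qed
  have int2: "integrable (PiM I (\<lambda>_. std_normal_distribution)) f'"
    using bound(2) by (intro PS.integrable_const_bound[where B=B] meas AE_I2) auto
  have "(\<integral>x. x i * f x \<partial>PiM I (\<lambda>_. std_normal_distribution)) =
     (\<integral>x. (\<integral>t. t * f (x(i:=t)) \<partial>std_normal_distribution) \<partial>PiM J (\<lambda>_. std_normal_distribution))"
    using product_integral_insert[OF J(1,2), of "\<lambda>x. x i * f x"] int1 J(3) by simp
  also have "\<dots> = (\<integral>x. (\<integral>t. f' (x(i:=t)) \<partial>std_normal_distribution) \<partial>PiM J (\<lambda>_. std_normal_distribution))"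
    by (intro Bochner_Integration.integral_cong refl std_normal_integration_by_parts[where B=B] deriv cont bound)
  also have "\<dots> = (\<integral>x. f' x \<partial>PiM I (\<lambda>_. std_normal_distribution))"
    using product_integral_insert[OF J(1,2), of f'] int2 J(3) by simp
  finally show ?thesis .
qed

text \<open>The sum over \<open>i\<close> is half the derivative of the covariance of
  \<open>X \<theta> x k\<close> and \<open>X \<theta> x l\<close>. Differentiation under the
  integral produces factors \<open>x i * f1 k\<close>, and integration by parts in
  \<open>x i\<close> trades \<open>x i\<close> for second derivatives. The hypotheses on
  \<open>f\<close>, \<open>f1\<close> and \<open>f2\<close> speak of curves because the proof uses
  two kinds of them: varying the angle, and varying a single coordinate of \<open>x\<close>.\<close>

lemma gaussian_interpolation_derivative:
  fixes A :: "'k \<Rightarrow> 'i \<Rightarrow> real" and c c' :: "real \<Rightarrow> 'i \<Rightarrow> real"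
    and f :: "('k \<Rightarrow> real) \<Rightarrow> real" and f1 :: "'k \<Rightarrow> ('k \<Rightarrow> real) \<Rightarrow> real"
    and f2 :: "'k \<Rightarrow> 'k \<Rightarrow> ('k \<Rightarrow> real) \<Rightarrow> real"
    and I :: "'i set" and K :: "'k set"
  defines "P \<equiv> PiM I (\<lambda>_::'i. std_normal_distribution)"
    and "X \<equiv> \<lambda>\<theta> x k. \<Sum>i\<in>I. c \<theta> i * A k i * x i"
  assumes fin: "finite I" "finite K"
    and c: "\<And>i t. i \<in> I \<Longrightarrow> ((\<lambda>t. c t i) has_real_derivative c' t i) (at t)"
    and c': "\<And>i t. i \<in> I \<Longrightarrow> \<bar>c' t i\<bar> \<le> 1"
    and f: "\<And>X X' t. (\<And>k. k \<in> K \<Longrightarrow> ((\<lambda>t. X t k) has_real_derivative X' k) (at t)) \<Longrightarrow>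
      ((\<lambda>t. f (X t)) has_real_derivative (\<Sum>k\<in>K. f1 k (X t) * X' k)) (at t)"
    and f1: "\<And>X X' t k. k \<in> K \<Longrightarrow> (\<And>k. k \<in> K \<Longrightarrow> ((\<lambda>t. X t k) has_real_derivative X' k) (at t)) \<Longrightarrow>
      ((\<lambda>t. f1 k (X t)) has_real_derivative (\<Sum>l\<in>K. f2 k l (X t) * X' l)) (at t)"
    and f2: "\<And>(X :: real \<Rightarrow> 'k \<Rightarrow> real) t k l. k \<in> K \<Longrightarrow> l \<in> K \<Longrightarrow> (\<And>k. k \<in> K \<Longrightarrow> isCont (\<lambda>t. X t k) t) \<Longrightarrow>
      isCont (\<lambda>t. f2 k l (X t)) t"
    and bound: "\<And>X. \<bar>f X\<bar> \<le> B" "\<And>X k. k \<in> K \<Longrightarrow> \<bar>f1 k X\<bar> \<le> B"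
      "\<And>X k l. k \<in> K \<Longrightarrow> l \<in> K \<Longrightarrow> \<bar>f2 k l X\<bar> \<le> B"
    and meas: "\<And>X. (\<And>k. k \<in> K \<Longrightarrow> (\<lambda>x. X x k) \<in> borel_measurable P) \<Longrightarrow> (\<lambda>x. f (X x)) \<in> borel_measurable P"
      "\<And>X k. k \<in> K \<Longrightarrow> (\<And>k. k \<in> K \<Longrightarrow> (\<lambda>x. X x k) \<in> borel_measurable P) \<Longrightarrow> (\<lambda>x. f1 k (X x)) \<in> borel_measurable P"
      "\<And>X k l. k \<in> K \<Longrightarrow> l \<in> K \<Longrightarrow> (\<And>k. k \<in> K \<Longrightarrow> (\<lambda>x. X x k) \<in> borel_measurable P) \<Longrightarrow>
        (\<lambda>x. f2 k l (X x)) \<in> borel_measurable P"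
  shows "((\<lambda>\<theta>. \<integral>x. f (X \<theta> x) \<partial>P) has_real_derivative
    (\<Sum>k\<in>K. \<Sum>l\<in>K. (\<Sum>i\<in>I. c \<theta> i * c' \<theta> i * A k i * A l i) * (\<integral>x. f2 k l (X \<theta> x) \<partial>P))) (at \<theta>)"
proof -
  interpret prob_space P
    unfolding P_def by (rule prob_space_PiM_std_normal)
  have comp: "(\<lambda>x. x i) \<in> borel_measurable P" if "i \<in> I" for i
    unfolding P_def by (rule measurable_std_normal_component[OF that])
  have X_meas: "(\<lambda>x. \<Sum>i\<in>I. a i * x i) \<in> borel_measurable P" for a :: "'i \<Rightarrow> real"
    by (intro borel_measurable_sum borel_measurable_times comp borel_measurable_const)
  have Xm: "(\<lambda>x. X \<theta> x k) \<in> borel_measurable P" for \<theta> k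
    unfolding X_def by (rule X_meas)
  have B0: "0 \<le> B" using bound(1)[of undefined] by linarith
  have X_deriv: "((\<lambda>t. X t x k) has_real_derivative (\<Sum>i\<in>I. c' t i * A k i * x i)) (at t)" for t x k
    unfolding X_def by (auto intro!: derivative_eq_intros c)
  have X_deriv_coord: "((\<lambda>t. X \<theta> (x(i := t)) k) has_real_derivative c \<theta> i * A k i) (at t)" if "i \<in> I" for \<theta> x i k t
  proof -
    have "((\<lambda>t. X \<theta> (x(i := t)) k) has_real_derivative (\<Sum>j\<in>I. if j = i then c \<theta> i * A k i else 0)) (at t)"
      unfolding X_def
    proof (rule DERIV_sum)
      fix j
      show "((\<lambda>t. c \<theta> j * A k j * (x(i := t)) j) has_real_derivative (if j = i then c \<theta> i * A k i else 0)) (at t)"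
        by (cases "j = i") (auto intro!: derivative_eq_intros)
    qed
    then show ?thesis using that fin by simp
  qed
  have int1: "integrable P (\<lambda>x. x i * f1 k (X \<theta> x))" if "i \<in> I" "k \<in> K" for i k \<theta>
  proof (rule Bochner_Integration.integrable_bound)
    show "integrable P (\<lambda>x. B * x i ^ 1)"
      unfolding P_def using integrable_PiM_std_normal_component[OF that(1), of 1] by (rule integrable_mult_right)
    show "(\<lambda>x. x i * f1 k (X \<theta> x)) \<in> borel_measurable P"
      by (intro borel_measurable_times comp that meas Xm)
    have "\<bar>x i\<bar> * \<bar>f1 k (X \<theta> x)\<bar> \<le> \<bar>x i\<bar> * \<bar>B\<bar>" for x
      by (intro mult_left_mono order_trans[OF bound(2) abs_ge_self] that) auto
    then show "AE x in P. norm (x i * f1 k (X \<theta> x)) \<le> norm (B * x i ^ 1)"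
      by (auto simp: abs_mult mult.commute)
  qed
  have int2: "integrable P (\<lambda>x. f2 k l (X \<theta> x))" if "k \<in> K" "l \<in> K" for k l \<theta>
    using bound(3)[OF that] by (intro integrable_const_bound[where B=B] meas Xm that) auto
  have ibp: "(\<integral>x. x i * f1 k (X \<theta> x) \<partial>P) = (\<Sum>l\<in>K. c \<theta> i * A l i * (\<integral>x. f2 k l (X \<theta> x) \<partial>P))"
    if i: "i \<in> I" and k: "k \<in> K" for i k
  proof -
    \<comment> \<open>Stein's identity asks for one constant that dominates both \<open>f1 k\<close>
      and its derivative in the coordinate \<open>i\<close>.\<close>
    define B' where "B' = B + (\<Sum>l\<in>K. B * \<bar>c \<theta> i * A l i\<bar>)"
    have S0: "0 \<le> (\<Sum>l\<in>K. B * \<bar>c \<theta> i * A l i\<bar>)" using B0 by (intro sum_nonneg) auto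
    have "(\<integral>x. x i * f1 k (X \<theta> x) \<partial>P) = (\<integral>x. (\<Sum>l\<in>K. f2 k l (X \<theta> x) * (c \<theta> i * A l i)) \<partial>P)"
      unfolding P_def
    proof (rule PiM_std_normal_integration_by_parts[OF fin(1) i, where B=B'], fold P_def)
      show "(\<lambda>x. f1 k (X \<theta> x)) \<in> borel_measurable P"
        by (intro meas k Xm)
      show "(\<lambda>x. \<Sum>l\<in>K. f2 k l (X \<theta> x) * (c \<theta> i * A l i)) \<in> borel_measurable P"
        by (intro borel_measurable_sum borel_measurable_times borel_measurable_const meas k Xm)
      show "((\<lambda>t. f1 k (X \<theta> (x(i := t)))) has_real_derivative
          (\<Sum>l\<in>K. f2 k l (X \<theta> (x(i := t))) * (c \<theta> i * A l i))) (at t)" for x t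
        by (rule f1[OF k X_deriv_coord[OF i]])
      have "isCont (\<lambda>t. X \<theta> (x(i := t)) k) t" for x t k
        using X_deriv_coord[OF i] by (rule DERIV_isCont)
      then have "isCont (\<lambda>t. f2 k l (X \<theta> (x(i := t)))) t" if "l \<in> K" for x t l
        by (intro f2[where X="\<lambda>t. X \<theta> (x(i := t))", OF k that])
      then show "isCont (\<lambda>t. \<Sum>l\<in>K. f2 k l (X \<theta> (x(i := t))) * (c \<theta> i * A l i)) t" for x t
        by (intro continuous_intros)
      show "\<bar>f1 k (X \<theta> x)\<bar> \<le> B'" for x
        using bound(2)[OF k, of "X \<theta> x"] S0 by (simp add: B'_def)
      have "\<bar>\<Sum>l\<in>K. f2 k l (X \<theta> x) * (c \<theta> i * A l i)\<bar> \<le> (\<Sum>l\<in>K. B * \<bar>c \<theta> i * A l i\<bar>)" for x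
        by (rule order_trans[OF sum_abs], rule sum_mono)
          (auto simp: abs_mult intro!: mult_right_mono bound k)
      then show "\<bar>\<Sum>l\<in>K. f2 k l (X \<theta> x) * (c \<theta> i * A l i)\<bar> \<le> B'" for x
        using B0 by (simp add: B'_def add_increasing)
    qed
    also have "\<dots> = (\<Sum>l\<in>K. c \<theta> i * A l i * (\<integral>x. f2 k l (X \<theta> x) \<partial>P))"
      using int2[OF k] by (subst Bochner_Integration.integral_sum) (auto simp: mult_ac)
    finally show ?thesis .
  qed
  have "((\<lambda>\<theta>. \<integral>x. f (X \<theta> x) \<partial>P) has_real_derivative
      (\<integral>x. (\<Sum>k\<in>K. f1 k (X \<theta> x) * (\<Sum>i\<in>I. c' \<theta> i * A k i * x i)) \<partial>P)) (at \<theta>)"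
  proof (rule has_real_derivative_integral[where g="\<lambda>x. \<Sum>k\<in>K. B * (\<Sum>i\<in>I. \<bar>A k i\<bar> * \<bar>x i\<bar>)"])
    show "integrable P (\<lambda>x. f (X t x))" for t
      using bound(1) by (intro integrable_const_bound[where B=B] meas Xm) auto
    show "((\<lambda>t. f (X t x)) has_real_derivative (\<Sum>k\<in>K. f1 k (X t x) * (\<Sum>i\<in>I. c' t i * A k i * x i))) (at t)" for x t
      by (rule f[OF X_deriv])
    show "\<bar>\<Sum>k\<in>K. f1 k (X t x) * (\<Sum>i\<in>I. c' t i * A k i * x i)\<bar> \<le> (\<Sum>k\<in>K. B * (\<Sum>i\<in>I. \<bar>A k i\<bar> * \<bar>x i\<bar>))" for x t
    proof (rule order_trans[OF sum_abs], rule sum_mono)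
      fix k assume k: "k \<in> K"
      have "\<bar>\<Sum>i\<in>I. c' t i * A k i * x i\<bar> \<le> (\<Sum>i\<in>I. \<bar>A k i\<bar> * \<bar>x i\<bar>)"
      proof (rule order_trans[OF sum_abs], rule sum_mono)
        fix i assume "i \<in> I"
        then have "\<bar>c' t i\<bar> * (\<bar>A k i\<bar> * \<bar>x i\<bar>) \<le> 1 * (\<bar>A k i\<bar> * \<bar>x i\<bar>)"
          using c' by (intro mult_right_mono) auto
        then show "\<bar>c' t i * A k i * x i\<bar> \<le> \<bar>A k i\<bar> * \<bar>x i\<bar>" by (simp add: abs_mult mult_ac)
      qed
      then show "\<bar>f1 k (X t x) * (\<Sum>i\<in>I. c' t i * A k i * x i)\<bar> \<le> B * (\<Sum>i\<in>I. \<bar>A k i\<bar> * \<bar>x i\<bar>)"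
        unfolding abs_mult using bound(2)[OF k] B0 by (intro mult_mono) auto
    qed
    have "integrable P (\<lambda>x. \<bar>x i\<bar>)" if "i \<in> I" for i
      using integrable_PiM_std_normal_component[OF that, of 1] unfolding P_def
      by (intro integrable_abs) simp
    then show "integrable P (\<lambda>x. \<Sum>k\<in>K. B * (\<Sum>i\<in>I. \<bar>A k i\<bar> * \<bar>x i\<bar>))"
      by (intro Bochner_Integration.integrable_sum integrable_mult_right)
    show "(\<lambda>x. \<Sum>k\<in>K. f1 k (X \<theta> x) * (\<Sum>i\<in>I. c' \<theta> i * A k i * x i)) \<in> borel_measurable P"
      by (intro borel_measurable_sum[of K] borel_measurable_times X_meas meas Xm)
  qed
  also have "(\<integral>x. (\<Sum>k\<in>K. f1 k (X \<theta> x) * (\<Sum>i\<in>I. c' \<theta> i * A k i * x i)) \<partial>P) =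
      (\<integral>x. (\<Sum>k\<in>K. \<Sum>i\<in>I. (c' \<theta> i * A k i) * (x i * f1 k (X \<theta> x))) \<partial>P)"
    by (simp add: sum_distrib_left mult_ac)
  also have "\<dots> = (\<Sum>k\<in>K. \<Sum>i\<in>I. (c' \<theta> i * A k i) * (\<integral>x. x i * f1 k (X \<theta> x) \<partial>P))"
    using int1 by (simp add: Bochner_Integration.integral_sum)
  also have "\<dots> = (\<Sum>k\<in>K. \<Sum>i\<in>I. \<Sum>l\<in>K. c \<theta> i * c' \<theta> i * A k i * A l i * (\<integral>x. f2 k l (X \<theta> x) \<partial>P))"
    by (intro sum.cong refl) (simp add: ibp sum_distrib_left mult_ac)
  also have "\<dots> = (\<Sum>k\<in>K. \<Sum>l\<in>K. (\<Sum>i\<in>I. c \<theta> i * c' \<theta> i * A k i * A l i) * (\<integral>x. f2 k l (X \<theta> x) \<partial>P))"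
    by (intro sum.cong refl, subst sum.swap) (simp add: sum_distrib_right)
  finally show ?thesis .
qed

section \<open>A smooth min-max functional\<close>

text \<open>The quotient has the shape of \<open>soft_minmax1\<close>: \<open>e\<close> is an
  exponential, \<open>d\<close> its sum over \<open>s\<close>, and \<open>v\<close> the total
  \<open>soft_sum\<close>.\<close>

lemma DERIV_quotient_squares:
  fixes e d v :: "real \<Rightarrow> real"
  assumes "(e has_real_derivative e') (at t)" "(d has_real_derivative d') (at t)"
    "(v has_real_derivative v') (at t)" "d t \<noteq> 0" "v t \<noteq> 0"
  shows "((\<lambda>t. a * e t / (d t)\<^sup>2 / (v t)\<^sup>2) has_real_derivative
    a * e' / (d t)\<^sup>2 / (v t)\<^sup>2 - 2 * a * e t * d' / d t ^ 3 / (v t)\<^sup>2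
      - 2 * a * e t / (d t)\<^sup>2 * v' / v t ^ 3) (at t)"
  using assms(4,5)
  by (auto intro!: derivative_eq_intros assms(1-3) simp: field_simps power2_eq_square power3_eq_cube)

lemma divide_square_le_1:
  fixes w V :: real
  assumes "w \<le> V" "1 \<le> V"
  shows "w / V\<^sup>2 \<le> 1"
proof -
  have "V * 1 \<le> V * V" using assms by (intro mult_left_mono) auto
  then have "w \<le> V * V" using assms by linarith
  then show ?thesis using assms by (simp add: divide_le_eq power2_eq_square)
qed

text \<open>As \<open>\<alpha>\<close> tends to infinity, \<open>soft_minmax\<close> tends to the indicator of
  \<open>min\<^sub>y max\<^sub>s X (s, y) > \<tau>\<close> off the boundary. Its mixed second derivatives are nonnegative for
  coordinates with different \<open>y\<close>, which is the sign condition in Gordon's comparison.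
  \<open>soft_minmax1\<close> and \<open>soft_minmax2\<close> are the first and second partial derivatives.\<close>

context
  fixes T :: "'s set" and Y :: "'y set" and \<alpha> \<tau> :: real
begin

definition soft_exp :: "'s \<times> 'y \<Rightarrow> ('s \<times> 'y \<Rightarrow> real) \<Rightarrow> real" where
  "soft_exp k X = exp (\<alpha> * (X k - \<tau>))"

definition soft_max :: "'y \<Rightarrow> ('s \<times> 'y \<Rightarrow> real) \<Rightarrow> real" where
  "soft_max y X = (\<Sum>s\<in>T. soft_exp (s, y) X)"

text \<open>A sum of exponentials imitates a maximum, and reciprocals turn the minimum over
  \<open>y\<close> into a sum dominated by its largest term. The summand 1 sends the result into the
  unit interval after inversion and keeps all derivatives bounded uniformly in
  \<open>X\<close>.\<close>

definition soft_sum :: "('s \<times> 'y \<Rightarrow> real) \<Rightarrow> real" where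
  "soft_sum X = 1 + (\<Sum>y\<in>Y. 1 / soft_max y X)"

definition soft_minmax :: "('s \<times> 'y \<Rightarrow> real) \<Rightarrow> real" where
  "soft_minmax X = 1 / soft_sum X"

definition soft_minmax1 :: "'s \<times> 'y \<Rightarrow> ('s \<times> 'y \<Rightarrow> real) \<Rightarrow> real" where
  "soft_minmax1 k X = \<alpha> * soft_exp k X / (soft_max (snd k) X)\<^sup>2 / (soft_sum X)\<^sup>2"

definition soft_minmax2 :: "'s \<times> 'y \<Rightarrow> 's \<times> 'y \<Rightarrow> ('s \<times> 'y \<Rightarrow> real) \<Rightarrow> real" where
  "soft_minmax2 k l X =
    (if k = l then \<alpha>\<^sup>2 * soft_exp k X / (soft_max (snd k) X)\<^sup>2 / (soft_sum X)\<^sup>2 else 0)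
    - (if snd k = snd l then 2 * \<alpha>\<^sup>2 * soft_exp k X * soft_exp l X / (soft_max (snd k) X) ^ 3 / (soft_sum X)\<^sup>2 else 0)
    + 2 * \<alpha>\<^sup>2 * (soft_exp k X / (soft_max (snd k) X)\<^sup>2) * (soft_exp l X / (soft_max (snd l) X)\<^sup>2) / (soft_sum X) ^ 3"

context
  assumes fin: "finite T" "finite Y" and ne: "T \<noteq> {}"
begin

lemma soft_exp_pos: "soft_exp k X > 0"
  by (simp add: soft_exp_def)

lemma soft_max_pos: "soft_max y X > 0"
  unfolding soft_max_def using fin ne by (intro sum_pos soft_exp_pos)

lemma soft_exp_le_max: "fst k \<in> T \<Longrightarrow> soft_exp k X \<le> soft_max (snd k) X"
  unfolding soft_max_def using fin member_le_sum[of "fst k" T "\<lambda>s. soft_exp (s, snd k) X"] soft_exp_pos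
  by (simp add: less_imp_le)

lemma soft_sum_ge_1: "soft_sum X \<ge> 1"
  unfolding soft_sum_def using soft_max_pos by (simp add: sum_nonneg less_imp_le)

lemma inverse_soft_max_le: "y \<in> Y \<Longrightarrow> 1 / soft_max y X \<le> soft_sum X"
  using member_le_sum[of y Y "\<lambda>y. 1 / soft_max y X"] fin soft_max_pos[of _ X]
  unfolding soft_sum_def by (simp add: less_imp_le)

lemma DERIV_soft_sum:
  assumes "\<And>k. k \<in> T \<times> Y \<Longrightarrow> ((\<lambda>t. X t k) has_real_derivative X' k) (at t)"
  shows "((\<lambda>t. soft_sum (X t)) has_real_derivative
    - (\<Sum>k\<in>T \<times> Y. \<alpha> * soft_exp k (X t) / (soft_max (snd k) (X t))\<^sup>2 * X' k)) (at t)"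
    and "y \<in> Y \<Longrightarrow> ((\<lambda>t. soft_max y (X t)) has_real_derivative (\<Sum>s\<in>T. \<alpha> * soft_exp (s, y) (X t) * X' (s, y))) (at t)"
    and "k \<in> T \<times> Y \<Longrightarrow> ((\<lambda>t. soft_exp k (X t)) has_real_derivative \<alpha> * soft_exp k (X t) * X' k) (at t)"
proof -
  show e: "((\<lambda>t. soft_exp k (X t)) has_real_derivative \<alpha> * soft_exp k (X t) * X' k) (at t)" if "k \<in> T \<times> Y" for k
    unfolding soft_exp_def using assms[OF that] by (auto intro!: derivative_eq_intros)
  show d: "((\<lambda>t. soft_max y (X t)) has_real_derivative (\<Sum>s\<in>T. \<alpha> * soft_exp (s, y) (X t) * X' (s, y))) (at t)" if "y \<in> Y" for y
    unfolding soft_max_def using that by (intro DERIV_sum e) auto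
  have "((\<lambda>t. soft_sum (X t)) has_real_derivative
     (\<Sum>y\<in>Y. - (\<Sum>s\<in>T. \<alpha> * soft_exp (s, y) (X t) * X' (s, y)) / (soft_max y (X t))\<^sup>2)) (at t)"
    unfolding soft_sum_def
    by (rule derivative_eq_intros DERIV_sum d refl | assumption)+
      (use soft_max_pos in \<open>auto simp: less_imp_neq[symmetric] power2_eq_square divide_simps\<close>)
  also have "(\<Sum>y\<in>Y. - (\<Sum>s\<in>T. \<alpha> * soft_exp (s, y) (X t) * X' (s, y)) / (soft_max y (X t))\<^sup>2) =
     - (\<Sum>y\<in>Y. \<Sum>s\<in>T. \<alpha> * soft_exp (s, y) (X t) / (soft_max y (X t))\<^sup>2 * X' (s, y))"
    by (simp add: sum_divide_distrib sum_negf)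
  also have "\<dots> = - (\<Sum>k\<in>T \<times> Y. \<alpha> * soft_exp k (X t) / (soft_max (snd k) (X t))\<^sup>2 * X' k)"
    by (subst sum.swap) (simp add: sum.cartesian_product case_prod_unfold)
  finally show "((\<lambda>t. soft_sum (X t)) has_real_derivative
    - (\<Sum>k\<in>T \<times> Y. \<alpha> * soft_exp k (X t) / (soft_max (snd k) (X t))\<^sup>2 * X' k)) (at t)" .
qed

lemma DERIV_soft_minmax:
  assumes "\<And>k. k \<in> T \<times> Y \<Longrightarrow> ((\<lambda>t. X t k) has_real_derivative X' k) (at t)"
  shows "((\<lambda>t. soft_minmax (X t)) has_real_derivative (\<Sum>k\<in>T \<times> Y. soft_minmax1 k (X t) * X' k)) (at t)"
proof -
  have "soft_sum (X t) \<noteq> 0" using soft_sum_ge_1[of "X t"] by linarith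
  then have "((\<lambda>t. soft_minmax (X t)) has_real_derivative
      - (- (\<Sum>k\<in>T \<times> Y. \<alpha> * soft_exp k (X t) / (soft_max (snd k) (X t))\<^sup>2 * X' k)) / (soft_sum (X t))\<^sup>2) (at t)"
    unfolding soft_minmax_def
    by (auto intro!: derivative_eq_intros DERIV_soft_sum(1)[where X=X and X'=X'] assms simp: power2_eq_square)
  then show ?thesis
    by (simp add: soft_minmax1_def sum_divide_distrib)
qed

lemma DERIV_soft_minmax1:
  assumes k: "k \<in> T \<times> Y"
    and X: "\<And>k. k \<in> T \<times> Y \<Longrightarrow> ((\<lambda>t. X t k) has_real_derivative X' k) (at t)"
  shows "((\<lambda>t. soft_minmax1 k (X t)) has_real_derivative (\<Sum>l\<in>T \<times> Y. soft_minmax2 k l (X t) * X' l)) (at t)"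
proof -
  let ?E = "\<lambda>k. soft_exp k (X t)" and ?D = "\<lambda>y. soft_max y (X t)" and ?V = "soft_sum (X t)"
  have V: "?V \<noteq> 0" using soft_sum_ge_1[of "X t"] by linarith
  have D: "?D y \<noteq> 0" for y using soft_max_pos[of y "X t"] by linarith
  have ky: "snd k \<in> Y" using k by auto
  let ?dE = "\<alpha> * ?E k * X' k"
  let ?dD = "\<Sum>s\<in>T. \<alpha> * ?E (s, snd k) * X' (s, snd k)"
  let ?dV = "- (\<Sum>l\<in>T \<times> Y. \<alpha> * ?E l / (?D (snd l))\<^sup>2 * X' l)"
  have "((\<lambda>t. soft_minmax1 k (X t)) has_real_derivative
     \<alpha> * ?dE / (?D (snd k))\<^sup>2 / ?V\<^sup>2 - 2 * \<alpha> * ?E k * ?dD / (?D (snd k)) ^ 3 / ?V\<^sup>2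
      - 2 * \<alpha> * ?E k / (?D (snd k))\<^sup>2 * ?dV / ?V ^ 3) (at t)"
    unfolding soft_minmax1_def
    by (rule DERIV_quotient_squares DERIV_soft_sum[where X=X and X'=X'] X k ky V D | assumption)+
  moreover have "\<alpha> * ?dE / (?D (snd k))\<^sup>2 / ?V\<^sup>2 =
      (\<Sum>l\<in>T \<times> Y. (if k = l then \<alpha>\<^sup>2 * ?E k / (?D (snd k))\<^sup>2 / ?V\<^sup>2 else 0) * X' l)"
    using k fin by (simp add: if_distrib[where f="\<lambda>x. x * _"] power2_eq_square cong: if_cong)
  moreover have "2 * \<alpha> * ?E k * ?dD / (?D (snd k)) ^ 3 / ?V\<^sup>2 =
      (\<Sum>l\<in>T \<times> Y. (if snd k = snd l then 2 * \<alpha>\<^sup>2 * ?E k * ?E l / (?D (snd k)) ^ 3 / ?V\<^sup>2 else 0) * X' l)"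
  proof -
    have "(\<Sum>l\<in>T \<times> Y. (if snd k = snd l then 2 * \<alpha>\<^sup>2 * ?E k * ?E l / (?D (snd k)) ^ 3 / ?V\<^sup>2 else 0) * X' l) =
        (\<Sum>s\<in>T. \<Sum>y\<in>Y. if snd k = y then 2 * \<alpha>\<^sup>2 * ?E k * ?E (s, y) / (?D (snd k)) ^ 3 / ?V\<^sup>2 * X' (s, y) else 0)"
      by (subst sum.cartesian_product) (auto intro!: sum.cong)
    also have "\<dots> = (\<Sum>s\<in>T. 2 * \<alpha>\<^sup>2 * ?E k * ?E (s, snd k) / (?D (snd k)) ^ 3 / ?V\<^sup>2 * X' (s, snd k))"
      using fin ky by simp
    finally show ?thesis
      by (simp add: sum_distrib_left sum_divide_distrib power2_eq_square mult_ac)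
  qed
  moreover have "2 * \<alpha> * ?E k / (?D (snd k))\<^sup>2 * ?dV / ?V ^ 3 =
      - (\<Sum>l\<in>T \<times> Y. 2 * \<alpha>\<^sup>2 * (?E k / (?D (snd k))\<^sup>2) * (?E l / (?D (snd l))\<^sup>2) / ?V ^ 3 * X' l)"
    by (simp add: sum_distrib_left sum_divide_distrib power2_eq_square mult_ac)
  ultimately show ?thesis
    unfolding soft_minmax2_def by (simp add: algebra_simps sum.distrib sum_subtractf)
qed

lemma soft_minmax_bounds: "0 < soft_minmax X" "soft_minmax X \<le> 1"
  using soft_sum_ge_1[of X] by (auto simp: soft_minmax_def divide_le_eq)

text \<open>The weight is a share of \<open>soft_max\<close>, hence at most 1, times a reciprocal
  that occurs as a summand of \<open>soft_sum\<close>.\<close>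

lemma soft_weight_bounds:
  assumes "k \<in> T \<times> Y"
  shows "0 \<le> soft_exp k X / (soft_max (snd k) X)\<^sup>2" "soft_exp k X / (soft_max (snd k) X)\<^sup>2 \<le> soft_sum X"
proof -
  have "soft_exp k X / (soft_max (snd k) X)\<^sup>2 = (soft_exp k X / soft_max (snd k) X) * (1 / soft_max (snd k) X)"
    by (simp add: power2_eq_square)
  also have "\<dots> \<le> 1 * soft_sum X"
    using assms soft_exp_le_max[of k X] soft_max_pos[of "snd k" X] soft_exp_pos[of k X]
    by (intro mult_mono inverse_soft_max_le) (auto simp: divide_le_eq less_imp_le)
  finally show "soft_exp k X / (soft_max (snd k) X)\<^sup>2 \<le> soft_sum X" by simp
qed (simp add: soft_exp_pos less_imp_le)

lemma soft_minmax1_bound: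
  assumes "k \<in> T \<times> Y"
  shows "\<bar>soft_minmax1 k X\<bar> \<le> \<bar>\<alpha>\<bar>"
proof -
  let ?w = "soft_exp k X / (soft_max (snd k) X)\<^sup>2" and ?V = "soft_sum X"
  have "?w / ?V\<^sup>2 \<le> 1"
    using soft_weight_bounds[OF assms] soft_sum_ge_1 by (intro divide_square_le_1)
  then have "\<bar>\<alpha>\<bar> * (?w / ?V\<^sup>2) \<le> \<bar>\<alpha>\<bar> * 1" by (intro mult_left_mono) auto
  moreover have "\<bar>soft_minmax1 k X\<bar> = \<bar>\<alpha>\<bar> * (?w / ?V\<^sup>2)"
    using soft_weight_bounds(1)[OF assms, of X] by (simp add: soft_minmax1_def abs_mult soft_exp_pos less_imp_le)
  ultimately show ?thesis by simp
qed

text \<open>The three terms of \<open>soft_minmax2\<close> contribute 1, 2 and 2: apart from these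
  coefficients and \<alpha> squared, each is a product of factors bounded by 1.\<close>

lemma soft_minmax2_bound:
  assumes k: "k \<in> T \<times> Y" and l: "l \<in> T \<times> Y"
  shows "\<bar>soft_minmax2 k l X\<bar> \<le> 5 * \<alpha>\<^sup>2"
proof -
  let ?w = "\<lambda>k. soft_exp k X / (soft_max (snd k) X)\<^sup>2" and ?V = "soft_sum X"
  have V: "1 \<le> ?V" by (rule soft_sum_ge_1)
  have w: "0 \<le> ?w k" "?w k \<le> ?V" "0 \<le> ?w l" "?w l \<le> ?V"
    using soft_weight_bounds k l by auto
  have 1: "?w k / ?V\<^sup>2 \<le> 1"
    by (rule divide_square_le_1[OF w(2) V])
  have 2: "soft_exp l X / soft_max (snd k) X \<le> 1" if "snd k = snd l"
    using soft_exp_le_max[of l X] l soft_max_pos[of "snd k" X] that by (auto simp: divide_le_eq)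
  have 3: "?w k * ?w l / ?V ^ 3 \<le> 1"
  proof -
    have "?w k * ?w l \<le> ?V * ?V" using w V by (intro mult_mono) auto
    also have "\<dots> \<le> ?V ^ 3" using V mult_left_mono[of 1 ?V "?V * ?V"] by (simp add: power3_eq_cube mult_ac)
    finally show ?thesis using V by (subst divide_le_eq_1_pos) auto
  qed
  have "\<bar>if k = l then \<alpha>\<^sup>2 * soft_exp k X / (soft_max (snd k) X)\<^sup>2 / ?V\<^sup>2 else 0\<bar> \<le> \<alpha>\<^sup>2"
    using mult_left_mono[OF 1, of "\<alpha>\<^sup>2"] soft_exp_pos[of k X] by (cases "k = l") (auto simp: less_imp_le)
  moreover have "\<bar>if snd k = snd l then 2 * \<alpha>\<^sup>2 * soft_exp k X * soft_exp l X / (soft_max (snd k) X) ^ 3 / ?V\<^sup>2 else 0\<bar> \<le> 2 * \<alpha>\<^sup>2"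
  proof (cases "snd k = snd l")
    case True
    have "(?w k / ?V\<^sup>2) * (soft_exp l X / soft_max (snd k) X) \<le> 1 * 1"
      using 1 2[OF True] soft_exp_pos[of l X] soft_max_pos[of "snd k" X] by (intro mult_mono) (auto simp: less_imp_le)
    then have "2 * \<alpha>\<^sup>2 * ((?w k / ?V\<^sup>2) * (soft_exp l X / soft_max (snd k) X)) \<le> 2 * \<alpha>\<^sup>2 * 1"
      by (intro mult_left_mono) auto
    moreover have "2 * \<alpha>\<^sup>2 * soft_exp k X * soft_exp l X / (soft_max (snd k) X) ^ 3 / ?V\<^sup>2 =
        2 * \<alpha>\<^sup>2 * ((?w k / ?V\<^sup>2) * (soft_exp l X / soft_max (snd k) X))"
      by (simp add: power3_eq_cube power2_eq_square mult_ac)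
    moreover have "0 \<le> (?w k / ?V\<^sup>2) * (soft_exp l X / soft_max (snd k) X)"
      using w(1) soft_exp_pos[of k X] soft_exp_pos[of l X] soft_max_pos[of "snd k" X] V by (intro mult_nonneg_nonneg divide_nonneg_nonneg) auto
    then have "0 \<le> 2 * \<alpha>\<^sup>2 * ((?w k / ?V\<^sup>2) * (soft_exp l X / soft_max (snd k) X))"
      by (rule mult_nonneg_nonneg[rotated]) simp
    ultimately show ?thesis using True by simp
  qed auto
  moreover have "\<bar>2 * \<alpha>\<^sup>2 * ?w k * ?w l / ?V ^ 3\<bar> \<le> 2 * \<alpha>\<^sup>2"
  proof -
    have "0 \<le> ?w k * ?w l / ?V ^ 3"
      by (rule divide_nonneg_nonneg[OF mult_nonneg_nonneg[OF w(1) w(3)]]) (use V in auto)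
    then show ?thesis
      using mult_left_mono[OF 3, of "2 * \<alpha>\<^sup>2"] mult_nonneg_nonneg[of "2 * \<alpha>\<^sup>2" "?w k * ?w l / ?V ^ 3"]
      by (simp add: mult.assoc)
  qed
  ultimately show ?thesis unfolding soft_minmax2_def by linarith
qed

text \<open>For different \<open>y\<close> the two terms guarded by conditionals vanish, and the
  remaining one is a product of weights.\<close>

lemma soft_minmax2_nonneg:
  assumes "k \<in> T \<times> Y" "l \<in> T \<times> Y" "snd k \<noteq> snd l"
  shows "0 \<le> soft_minmax2 k l X"
proof -
  have "k \<noteq> l" using assms by auto
  then show ?thesis
    unfolding soft_minmax2_def using assms soft_weight_bounds(1)[of k X] soft_weight_bounds(1)[of l X] soft_sum_ge_1[of X]
    by (auto intro!: mult_nonneg_nonneg divide_nonneg_nonneg less_imp_le[OF soft_exp_pos])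
qed

lemma isCont_soft_minmax2:
  assumes k: "k \<in> T \<times> Y" "l \<in> T \<times> Y" and X: "\<And>k. k \<in> T \<times> Y \<Longrightarrow> isCont (\<lambda>t. X t k) t"
  shows "isCont (\<lambda>t. soft_minmax2 k l (X t)) t"
proof -
  have e: "isCont (\<lambda>t. soft_exp k (X t)) t" if "k \<in> T \<times> Y" for k
    unfolding soft_exp_def by (intro continuous_intros X that)
  have d: "isCont (\<lambda>t. soft_max y (X t)) t" if "y \<in> Y" for y
    unfolding soft_max_def using that by (intro continuous_intros e) auto
  have d0: "soft_max y X \<noteq> 0" for y X using soft_max_pos[of y X] by linarith
  have v: "isCont (\<lambda>t. soft_sum (X t)) t"
    unfolding soft_sum_def by (intro continuous_intros d d0)
  have v0: "soft_sum X \<noteq> 0" for X using soft_sum_ge_1[of X] by linarith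
  have y: "snd k \<in> Y" "snd l \<in> Y" using k by auto
  show ?thesis
    unfolding soft_minmax2_def
    by (cases "k = l"; cases "snd k = snd l"; simp; intro continuous_intros e d v k y) (auto simp: d0 v0)
qed

lemma measurable_soft_minmax:
  assumes X: "\<And>k. k \<in> T \<times> Y \<Longrightarrow> (\<lambda>x. X x k) \<in> borel_measurable P"
  shows "(\<lambda>x. soft_minmax (X x)) \<in> borel_measurable P"
    and "k \<in> T \<times> Y \<Longrightarrow> (\<lambda>x. soft_minmax1 k (X x)) \<in> borel_measurable P"
    and "k \<in> T \<times> Y \<Longrightarrow> l \<in> T \<times> Y \<Longrightarrow> (\<lambda>x. soft_minmax2 k l (X x)) \<in> borel_measurable P"
proof -
  have e: "(\<lambda>x. soft_exp k (X x)) \<in> borel_measurable P" if "k \<in> T \<times> Y" for k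
    unfolding soft_exp_def using X[OF that] by simp
  have d: "(\<lambda>x. soft_max y (X x)) \<in> borel_measurable P" if "y \<in> Y" for y
    unfolding soft_max_def using that by (intro borel_measurable_sum e) auto
  have v: "(\<lambda>x. soft_sum (X x)) \<in> borel_measurable P"
    unfolding soft_sum_def by (intro borel_measurable_add borel_measurable_sum borel_measurable_divide d borel_measurable_const)
  show "(\<lambda>x. soft_minmax (X x)) \<in> borel_measurable P"
    unfolding soft_minmax_def using v by simp
  show "(\<lambda>x. soft_minmax1 k (X x)) \<in> borel_measurable P" if "k \<in> T \<times> Y"
    unfolding soft_minmax1_def using v e[OF that] d[of "snd k"] that by auto
  show "(\<lambda>x. soft_minmax2 k l (X x)) \<in> borel_measurable P" if "k \<in> T \<times> Y" "l \<in> T \<times> Y"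
  proof -
    have "snd k \<in> Y" "snd l \<in> Y" using that by auto
    then show ?thesis
      unfolding soft_minmax2_def using v e[OF that(1)] e[OF that(2)] d
      by (cases "k = l"; cases "snd k = snd l") simp_all
  qed
qed

end
end

section \<open>Gordon's comparison inequality\<close>

text \<open>The Gaussian matrix gets an extra row \<open>g\<close>, an extra column \<open>h\<close> and a corner entry \<open>\<gamma>\<close>. With
  \<open>y\<close> extended by \<open>1\<close> and \<open>z\<close> extended by \<open>R\<close>, rotating the angle from \<open>0\<close> to \<open>\<pi>/2\<close> moves the weight from
  \<open>\<langle>G z, y\<rangle> + R \<gamma>\<close> to \<open>\<langle>z, g\<rangle> + R \<langle>h, y\<rangle>\<close>; the corner term makes the two variances equal when
  \<open>y\<close> is a unit vector.\<close>

definition bordered_coeff :: "nat \<Rightarrow> nat \<Rightarrow> real \<Rightarrow> ('s \<Rightarrow> nat \<Rightarrow> real) \<Rightarrow> 's \<times> (nat \<Rightarrow> real) \<Rightarrow> nat \<times> nat \<Rightarrow> real" where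
  "bordered_coeff M N R z k e =
    (if fst e < M then snd k (fst e) else 1) * (if snd e < N then z (fst k) (snd e) else R)"

definition bordered_angle :: "nat \<Rightarrow> nat \<Rightarrow> real \<Rightarrow> nat \<times> nat \<Rightarrow> real" where
  "bordered_angle M N \<theta> e = (if (fst e < M) = (snd e < N) then cos \<theta> else sin \<theta>)"

definition bordered_process ::
    "nat \<Rightarrow> nat \<Rightarrow> real \<Rightarrow> ('s \<Rightarrow> nat \<Rightarrow> real) \<Rightarrow> real \<Rightarrow> (nat \<times> nat \<Rightarrow> real) \<Rightarrow> 's \<times> (nat \<Rightarrow> real) \<Rightarrow> real" where
  "bordered_process M N R z \<theta> x k =
    (\<Sum>e\<in>{..M} \<times> {..N}. bordered_angle M N \<theta> e * bordered_coeff M N R z k e * x e)"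

abbreviation bordered_normal :: "nat \<Rightarrow> nat \<Rightarrow> (nat \<times> nat \<Rightarrow> real) measure" where
  "bordered_normal M N \<equiv> PiM ({..M} \<times> {..N}) (\<lambda>_. std_normal_distribution)"

lemma sum_bordered:
  fixes h :: "nat \<Rightarrow> nat \<Rightarrow> real"
  shows "(\<Sum>e\<in>{..M} \<times> {..N}. h (fst e) (snd e)) =
    (\<Sum>j<M. \<Sum>i<N. h j i) + (\<Sum>j<M. h j N) + (\<Sum>i<N. h M i) + h M N"
  unfolding lessThan_Suc_atMost[symmetric]
  by (simp add: sum.cartesian_product' sum.distrib)

lemma bordered_process_0:
  "bordered_process M N R z 0 x (s, y) = (\<Sum>j<M. \<Sum>i<N. y j * z s i * x (j, i)) + R * x (M, N)"
  unfolding bordered_process_def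
  using sum_bordered[of "\<lambda>j i. bordered_angle M N 0 (j, i) * bordered_coeff M N R z (s, y) (j, i) * x (j, i)" M N]
  by (simp add: bordered_angle_def bordered_coeff_def)

lemma bordered_process_pi_half:
  "bordered_process M N R z (pi / 2) x (s, y) = (\<Sum>i<N. z s i * x (M, i)) + R * (\<Sum>j<M. y j * x (j, N))"
  unfolding bordered_process_def
  using sum_bordered[of "\<lambda>j i. bordered_angle M N (pi/2) (j, i) * bordered_coeff M N R z (s, y) (j, i) * x (j, i)" M N]
  by (simp add: bordered_angle_def bordered_coeff_def sum_distrib_left mult_ac)

lemma sum_mult_le_of_squares:
  fixes u v :: "'a \<Rightarrow> real"
  assumes "(\<Sum>i\<in>A. (u i)\<^sup>2) \<le> C" "(\<Sum>i\<in>A. (v i)\<^sup>2) \<le> C"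
  shows "(\<Sum>i\<in>A. u i * v i) \<le> C"
proof -
  have "(\<Sum>i\<in>A. u i * v i) \<le> (\<Sum>i\<in>A. ((u i)\<^sup>2 + (v i)\<^sup>2) / 2)"
  proof (rule sum_mono)
    fix i show "u i * v i \<le> ((u i)\<^sup>2 + (v i)\<^sup>2) / 2"
      using sum_squares_bound[of "u i" "v i"] by simp
  qed
  also have "\<dots> = ((\<Sum>i\<in>A. (u i)\<^sup>2) + (\<Sum>i\<in>A. (v i)\<^sup>2)) / 2"
    by (simp add: sum.distrib sum_divide_distrib[symmetric])
  also have "\<dots> \<le> (C + C) / 2"
    using assms by (intro divide_right_mono add_mono) auto
  finally show ?thesis by simp
qed

text \<open>Write S and Z for the inner products of the \<open>y\<close> and of the
  \<open>z\<close>. Up to the factor sin \<theta> cos \<theta>, the four parts of the bordered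
  matrix contribute - S Z (inner block), S R^2 (last column), Z (last row) and - R^2 (corner); the
  corner is what makes the total factor.\<close>

lemma bordered_covariance:
  "(\<Sum>e\<in>{..M} \<times> {..N}. bordered_angle M N \<theta> e *
      (if (fst e < M) = (snd e < N) then - sin \<theta> else cos \<theta>) *
      bordered_coeff M N R z (s, y) e * bordered_coeff M N R z (s', y') e) =
    - (sin \<theta> * cos \<theta>) * (((\<Sum>j<M. y j * y' j) - 1) * ((\<Sum>i<N. z s i * z s' i) - R\<^sup>2))"
proof -
  define S Z where "S = (\<Sum>j<M. y j * y' j)" and "Z = (\<Sum>i<N. z s i * z s' i)"
  have "(\<Sum>j<M. \<Sum>i<N. cos \<theta> * (- sin \<theta>) * (y j * z s i) * (y' j * z s' i)) = - (sin \<theta> * cos \<theta>) * (S * Z)"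
  proof -
    have "S * Z = (\<Sum>j<M. \<Sum>i<N. (y j * y' j) * (z s i * z s' i))"
      unfolding S_def Z_def by (rule sum_product)
    then show ?thesis
      by (simp only: sum_distrib_left) (intro sum.cong refl, simp)
  qed
  moreover have "(\<Sum>j<M. sin \<theta> * cos \<theta> * (y j * R) * (y' j * R)) = (sin \<theta> * cos \<theta>) * (S * R\<^sup>2)"
    by (simp add: S_def sum_distrib_left sum_distrib_right power2_eq_square mult_ac)
  moreover have "(\<Sum>i<N. sin \<theta> * cos \<theta> * z s i * z s' i) = (sin \<theta> * cos \<theta>) * Z"
    by (simp add: Z_def sum_distrib_left mult_ac)
  ultimately show ?thesis
    using sum_bordered[of "\<lambda>j i. bordered_angle M N \<theta> (j, i) *
        (if (j < M) = (i < N) then - sin \<theta> else cos \<theta>) *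
        bordered_coeff M N R z (s, y) (j, i) * bordered_coeff M N R z (s', y') (j, i)" M N]
    unfolding S_def[symmetric] Z_def[symmetric]
    by (simp add: bordered_angle_def bordered_coeff_def algebra_simps power2_eq_square)
qed

text \<open>The derivative in the angle is a sum of covariance derivatives times expected second
  derivatives of the functional. Pairs with different \<open>y\<close> have covariance derivative
  \<le> 0 and second derivative \<ge> 0; pairs with equal \<open>y\<close> drop out.\<close>

lemma gordon_expectation:
  fixes T :: "'s set" and Y :: "(nat \<Rightarrow> real) set" and z :: "'s \<Rightarrow> nat \<Rightarrow> real"
  assumes T: "finite T" "T \<noteq> {}" and Y: "finite Y"
    and unit: "\<And>y. y \<in> Y \<Longrightarrow> (\<Sum>j<M. (y j)\<^sup>2) = 1"
    and z: "\<And>s. s \<in> T \<Longrightarrow> (\<Sum>i<N. (z s i)\<^sup>2) \<le> R\<^sup>2"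
  shows "(\<integral>x. soft_minmax T Y \<alpha> \<tau> (bordered_process M N R z (pi / 2) x) \<partial>bordered_normal M N) \<le>
    (\<integral>x. soft_minmax T Y \<alpha> \<tau> (bordered_process M N R z 0 x) \<partial>bordered_normal M N)"
proof (rule DERIV_nonpos_imp_nonincreasing[where f="\<lambda>\<theta>. \<integral>x. soft_minmax T Y \<alpha> \<tau> (bordered_process M N R z \<theta> x) \<partial>bordered_normal M N"])
  fix \<theta> :: real assume \<theta>: "0 \<le> \<theta>" "\<theta> \<le> pi / 2"
  let ?c' = "\<lambda>\<theta> e. if (fst e < M) = (snd e < N) then - sin \<theta> else cos \<theta>"
  let ?cov = "\<lambda>k l. \<Sum>e\<in>{..M} \<times> {..N}. bordered_angle M N \<theta> e * ?c' \<theta> e * bordered_coeff M N R z k e * bordered_coeff M N R z l e"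
  let ?f2 = "\<lambda>k l. \<integral>x. soft_minmax2 T Y \<alpha> \<tau> k l (bordered_process M N R z \<theta> x) \<partial>bordered_normal M N"
  have B: "\<bar>\<alpha>\<bar> \<le> 1 + \<bar>\<alpha>\<bar> + 5 * \<alpha>\<^sup>2" "5 * \<alpha>\<^sup>2 \<le> 1 + \<bar>\<alpha>\<bar> + 5 * \<alpha>\<^sup>2" "1 \<le> 1 + \<bar>\<alpha>\<bar> + 5 * \<alpha>\<^sup>2"
    by auto
  have "((\<lambda>\<theta>. \<integral>x. soft_minmax T Y \<alpha> \<tau> (bordered_process M N R z \<theta> x) \<partial>bordered_normal M N) has_real_derivative
     (\<Sum>k\<in>T\<times>Y. \<Sum>l\<in>T\<times>Y. ?cov k l * ?f2 k l)) (at \<theta>)"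
    unfolding bordered_process_def[abs_def]
  proof (rule gaussian_interpolation_derivative[where c="bordered_angle M N" and c'="?c'" and
        f="soft_minmax T Y \<alpha> \<tau>" and ?f1.0="soft_minmax1 T Y \<alpha> \<tau>" and ?f2.0="soft_minmax2 T Y \<alpha> \<tau>"
        and B="1 + \<bar>\<alpha>\<bar> + 5 * \<alpha>\<^sup>2"])
    show "((\<lambda>t. bordered_angle M N t e) has_real_derivative ?c' t e) (at t)" for e t
      by (auto simp: bordered_angle_def intro!: derivative_eq_intros)
    show "\<bar>?c' t e\<bar> \<le> 1" for t :: real and e :: "nat \<times> nat"
      using abs_sin_le_one[of t] abs_cos_le_one[of t] by auto
    show "\<bar>soft_minmax T Y \<alpha> \<tau> X\<bar> \<le> 1 + \<bar>\<alpha>\<bar> + 5 * \<alpha>\<^sup>2" for X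
      using soft_minmax_bounds[OF T(1) Y T(2), of \<alpha> \<tau> X] B(3) by linarith
    show "\<bar>soft_minmax1 T Y \<alpha> \<tau> k X\<bar> \<le> 1 + \<bar>\<alpha>\<bar> + 5 * \<alpha>\<^sup>2" if "k \<in> T \<times> Y" for k X
      by (rule order_trans[OF soft_minmax1_bound[OF T(1) Y T(2) that] B(1)])
    show "\<bar>soft_minmax2 T Y \<alpha> \<tau> k l X\<bar> \<le> 1 + \<bar>\<alpha>\<bar> + 5 * \<alpha>\<^sup>2" if "k \<in> T \<times> Y" "l \<in> T \<times> Y" for k l X
      by (rule order_trans[OF soft_minmax2_bound[OF T(1) Y T(2) that] B(2)])
  qed (fact finite_cartesian_product[OF T(1) Y] DERIV_soft_minmax[OF T(1) Y T(2)]
      DERIV_soft_minmax1[OF T(1) Y T(2)] isCont_soft_minmax2[OF T(1) Y T(2)]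
      measurable_soft_minmax(1)[OF T(1) Y T(2)] measurable_soft_minmax(2,3)[OF T(1) Y T(2), rotated] | simp)+
  moreover have "(\<Sum>k\<in>T\<times>Y. \<Sum>l\<in>T\<times>Y. ?cov k l * ?f2 k l) \<le> 0"
  proof (intro sum_nonpos)
    fix k l assume kl: "k \<in> T \<times> Y" "l \<in> T \<times> Y"
    obtain s y s' y' where [simp]: "k = (s, y)" "l = (s', y')" by (cases k, cases l)
    have sy: "s \<in> T" "y \<in> Y" "s' \<in> T" "y' \<in> Y" using kl by auto
    have cov: "?cov k l = - (sin \<theta> * cos \<theta>) * (((\<Sum>j<M. y j * y' j) - 1) * ((\<Sum>i<N. z s i * z s' i) - R\<^sup>2))"
      using bordered_covariance[of M N \<theta> R z s y s' y'] by simp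
    show "?cov k l * ?f2 k l \<le> 0"
    \<comment> \<open>For equal \<open>y\<close> the sign of the second derivative is not
      controlled; unit length makes the covariance derivative vanish exactly there.\<close>
    proof (cases "y = y'")
      case True
      then have "(\<Sum>j<M. y j * y' j) = 1" using unit[OF sy(2)] by (simp add: power2_eq_square)
      then have "?cov k l = 0" unfolding cov by simp
      then show ?thesis by (simp only: mult_zero_left order_refl)
    next
      case False
      have "0 \<le> ?f2 k l"
        using soft_minmax2_nonneg[OF T(1) Y T(2) kl] False by (intro integral_nonneg_AE) auto
      moreover have "?cov k l \<le> 0"
      proof -
        have "0 \<le> ((\<Sum>j<M. y j * y' j) - 1) * ((\<Sum>i<N. z s i * z s' i) - R\<^sup>2)"
          using sum_mult_le_of_squares[of y "{..<M}" 1 y'] unit sy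
            sum_mult_le_of_squares[of "z s" "{..<N}" "R\<^sup>2" "z s'"] z
          by (intro mult_nonpos_nonpos) auto
        moreover have "0 \<le> sin \<theta> * cos \<theta>"
          using \<theta> by (intro mult_nonneg_nonneg sin_ge_zero cos_ge_zero) auto
        ultimately show ?thesis unfolding cov using mult_nonneg_nonneg by fastforce
      qed
      ultimately show ?thesis by (rule mult_nonpos_nonneg[rotated])
    qed
  qed
  ultimately show "\<exists>y. ((\<lambda>\<theta>. \<integral>x. soft_minmax T Y \<alpha> \<tau> (bordered_process M N R z \<theta> x) \<partial>bordered_normal M N) has_real_derivative y) (at \<theta>) \<and> y \<le> 0"
    by blast
qed simp

lemma bordered_process_measurable:
  "(\<lambda>x. bordered_process M N R z \<theta> x k) \<in> borel_measurable (bordered_normal M N)"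
  unfolding bordered_process_def
  by (intro borel_measurable_sum borel_measurable_times borel_measurable_const measurable_std_normal_component)

text \<open>The functional is centred at the midpoint \<tau> of \<open>a\<close> and
  \<open>b\<close>, so the gap leaves a margin \<delta> on both sides. There it differs from an
  indicator by at most \<open>card T\<close> or \<open>card Y\<close> times exp (- \<alpha>
  \<delta>), and both errors disappear as \<alpha> tends to infinity.\<close>

lemma gordon_comparison:
  fixes T :: "'s set" and Y :: "(nat \<Rightarrow> real) set" and z :: "'s \<Rightarrow> nat \<Rightarrow> real" and M N :: nat
  defines "P \<equiv> bordered_normal M N"
  assumes T: "finite T" "T \<noteq> {}" and Y: "finite Y"
    and unit: "\<And>y. y \<in> Y \<Longrightarrow> (\<Sum>j<M. (y j)\<^sup>2) = 1"
    and z: "\<And>s. s \<in> T \<Longrightarrow> (\<Sum>i<N. (z s i)\<^sup>2) \<le> R\<^sup>2"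
    and ab: "a < b"
  shows "measure P {x \<in> space P. \<exists>y\<in>Y. \<forall>s\<in>T. bordered_process M N R z 0 x (s, y) \<le> a} \<le>
    measure P {x \<in> space P. \<exists>y\<in>Y. \<forall>s\<in>T. bordered_process M N R z (pi / 2) x (s, y) \<le> b}"
    (is "measure P ?A \<le> measure P ?B")
proof -
  interpret prob_space P unfolding P_def by (rule prob_space_PiM_std_normal)
  define \<tau> \<delta> where "\<tau> = (a + b) / 2" and "\<delta> = (b - a) / 2"
  have \<delta>: "0 < \<delta>" "a = \<tau> - \<delta>" "b = \<tau> + \<delta>" using ab by (auto simp: \<tau>_def \<delta>_def field_simps)
  have meas: "(\<lambda>x. bordered_process M N R z \<theta> x k) \<in> borel_measurable P" for \<theta> k
    unfolding P_def by (rule bordered_process_measurable)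
  have AB: "?A \<in> events" "?B \<in> events"
    by (intro sets.sets_Collect_finite_Ex sets.sets_Collect_finite_All T Y borel_measurable_le meas borel_measurable_const)+
  have *: "prob ?A \<le> prob ?B + (card T + card Y) * exp (- (\<alpha> * \<delta>))" if \<alpha>: "0 < \<alpha>" for \<alpha>
  proof -
    let ?f = "\<lambda>\<theta> x. soft_minmax T Y \<alpha> \<tau> (bordered_process M N R z \<theta> x)"
    let ?q = "exp (- (\<alpha> * \<delta>))"
    note pos = soft_max_pos[OF T(1) Y T(2)] and ge1 = soft_sum_ge_1[OF T(1) Y T(2)]
    have int: "integrable P (?f \<theta>)" for \<theta>
    proof (rule integrable_const_bound[where B=1])
      show "?f \<theta> \<in> borel_measurable P" by (intro measurable_soft_minmax T Y meas)
      show "AE x in P. norm (?f \<theta> x) \<le> 1"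
        using soft_minmax_bounds[OF T(1) Y T(2)] by (auto intro!: AE_I2 simp: abs_of_pos)
    qed
    \<comment> \<open>On \<open>?A\<close> a single \<open>y\<close> with all values below \<tau> -
      \<delta> suffices, since \<open>soft_sum\<close> is at least its reciprocal term, whence
      \<open>soft_minmax\<close> is at most \<open>soft_max\<close> at this
      \<open>y\<close>.\<close>
    have upper: "?f 0 x \<le> 1 - indicator ?A x + card T * ?q" if x: "x \<in> space P" for x
    proof (cases "x \<in> ?A")
      case True
      let ?X = "bordered_process M N R z 0 x"
      from True obtain y where y: "y \<in> Y" "\<And>s. s \<in> T \<Longrightarrow> ?X (s, y) \<le> \<tau> - \<delta>"
        using \<delta> by auto
      have "soft_max T \<alpha> \<tau> y ?X \<le> (\<Sum>s\<in>T. ?q)"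
        unfolding soft_max_def soft_exp_def
      proof (rule sum_mono)
        fix s assume "s \<in> T"
        then have "\<alpha> * (?X (s, y) - \<tau>) \<le> \<alpha> * (- \<delta>)"
          using y(2)[of s] \<alpha> by (intro mult_left_mono) auto
        then show "exp (\<alpha> * (?X (s, y) - \<tau>)) \<le> ?q" by simp
      qed
      then have D: "soft_max T \<alpha> \<tau> y ?X \<le> card T * ?q" by simp
      have "?f 0 x \<le> soft_max T \<alpha> \<tau> y ?X"
        using inverse_soft_max_le[OF T(1) Y T(2) y(1), of \<alpha> \<tau> ?X] pos[of \<alpha> \<tau> y ?X] ge1[of \<alpha> \<tau> ?X]
        by (simp add: soft_minmax_def divide_simps mult.commute)
      then show ?thesis using True D by simp
    next
      case False
      then show ?thesis using soft_minmax_bounds(2)[OF T(1) Y T(2), of \<alpha> \<tau>] by (simp add: add_increasing2)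
    qed
    have lower: "1 - indicator ?B x - card Y * ?q \<le> ?f (pi / 2) x" if x: "x \<in> space P" for x
    proof (cases "x \<in> ?B")
      case True
      then show ?thesis using soft_minmax_bounds(1)[OF T(1) Y T(2), of \<alpha> \<tau> "bordered_process M N R z (pi / 2) x"]
        by (simp add: less_imp_le order_trans[of _ 0])
    next
      case False
      let ?X = "bordered_process M N R z (pi / 2) x"
      have D: "1 / soft_max T \<alpha> \<tau> y ?X \<le> ?q" if y: "y \<in> Y" for y
      proof -
        obtain s where s: "s \<in> T" "\<tau> + \<delta> < ?X (s, y)"
          using False x y \<delta> by (auto simp: not_le)
        have "\<alpha> * \<delta> \<le> \<alpha> * (?X (s, y) - \<tau>)" using s(2) \<alpha> by (intro mult_left_mono) auto
        then have "exp (\<alpha> * \<delta>) \<le> soft_max T \<alpha> \<tau> y ?X"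
          using soft_exp_le_max[OF T(1) Y T(2), of "(s, y)" \<alpha> \<tau> ?X] s(1)
          by (auto simp: soft_exp_def intro: order_trans[rotated])
        then show ?thesis using pos[of \<alpha> \<tau> y ?X] by (simp add: exp_minus field_simps)
      qed
      have "(\<Sum>y\<in>Y. 1 / soft_max T \<alpha> \<tau> y ?X) \<le> (\<Sum>y\<in>Y. ?q)" by (intro sum_mono D)
      then have S: "soft_sum T Y \<alpha> \<tau> ?X \<le> 1 + card Y * ?q" by (simp add: soft_sum_def)
      \<comment> \<open>This is 1 - t \<le> 1 / (1 + t) for t \<ge> 0.\<close>
      have "1 - card Y * ?q \<le> 1 / (1 + card Y * ?q)"
        by (simp add: le_divide_eq add_pos_nonneg algebra_simps)
      also have "\<dots> \<le> ?f (pi / 2) x"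
        unfolding soft_minmax_def using S ge1[of \<alpha> \<tau> ?X] by (intro divide_left_mono mult_pos_pos) (auto simp: add_pos_nonneg)
      finally show ?thesis using False by simp
    qed
    have "(\<integral>x. 1 - indicator ?B x - card Y * ?q \<partial>P) \<le> (\<integral>x. ?f (pi / 2) x \<partial>P)"
      by (intro integral_mono int lower Bochner_Integration.integrable_diff integrable_real_indicator AB)
        (auto simp: emeasure_eq_measure)
    also have "\<dots> \<le> (\<integral>x. ?f 0 x \<partial>P)"
      unfolding P_def by (rule gordon_expectation[OF T Y unit z])
    also have "\<dots> \<le> (\<integral>x. 1 - indicator ?A x + card T * ?q \<partial>P)"
      by (intro integral_mono int upper Bochner_Integration.integrable_diff Bochner_Integration.integrable_add integrable_real_indicator AB)
        (auto simp: emeasure_eq_measure)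
    finally have "(\<integral>x. 1 - indicator ?B x - card Y * ?q \<partial>P) \<le> (\<integral>x. 1 - indicator ?A x + card T * ?q \<partial>P)" .
    moreover have "(\<integral>x. 1 - indicator ?B x - card Y * ?q \<partial>P) = 1 - prob ?B - card Y * ?q"
      using integrable_real_indicator[OF AB(2)] by (simp add: emeasure_eq_measure prob_space sets.Int_space_eq2[OF AB(2)])
    moreover have "(\<integral>x. 1 - indicator ?A x + card T * ?q \<partial>P) = 1 - prob ?A + card T * ?q"
      using integrable_real_indicator[OF AB(1)] by (simp add: emeasure_eq_measure prob_space sets.Int_space_eq2[OF AB(1)])
    moreover have "(card T + card Y) * ?q = card T * ?q + card Y * ?q"
      by (simp add: distrib_right)
    ultimately show ?thesis by linarith
  qed
  have "((\<lambda>\<alpha>. prob ?B + (card T + card Y) * exp (- (\<alpha> * \<delta>))) \<longlongrightarrow> prob ?B + real (card T + card Y) * (0 :: real)) at_top"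
  proof (intro tendsto_add tendsto_mult tendsto_const)
    show "((\<lambda>\<alpha>. exp (- (\<alpha> * \<delta>))) \<longlongrightarrow> 0) at_top"
      using \<delta>(1) by real_asymp
  qed
  then have "prob ?A \<le> prob ?B + real (card T + card Y) * (0 :: real)"
  proof (rule tendsto_lowerbound)
    show "\<forall>\<^sub>F \<alpha> in at_top. prob ?A \<le> prob ?B + real (card T + card Y) * exp (- (\<alpha> * \<delta>))"
      by (rule eventually_mono[OF eventually_gt_at_top[of 0]]) (rule *)
  qed simp
  then show ?thesis by simp
qed

section \<open>Deviation bounds\<close>

text \<open>The restriction to \<open>J\<close> has the product law over \<open>J\<close>, which is
  the product of the marginals; this characterises independence when \<open>J\<close> is
  nonempty.\<close>

lemma indep_vars_PiM_std_normal:
  assumes "finite I" "J \<subseteq> I"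
  shows "prob_space.indep_vars (PiM I (\<lambda>_. std_normal_distribution)) (\<lambda>_. borel) (\<lambda>i x. x i) J"
proof (cases "J = {}")
  case True
  then show ?thesis
    unfolding prob_space.indep_vars_def[OF prob_space_PiM_std_normal]
        prob_space.indep_sets_def[OF prob_space_PiM_std_normal] by blast
next
  case False
  have rv: "(\<lambda>x. x i) \<in> borel_measurable (PiM I (\<lambda>_. std_normal_distribution))" if "i \<in> J" for i
    using assms(2) that by (intro measurable_std_normal_component) auto
  have "distr (PiM I (\<lambda>_. std_normal_distribution)) (PiM J (\<lambda>_. borel)) (\<lambda>x. \<lambda>i\<in>J. x i) =
      distr (PiM I (\<lambda>_. std_normal_distribution)) (PiM J (\<lambda>_. std_normal_distribution)) (\<lambda>x. restrict x J)"
    by (intro distr_cong refl sets_PiM_cong) auto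
  also have "\<dots> = PiM J (\<lambda>_. std_normal_distribution)"
    by (rule product_prob_space.distr_restrict[OF product_prob_space_std_normal assms(2,1), symmetric])
  also have "\<dots> = PiM J (\<lambda>i. distr (PiM I (\<lambda>_. std_normal_distribution)) borel (\<lambda>x. x i))"
    using assms(2) by (intro PiM_cong refl distr_PiM_std_normal_component[symmetric]) auto
  finally show ?thesis
    using prob_space.indep_vars_iff_distr_eq_PiM'[OF prob_space_PiM_std_normal False rv] by simp
qed

lemma (in prob_space) indep_vars_imp_indep_var:
  assumes "indep_vars (\<lambda>_. N) X I" "i \<in> I" "j \<in> I" "i \<noteq> j"
  shows "indep_var N (X i) N (X j)"
proof -
  have "indep_var N ((\<lambda>x. x i) \<circ> (\<lambda>\<omega>. restrict (\<lambda>i. X i \<omega>) {i})) N ((\<lambda>x. x j) \<circ> (\<lambda>\<omega>. restrict (\<lambda>i. X i \<omega>) {j}))"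
    using assms by (intro indep_var_compose[OF indep_var_restrict[OF assms(1)]]) auto
  then show ?thesis by (simp add: o_def)
qed

text \<open>Chebyshev's inequality for the centred sum, whose cross terms vanish by independence.
  The hypothesis on second moments allows \<open>v\<close> to be any upper bound of the variances,
  which need not be computed.\<close>

lemma (in prob_space) indep_vars_sum_deviation:
  fixes X :: "'i \<Rightarrow> 'a \<Rightarrow> real"
  assumes fin: "finite J" and indep: "indep_vars (\<lambda>_. borel) X J"
    and int: "\<And>i. i \<in> J \<Longrightarrow> integrable M (\<lambda>x. (X i x)\<^sup>2)"
    and mean: "\<And>i. i \<in> J \<Longrightarrow> expectation (X i) = m i"
    and second: "\<And>i. i \<in> J \<Longrightarrow> expectation (\<lambda>x. (X i x)\<^sup>2) \<le> (m i)\<^sup>2 + v i"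
    and D: "0 < D"
  shows "prob {x \<in> space M. D \<le> \<bar>(\<Sum>i\<in>J. X i x) - (\<Sum>i\<in>J. m i)\<bar>} \<le> (\<Sum>i\<in>J. v i) / D\<^sup>2"
proof -
  have rv: "random_variable borel (X i)" if "i \<in> J" for i
    using indep that by (auto simp: indep_vars_def)
  have int1: "integrable M (X i)" if "i \<in> J" for i
    by (rule square_integrable_imp_integrable[OF rv int]) (use that in auto)
  define Y where "Y i x = X i x - m i" for i x
  have Yint1: "integrable M (Y i)" if "i \<in> J" for i
    unfolding Y_def using int1[OF that] by simp
  have Y_mean: "expectation (Y i) = 0" if "i \<in> J" for i
    unfolding Y_def using int1[OF that] mean[OF that] by (simp add: prob_space)
  have Yint2: "integrable M (\<lambda>x. Y i x * Y i x)" if "i \<in> J" for i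
    unfolding Y_def using int[OF that] int1[OF that]
    by (simp add: algebra_simps power2_eq_square)
  have Y_second: "expectation (\<lambda>x. Y i x * Y i x) \<le> v i" if "i \<in> J" for i
  proof -
    have "expectation (\<lambda>x. Y i x * Y i x) = expectation (\<lambda>x. (X i x)\<^sup>2 - 2 * m i * X i x + (m i)\<^sup>2)"
      by (simp add: Y_def power2_eq_square algebra_simps)
    also have "\<dots> = expectation (\<lambda>x. (X i x)\<^sup>2) - (m i)\<^sup>2"
      using int[OF that] int1[OF that] mean[OF that] by (simp add: prob_space power2_eq_square)
    finally show ?thesis using second[OF that] by simp
  qed
  have indepY: "indep_vars (\<lambda>_. borel) Y J"
    unfolding Y_def by (rule indep_vars_compose2[OF indep]) simp
  have cross: "integrable M (\<lambda>x. Y i x * Y j x)" "expectation (\<lambda>x. Y i x * Y j x) = 0"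
    if "i \<in> J" "j \<in> J" "i \<noteq> j" for i j
    using indep_var_integrable[OF indep_vars_imp_indep_var[OF indepY that] Yint1 Yint1]
      indep_var_lebesgue_integral[OF indep_vars_imp_indep_var[OF indepY that] Yint1 Yint1] Y_mean that by auto
  have int_all: "integrable M (\<lambda>x. Y i x * Y j x)" if "i \<in> J" "j \<in> J" for i j
    using cross Yint2 that by (cases "i = j") auto
  have sq: "(\<Sum>i\<in>J. Y i x)\<^sup>2 = (\<Sum>i\<in>J. \<Sum>j\<in>J. Y i x * Y j x)" for x
    by (simp add: power2_eq_square sum_product)
  have int_sq: "integrable M (\<lambda>x. (\<Sum>i\<in>J. Y i x)\<^sup>2)"
    unfolding sq using int_all by (intro Bochner_Integration.integrable_sum) auto
  have "expectation (\<lambda>x. (\<Sum>i\<in>J. Y i x)\<^sup>2) = (\<Sum>i\<in>J. \<Sum>j\<in>J. expectation (\<lambda>x. Y i x * Y j x))"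
    unfolding sq using int_all by simp
  also have "\<dots> = (\<Sum>i\<in>J. \<Sum>j\<in>J. if j = i then expectation (\<lambda>x. Y i x * Y i x) else 0)"
    using cross(2) by (intro sum.cong refl) auto
  also have "\<dots> \<le> (\<Sum>i\<in>J. v i)"
    using fin Y_second by (simp add: sum_mono)
  finally have second_sum: "expectation (\<lambda>x. (\<Sum>i\<in>J. Y i x)\<^sup>2) \<le> (\<Sum>i\<in>J. v i)" .
  have mean_sum: "expectation (\<lambda>x. \<Sum>i\<in>J. Y i x) = 0"
    using Yint1 Y_mean by simp
  have rvY: "random_variable borel (\<lambda>x. \<Sum>i\<in>J. Y i x)"
    unfolding Y_def using rv by (intro borel_measurable_sum borel_measurable_diff) auto
  have "prob {x \<in> space M. D \<le> \<bar>(\<Sum>i\<in>J. Y i x) - expectation (\<lambda>x. \<Sum>i\<in>J. Y i x)\<bar>} \<le>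
      variance (\<lambda>x. \<Sum>i\<in>J. Y i x) / D\<^sup>2"
    by (rule Chebyshev_inequality[OF rvY int_sq D])
  also have "\<dots> \<le> (\<Sum>i\<in>J. v i) / D\<^sup>2"
    unfolding mean_sum using second_sum by (intro divide_right_mono) auto
  finally show ?thesis
    unfolding mean_sum by (simp add: Y_def sum_subtractf)
qed

lemma integral_PiM_std_normal_component:
  fixes f :: "real \<Rightarrow> real"
  assumes "i \<in> I" "f \<in> borel_measurable borel"
  shows "(\<integral>x. f (x i) \<partial>PiM I (\<lambda>_. std_normal_distribution)) = (\<integral>t. f t \<partial>std_normal_distribution)"
  using integral_distr[of "\<lambda>x. x i" "PiM I (\<lambda>_. std_normal_distribution)" borel f] assms
  by (simp add: distr_PiM_std_normal_component measurable_std_normal_component)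

lemma PiM_std_normal_linear_deviation:
  fixes I :: "'i set"
  defines "P \<equiv> PiM I (\<lambda>_::'i. std_normal_distribution)"
  assumes "finite I" "J \<subseteq> I" "0 < D"
  shows "measure P {x \<in> space P. D \<le> \<bar>\<Sum>i\<in>J. w i * x i\<bar>} \<le> (\<Sum>i\<in>J. (w i)\<^sup>2) / D\<^sup>2"
proof -
  interpret prob_space P unfolding P_def by (rule prob_space_PiM_std_normal)
  have J: "finite J" using assms finite_subset by blast
  have JI: "i \<in> I" if "i \<in> J" for i using that assms by auto
  have "prob {x \<in> space P. D \<le> \<bar>(\<Sum>i\<in>J. w i * x i) - (\<Sum>i\<in>J. 0)\<bar>} \<le> (\<Sum>i\<in>J. (w i)\<^sup>2) / D\<^sup>2"
  proof (rule indep_vars_sum_deviation[OF J _ _ _ _ assms(4)])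
    have "indep_vars (\<lambda>_. borel) (\<lambda>i x. x i) J"
      unfolding P_def by (rule indep_vars_PiM_std_normal[OF assms(2,3)])
    then show "indep_vars (\<lambda>_. borel) (\<lambda>i x. w i * x i) J"
      by (rule indep_vars_compose2) simp
    fix i assume i: "i \<in> J"
    have int: "integrable P (\<lambda>x. x i ^ k)" for k
      unfolding P_def by (rule integrable_PiM_std_normal_component[OF JI[OF i]])
    show "integrable P (\<lambda>x. (w i * x i)\<^sup>2)"
      using int[of 2] by (simp add: power_mult_distrib)
    have m: "expectation (\<lambda>x. x i ^ k) = (\<integral>t. t ^ k \<partial>std_normal_distribution)" for k
      unfolding P_def by (rule integral_PiM_std_normal_component[OF JI[OF i]]) simp
    show "expectation (\<lambda>x. w i * x i) = 0"
      using m[of 1] integral_std_normal_distribution_moment_odd[of 1] int[of 1] by simp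
    show "expectation (\<lambda>x. (w i * x i)\<^sup>2) \<le> 0\<^sup>2 + (w i)\<^sup>2"
      using m[of 2] std_normal_distribution_even_moments(1)[of 1] int[of 2] by (simp add: power_mult_distrib)
  qed
  then show ?thesis by simp
qed

lemma PiM_std_normal_squares_deviation:
  fixes I :: "'i set"
  defines "P \<equiv> PiM I (\<lambda>_::'i. std_normal_distribution)"
  assumes "finite I" "J \<subseteq> I" "0 < D"
  shows "measure P {x \<in> space P. D \<le> \<bar>(\<Sum>i\<in>J. (x i)\<^sup>2) - card J\<bar>} \<le> 2 * card J / D\<^sup>2"
proof -
  interpret prob_space P unfolding P_def by (rule prob_space_PiM_std_normal)
  have J: "finite J" using assms finite_subset by blast
  have JI: "i \<in> I" if "i \<in> J" for i using that assms by auto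
  have "prob {x \<in> space P. D \<le> \<bar>(\<Sum>i\<in>J. (x i)\<^sup>2) - (\<Sum>i\<in>J. 1)\<bar>} \<le> (\<Sum>i\<in>J. 2) / D\<^sup>2"
  proof (rule indep_vars_sum_deviation[OF J _ _ _ _ assms(4)])
    have "indep_vars (\<lambda>_. borel) (\<lambda>i x. x i) J"
      unfolding P_def by (rule indep_vars_PiM_std_normal[OF assms(2,3)])
    then show "indep_vars (\<lambda>_. borel) (\<lambda>i x. (x i)\<^sup>2) J"
      by (rule indep_vars_compose2) simp
    fix i assume i: "i \<in> J"
    have int: "integrable P (\<lambda>x. x i ^ k)" for k
      unfolding P_def by (rule integrable_PiM_std_normal_component[OF JI[OF i]])
    show "integrable P (\<lambda>x. ((x i)\<^sup>2)\<^sup>2)"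
      using int[of 4] by (simp flip: power_mult)
    have m: "expectation (\<lambda>x. x i ^ k) = (\<integral>t. t ^ k \<partial>std_normal_distribution)" for k
      unfolding P_def by (rule integral_PiM_std_normal_component[OF JI[OF i]]) simp
    show "expectation (\<lambda>x. (x i)\<^sup>2) = 1"
      using m[of 2] std_normal_distribution_even_moments(1)[of 1] by simp
    \<comment> \<open>The fourth moment of a standard normal variable is 3, so its square has
      variance 2.\<close>
    show "expectation (\<lambda>x. ((x i)\<^sup>2)\<^sup>2) \<le> 1\<^sup>2 + 2"
      using m[of 4] std_normal_distribution_even_moments(1)[of 2] by (simp add: fact_numeral flip: power_mult)
  qed
  then show ?thesis by (simp add: mult.commute)
qed

lemma PiM_std_normal_block_deviation:
  fixes I :: "'i set" and J :: "'b \<Rightarrow> 'i set"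
  defines "P \<equiv> PiM I (\<lambda>_::'i. std_normal_distribution)"
  assumes I: "finite I" and B: "finite B" "\<And>k. k \<in> B \<Longrightarrow> J k \<subseteq> I" "disjoint_family_on J B"
    and card: "\<And>k. k \<in> B \<Longrightarrow> card (J k) = l" and l: "0 < l" and D: "0 < D"
  shows "measure P {x \<in> space P. D \<le> \<bar>(\<Sum>k\<in>B. \<bar>\<Sum>i\<in>J k. x i\<bar>) - card B * sqrt (2 * l / pi)\<bar>} \<le> card B * l / D\<^sup>2"
proof -
  interpret prob_space P unfolding P_def by (rule prob_space_PiM_std_normal)
  have "prob {x \<in> space P. D \<le> \<bar>(\<Sum>k\<in>B. \<bar>\<Sum>i\<in>J k. x i\<bar>) - (\<Sum>k\<in>B. sqrt (2 * l / pi))\<bar>} \<le> (\<Sum>k\<in>B. real l) / D\<^sup>2"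
  proof (rule indep_vars_sum_deviation[OF B(1) _ _ _ _ D])
    have "indep_vars (\<lambda>_. borel) (\<lambda>i x. x i) I"
      unfolding P_def by (rule indep_vars_PiM_std_normal[OF I order_refl])
    from indep_vars_restrict[OF this B(2,3)]
    have *: "indep_vars (\<lambda>k. PiM (J k) (\<lambda>_. borel)) (\<lambda>k x. \<lambda>i\<in>J k. x i) B" .
    have "indep_vars (\<lambda>_. borel) (\<lambda>k x. \<bar>\<Sum>i\<in>J k. (\<lambda>i\<in>J k. x i) i\<bar>) B"
      by (rule indep_vars_compose2[OF *]) (intro borel_measurable_abs borel_measurable_sum measurable_component_singleton)
    then show "indep_vars (\<lambda>_. borel) (\<lambda>k x. \<bar>\<Sum>i\<in>J k. x i\<bar>) B" by simp
    fix k assume k: "k \<in> B"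
    have Jk: "finite (J k)" "J k \<noteq> {}"
      using card[OF k] l by (auto intro: card_ge_0_finite)
    have dist1: "distributed P lborel (\<lambda>x. x i) (normal_density 0 1)" if "i \<in> J k" for i
    proof -
      have "i \<in> I" using that B(2) k by auto
      then show ?thesis
        unfolding distributed_def P_def
        by (subst distr_cong[OF refl sets_lborel refl])
          (auto simp: distr_PiM_std_normal_component intro: measurable_std_normal_component)
    qed
    have "distributed P lborel (\<lambda>x. \<Sum>i\<in>J k. x i) (normal_density (\<Sum>i\<in>J k. 0) (sqrt (\<Sum>i\<in>J k. 1\<^sup>2)))"
    proof (rule sum_indep_normal[OF Jk])
      show "indep_vars (\<lambda>i. borel) (\<lambda>i x. x i) (J k)"
        unfolding P_def by (rule indep_vars_PiM_std_normal[OF I B(2)[OF k]])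
    qed (use dist1 in auto)
    then have dist: "distributed P lborel (\<lambda>x. \<Sum>i\<in>J k. x i) (normal_density 0 (sqrt l))"
      using card[OF k] by simp
    have sl: "0 < sqrt l" using l by simp
    have sq: "has_bochner_integral lborel (\<lambda>x. normal_density 0 (sqrt l) x * x\<^sup>2) (real l)"
      using normal_moment_even[OF sl, of 0 1] l by (simp add: real_sqrt_pow2)
    show "integrable P (\<lambda>x. \<bar>\<Sum>i\<in>J k. x i\<bar>\<^sup>2)"
      using distributed_integrable[OF dist, of "\<lambda>x. x\<^sup>2"] sq by (simp add: has_bochner_integral_iff)
    have "expectation (\<lambda>x. (\<Sum>i\<in>J k. x i)\<^sup>2) = real l"
      using distributed_integral[OF dist, of "\<lambda>x. x\<^sup>2"] sq by (simp add: has_bochner_integral_iff)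
    \<comment> \<open>The variance of the absolute value is bounded by the whole second moment
      \<open>l\<close>; subtracting the squared mean would gain only a constant factor.\<close>
    then show "expectation (\<lambda>x. \<bar>\<Sum>i\<in>J k. x i\<bar>\<^sup>2) \<le> (sqrt (2 * l / pi))\<^sup>2 + real l"
      by simp
    have "(\<integral>x. normal_density 0 (sqrt l) x * \<bar>x\<bar> \<partial>lborel) = sqrt l * sqrt (2 / pi)"
      using integral_normal_moment_abs_odd[OF sl, of 0 0] by simp
    then show "expectation (\<lambda>x. \<bar>\<Sum>i\<in>J k. x i\<bar>) = sqrt (2 * l / pi)"
      using distributed_integral[OF dist, of abs] by (simp add: real_sqrt_mult real_sqrt_divide mult_ac)
  qed
  then show ?thesis by simp
qed

lemma PiM_std_normal_max_deviation:
  fixes I :: "'i set"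
  defines "P \<equiv> PiM I (\<lambda>_::'i. std_normal_distribution)"
  assumes I: "finite I" and D: "0 < D"
  shows "measure P {x \<in> space P. \<exists>i\<in>I. D \<le> \<bar>x i\<bar>} \<le> card I / D\<^sup>2"
proof -
  interpret prob_space P unfolding P_def by (rule prob_space_PiM_std_normal)
  have comp: "(\<lambda>x. x i) \<in> borel_measurable P" if "i \<in> I" for i
    unfolding P_def by (rule measurable_std_normal_component[OF that])
  have ev: "{x \<in> space P. D \<le> \<bar>x i\<bar>} \<in> events" if "i \<in> I" for i
    using comp[OF that] by (intro borel_measurable_le borel_measurable_abs borel_measurable_const)
  have "{x \<in> space P. \<exists>i\<in>I. D \<le> \<bar>x i\<bar>} = (\<Union>i\<in>I. {x \<in> space P. D \<le> \<bar>x i\<bar>})" by auto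
  also have "prob \<dots> \<le> (\<Sum>i\<in>I. prob {x \<in> space P. D \<le> \<bar>x i\<bar>})"
    using ev by (intro finite_measure_subadditive_finite I) auto
  also have "\<dots> \<le> (\<Sum>i\<in>I. 1 / D\<^sup>2)"
  proof (rule sum_mono)
    fix i assume "i \<in> I"
    then show "prob {x \<in> space P. D \<le> \<bar>x i\<bar>} \<le> 1 / D\<^sup>2"
      using PiM_std_normal_linear_deviation[OF I, of "{i}" D "\<lambda>_. 1"] D by (simp add: P_def)
  qed
  finally show ?thesis by simp
qed

section \<open>Test signals and the null space condition\<close>

text \<open>Gordan's theorem by a nearest-point argument. The point \<open>v\<close> of the convex
  hull closest to the origin is nonzero, and minimality along the segment to each \<open>u s\<close>
  gives \<langle>v, u s\<rangle> \<ge> |v|^2 > 0. The unit vector sought is - v / |v|.\<close>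

lemma gordan_alternative:
  fixes u :: "'s \<Rightarrow> nat \<Rightarrow> real"
  assumes T: "finite T" "T \<noteq> {}"
    and no_kernel: "\<And>c. (\<And>s. s \<in> T \<Longrightarrow> 0 \<le> c s) \<Longrightarrow> (\<Sum>s\<in>T. c s) = 1 \<Longrightarrow>
      (\<And>j. j < M \<Longrightarrow> (\<Sum>s\<in>T. c s * u s j) = 0) \<Longrightarrow> False"
  obtains y where "(\<Sum>j<M. (y j)\<^sup>2) = 1" "\<And>s. s \<in> T \<Longrightarrow> (\<Sum>j<M. y j * u s j) \<le> 0"
proof -
  \<comment> \<open>The function space carries the product topology over the whole type, so
    coordinates outside \<open>T\<close> are pinned to 0 to make every factor compact.\<close>
  define C0 :: "('s \<Rightarrow> real) set" where "C0 = PiE UNIV (\<lambda>s. if s \<in> T then {0..1} else {0})"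
  define C where "C = C0 \<inter> {c. (\<Sum>s\<in>T. c s) = 1}"
  define F where "F c = (\<Sum>j<M. (\<Sum>s\<in>T. c s * u s j)\<^sup>2)" for c
  have coord: "continuous_on A (\<lambda>c :: 's \<Rightarrow> real. c s)" for A s
    by (rule continuous_on_subset[OF continuous_on_product_coordinates]) simp
  have "compact C0"
    unfolding C0_def compactin_euclidean_iff[symmetric] euclidean_product_topology[symmetric] compactin_PiE
    by (auto simp: compactin_euclidean_iff)
  moreover have "closed {c :: 's \<Rightarrow> real. (\<Sum>s\<in>T. c s) = 1}"
    by (intro closed_Collect_eq continuous_intros coord)
  ultimately have C: "compact C" unfolding C_def by (rule compact_Int_closed)
  obtain s0 where s0: "s0 \<in> T" using T by auto
  have "(\<lambda>s. if s = s0 then 1 else 0) \<in> C"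
  proof -
    have "\<forall>s. (if s = s0 then 1 else 0) \<in> (if s \<in> T then {0..1} else {0 :: real})" using s0 by simp
    then show ?thesis using s0 T by (simp add: C_def C0_def PiE_UNIV_domain Pi_iff)
  qed
  then have "C \<noteq> {}" by auto
  moreover have "continuous_on C F"
    unfolding F_def by (intro continuous_intros coord)
  ultimately obtain c where c: "c \<in> C" "\<And>c'. c' \<in> C \<Longrightarrow> F c \<le> F c'"
    using continuous_attains_inf[OF C] by blast
  have c_nonneg: "0 \<le> c s" "c s \<le> 1" if "s \<in> T" for s
    using c(1) that by (auto simp: C_def C0_def PiE_iff split: if_splits dest!: spec[of _ s])
  have c_zero: "c s = 0" if "s \<notin> T" for s
    using c(1) that by (auto simp: C_def C0_def PiE_iff split: if_splits dest!: spec[of _ s])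
  have c_sum: "(\<Sum>s\<in>T. c s) = 1" using c(1) by (simp add: C_def)
  define v where "v j = (\<Sum>s\<in>T. c s * u s j)" for j
  have Fv: "F c = (\<Sum>j<M. (v j)\<^sup>2)" by (simp add: F_def v_def)
  have "F c \<noteq> 0"
  proof
    assume "F c = 0"
    then have "v j = 0" if "j < M" for j
      using that unfolding Fv by (subst (asm) sum_nonneg_eq_0_iff) auto
    then show False using no_kernel[of c] c_nonneg(1) c_sum by (simp add: v_def)
  qed
  moreover have "0 \<le> F c" unfolding Fv by (intro sum_nonneg) auto
  ultimately have F_pos: "0 < F c" by simp
  have key: "F c \<le> (\<Sum>j<M. v j * u s j)" if s: "s \<in> T" for s
  proof (rule ccontr)
    assume "\<not> ?thesis"
    then have neg: "(\<Sum>j<M. v j * (u s j - v j)) < 0"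
      by (simp add: Fv algebra_simps sum_subtractf power2_eq_square)
    define \<alpha> \<beta> where "\<alpha> = (\<Sum>j<M. v j * (u s j - v j))" and "\<beta> = (\<Sum>j<M. (u s j - v j)\<^sup>2)"
    have F_line: "F c \<le> F c + 2 * t * \<alpha> + t\<^sup>2 * \<beta>" if t: "0 \<le> t" "t \<le> 1" for t
    proof -
      define c' where "c' r = (1 - t) * c r + t * (if r = s then 1 else 0)" for r
      have sum_c': "(\<Sum>r\<in>T. c' r * w r) = (1 - t) * (\<Sum>r\<in>T. c r * w r) + t * w s" for w :: "'s \<Rightarrow> real"
      proof -
        have "(\<Sum>r\<in>T. c' r * w r) = (\<Sum>r\<in>T. (1 - t) * (c r * w r) + (if r = s then t * w s else 0))"
          by (intro sum.cong refl) (auto simp: c'_def algebra_simps)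
        then show ?thesis using T s by (simp add: sum.distrib sum_distrib_left)
      qed
      have "0 \<le> c' r \<and> c' r \<le> 1" if "r \<in> T" for r
      proof -
        have "(1 - t) * c r + t * (if r = s then 1 else 0) \<le> (1 - t) * 1 + t * 1"
          using c_nonneg[OF that] t by (intro add_mono mult_left_mono) auto
        then show ?thesis using c_nonneg[OF that] t by (auto simp: c'_def)
      qed
      moreover have "c' r = 0" if "r \<notin> T" for r using that s c_zero by (auto simp: c'_def)
      moreover have "(\<Sum>r\<in>T. c' r) = 1" using sum_c'[of "\<lambda>_. 1"] c_sum by simp
      ultimately have "c' \<in> C" by (auto simp: C_def C0_def PiE_iff)
      then have "F c \<le> F c'" by (rule c(2))
      also have "F c' = (\<Sum>j<M. (v j + t * (u s j - v j))\<^sup>2)"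
        unfolding F_def sum_c' v_def[symmetric] by (simp add: algebra_simps)
      also have "\<dots> = (\<Sum>j<M. (v j)\<^sup>2 + 2 * t * (v j * (u s j - v j)) + t\<^sup>2 * (u s j - v j)\<^sup>2)"
        by (intro sum.cong refl) (simp add: power2_eq_square algebra_simps)
      also have "\<dots> = F c + 2 * t * \<alpha> + t\<^sup>2 * \<beta>"
        by (simp add: Fv \<alpha>_def \<beta>_def sum.distrib sum_distrib_left)
      finally show ?thesis .
    qed
    have \<beta>: "0 \<le> \<beta>" unfolding \<beta>_def by (intro sum_nonneg) auto
    have \<alpha>: "\<alpha> < 0" using neg by (simp add: \<alpha>_def)
    \<comment> \<open>This step length satisfies t \<beta> \<le> - \<alpha>, hence 2 \<alpha> + t
      \<beta> < 0, and \<open>F\<close> would decrease below its minimum.\<close>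
    define t where "t = min 1 (- \<alpha> / (\<beta> + 1))"
    have "0 < - \<alpha> / (\<beta> + 1)" using \<alpha> \<beta> by (intro divide_pos_pos) auto
    then have t: "0 < t" "t \<le> 1" "t \<le> - \<alpha> / (\<beta> + 1)" by (auto simp: t_def)
    have "t * \<beta> \<le> t * (\<beta> + 1)" using t by simp
    also have "\<dots> \<le> - \<alpha>" using t(3) \<beta> by (simp add: field_simps)
    finally have "2 * \<alpha> + t * \<beta> < 0" using \<alpha> by linarith
    then have "t * (2 * \<alpha> + t * \<beta>) < 0" using t by (simp add: mult_pos_neg)
    then show False using F_line[of t] t by (simp add: algebra_simps power2_eq_square)
  qed
  show thesis
  proof
    let ?y = "\<lambda>j. - v j / sqrt (F c)"
    show "(\<Sum>j<M. (?y j)\<^sup>2) = 1"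
      using F_pos by (simp add: power_divide Fv flip: sum_divide_distrib)
    fix s assume "s \<in> T"
    have "(\<Sum>j<M. ?y j * u s j) = - (\<Sum>j<M. v j * u s j) / sqrt (F c)"
      by (simp add: sum_divide_distrib sum_negf)
    also have "\<dots> \<le> 0" using key[OF \<open>s \<in> T\<close>] F_pos by (simp add: divide_nonpos_nonneg)
    finally show "(\<Sum>j<M. ?y j * u s j) \<le> 0" .
  qed
qed

section \<open>Kernels of wide matrices and the case of large \<open>K\<close>\<close>

lemma index_finite_difference:
  assumes "i + 1 < N"
  shows "finite_difference (vec N z) $ i = z (i + 1) - z i"
proof -
  have "vec N z $ (i + 1) = z (i + 1)" "vec N z $ i = z i" "i < dim_vec (vec N z) - 1"
    using assms by simp_all
  then show ?thesis
    unfolding finite_difference_def by (simp only: index_vec)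
qed

text \<open>Gaussian elimination, by induction on the number of equations: an equation with a
  nonzero coefficient at \<open>q\<close> eliminates the unknown \<open>q\<close>, and the smaller
  system still has more unknowns than equations.\<close>

lemma underdetermined_system:
  fixes a :: "nat \<Rightarrow> 'i \<Rightarrow> real"
  assumes "finite I" "M < card I"
  shows "\<exists>z. (\<exists>i\<in>I. z i \<noteq> 0) \<and> (\<forall>j<M. (\<Sum>i\<in>I. a j i * z i) = 0)"
  using assms
proof (induction M arbitrary: a I)
  case 0
  then obtain i where "i \<in> I" by (metis card.empty ex_in_conv less_irrefl)
  then show ?case by (intro exI[of _ "\<lambda>_. 1"]) auto
next
  case (Suc M)
  show ?case
  proof (cases "\<forall>i\<in>I. a M i = 0")
    case True
    obtain z where "\<exists>i\<in>I. z i \<noteq> 0" "\<forall>j<M. (\<Sum>i\<in>I. a j i * z i) = 0"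
      using Suc.IH[of I a] Suc.prems by auto
    then show ?thesis using True by (auto simp: less_Suc_eq intro!: exI[of _ z])
  next
    case False
    then obtain q where q: "q \<in> I" "a M q \<noteq> 0" by blast
    define J where "J = I - {q}"
    have J: "finite J" "q \<notin> J" "I = insert q J" "M < card J"
      using Suc.prems q by (auto simp: J_def)
    obtain w where w: "\<exists>i\<in>J. w i \<noteq> 0" "\<And>j. j < M \<Longrightarrow> (\<Sum>i\<in>J. (a j i - a j q / a M q * a M i) * w i) = 0"
      using Suc.IH[OF J(1,4), of "\<lambda>j i. a j i - a j q / a M q * a M i"] by blast
    define S where "S j = (\<Sum>i\<in>J. a j i * w i)" for j
    define z where "z = w(q := - S M / a M q)"
    have z_sum: "(\<Sum>i\<in>I. a j i * z i) = S j - a j q / a M q * S M" for j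
    proof -
      have "(\<Sum>i\<in>J. a j i * z i) = S j"
        unfolding S_def z_def using J(2) by (intro sum.cong refl) auto
      then show ?thesis using J by (simp add: z_def)
    qed
    have "S j - a j q / a M q * S M = 0" if "j < M" for j
    proof -
      have "(\<Sum>i\<in>J. (a j i - a j q / a M q * a M i) * w i) = S j - a j q / a M q * S M"
        unfolding S_def sum_distrib_left sum_subtractf[symmetric]
        by (intro sum.cong refl) (simp only: left_diff_distrib mult.assoc)
      then show ?thesis using w(2)[OF that] by simp
    qed
    then have "\<forall>j<Suc M. (\<Sum>i\<in>I. a j i * z i) = 0"
      unfolding z_sum using q(2) by (auto simp: less_Suc_eq)
    moreover have "\<exists>i\<in>I. z i \<noteq> 0" using w(1) J(2,3) by (auto simp: z_def)
    ultimately show ?thesis by blast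
  qed
qed

lemma wide_matrix_kernel:
  fixes A :: "real mat"
  assumes A: "A \<in> carrier_mat M N" and MN: "M < N"
  obtains z where "z \<in> carrier_vec N" "z \<noteq> 0\<^sub>v N" "A *\<^sub>v z = 0\<^sub>v M"
proof -
  obtain z where z: "\<exists>i\<in>{..<N}. z i \<noteq> 0" "\<forall>j<M. (\<Sum>i<N. A $$ (j, i) * z i) = 0"
    using underdetermined_system[of "{..<N}" M "\<lambda>j i. A $$ (j, i)"] MN by auto
  show thesis
  proof
    show "vec N z \<in> carrier_vec N" by simp
    show "vec N z \<noteq> 0\<^sub>v N"
    proof
      assume *: "vec N z = 0\<^sub>v N"
      from z(1) obtain i where i: "i < N" "z i \<noteq> 0" by auto
      have "vec N z $ i = 0\<^sub>v N $ i" unfolding * ..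
      then show False using i by simp
    qed
    show "A *\<^sub>v vec N z = 0\<^sub>v M"
      using A z(2) by (intro eq_vecI) (auto simp: scalar_prod_def atLeast0LessThan)
  qed
qed

lemma tv_null_space_condition_dim:
  assumes A: "A \<in> carrier_mat M N" and NSC: "tv_null_space_condition K A" and K: "N - 1 \<le> 2 * K"
  shows "N \<le> M"
proof (rule ccontr)
  assume "\<not> N \<le> M"
  then have "M < N" by simp
  then obtain z where z: "z \<in> carrier_vec N" "z \<noteq> 0\<^sub>v N" "A *\<^sub>v z = 0\<^sub>v M"
    using wide_matrix_kernel[OF A] by blast
  have *: "l1_norm_on S (finite_difference z) < l1_norm_on ({..<N - 1} - S) (finite_difference z)"
    if "S \<subseteq> {..<N - 1}" "card S \<le> K" for S
    using NSC z A that unfolding tv_null_space_condition_def Let_def by auto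
  \<comment> \<open>Both this set and its complement have at most \<open>K\<close> elements, so each
    would have strictly less variation than the other.\<close>
  let ?S = "{..<min K (N - 1)}"
  have "card ({..<N - 1} - ?S) \<le> K"
    using K by (subst card_Diff_subset) auto
  then have "l1_norm_on ({..<N - 1} - ?S) (finite_difference z) <
      l1_norm_on ({..<N - 1} - ({..<N - 1} - ?S)) (finite_difference z)"
    by (intro *) auto
  moreover have "{..<N - 1} - ({..<N - 1} - ?S) = ?S" by auto
  ultimately show False using *[of ?S] by simp
qed

text \<open>Subtracting the mean of the signs makes the sum of a test signal vanish, so that the mean
  \<open>\<mu>\<close> of the matrix entries drops out of \<open>A z\<close>.\<close>

definition block_value :: "nat \<Rightarrow> real \<Rightarrow> (nat \<Rightarrow> real) \<Rightarrow> nat \<Rightarrow> real" where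
  "block_value n b s k = (if k < n then b * (s k - (\<Sum>k<n. s k) / n) else 0)"

text \<open>Positions behind the last block have block numbers \<ge> \<open>n\<close>, where
  \<open>block_value\<close> is 0; thus the signal is padded with zeros up to length
  \<open>N\<close>.\<close>

definition test_vector :: "nat \<Rightarrow> nat \<Rightarrow> nat \<Rightarrow> real \<Rightarrow> (nat \<Rightarrow> real) \<Rightarrow> nat \<Rightarrow> real" where
  "test_vector p l n b s i = (if i < p then (- 1) ^ i else block_value n b s ((i - p) div l))"

definition signs :: "nat \<Rightarrow> (nat \<Rightarrow> real) set" where
  "signs n = PiE {..<n} (\<lambda>_. {- 1, 1})"

lemma finite_signs: "finite (signs n)"
  unfolding signs_def by (intro finite_PiE) auto

lemma signs_nonempty: "signs n \<noteq> {}"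
  unfolding signs_def by (simp add: PiE_eq_empty_iff)

lemma signs_value: "s \<in> signs n \<Longrightarrow> k < n \<Longrightarrow> s k = - 1 \<or> s k = 1"
  unfolding signs_def by (auto dest: PiE_mem)

lemma signs_mean_bound:
  assumes "s \<in> signs n"
  shows "\<bar>(\<Sum>k<n. s k) / n\<bar> \<le> 1"
proof -
  have "\<bar>\<Sum>k<n. s k\<bar> \<le> (\<Sum>k<n. 1)"
    by (rule order_trans[OF sum_abs], rule sum_mono) (use signs_value[OF assms] in force)
  then show ?thesis by (cases "n = 0") (auto simp: abs_divide divide_le_eq)
qed

section \<open>Sums, norms and variation of the test signals\<close>

context
  fixes p l n N :: nat and b :: real
  assumes l: "0 < l" and n: "0 < n" and p: "even p" "2 \<le> p" and N: "p + n * l \<le> N" and b: "0 \<le> b"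
begin

text \<open>A common form for the sum of the entries, the sum of their squares and the inner product
  with a vector; \<open>F i 0 = 0\<close> discards the zero padding.\<close>

lemma sum_test_vector:
  fixes F :: "nat \<Rightarrow> real \<Rightarrow> real"
  assumes "\<And>i. F i 0 = 0"
  shows "(\<Sum>i<N. F i (test_vector p l n b s i)) =
    (\<Sum>i<p. F i ((- 1) ^ i)) + (\<Sum>k<n. \<Sum>i=p + k * l..<p + k * l + l. F i (block_value n b s k))"
proof -
  let ?z = "test_vector p l n b s"
  have "(\<Sum>i<N. F i (?z i)) =
      (\<Sum>i<p. F i (?z i)) + (\<Sum>i=p..<p + n * l. F i (?z i)) + (\<Sum>i=p + n * l..<N. F i (?z i))"
    using N by (simp add: sum.atLeastLessThan_concat flip: atLeast0LessThan)
  moreover have "(\<Sum>i<p. F i (?z i)) = (\<Sum>i<p. F i ((- 1) ^ i))"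
    by (intro sum.cong) (auto simp: test_vector_def)
  moreover have "(\<Sum>i=p + n * l..<N. F i (?z i)) = 0"
  proof (intro sum.neutral ballI)
    fix i assume "i \<in> {p + n * l..<N}"
    then have "n * l \<le> i - p" "\<not> i < p" by auto
    then have "n \<le> (i - p) div l" using l by (simp add: less_eq_div_iff_mult_less_eq)
    then show "F i (?z i) = 0" using \<open>\<not> i < p\<close> assms by (simp add: test_vector_def block_value_def)
  qed
  moreover have "(\<Sum>i=p..<p + n * l. F i (?z i)) = (\<Sum>i<n * l. F (p + i) (?z (p + i)))"
    using sum.shift_bounds_nat_ivl[of "\<lambda>i. F i (?z i)" 0 p "n * l"] by (simp add: add.commute atLeast0LessThan)
  moreover have "\<dots> = (\<Sum>k<n. \<Sum>i=k * l..<k * l + l. F (p + i) (?z (p + i)))"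
    by (rule sum.nat_group[symmetric])
  moreover have "\<dots> = (\<Sum>k<n. \<Sum>i=p + k * l..<p + k * l + l. F i (block_value n b s k))"
  proof (rule sum.cong[OF refl])
    fix k assume "k \<in> {..<n}"
    have "(\<Sum>i=k * l..<k * l + l. F (p + i) (?z (p + i))) = (\<Sum>i=k * l..<k * l + l. F (p + i) (block_value n b s k))"
    proof (rule sum.cong[OF refl])
      fix i assume "i \<in> {k * l..<k * l + l}"
      then have "i div l = k" using l by (intro div_nat_eqI) (auto simp: algebra_simps)
      then show "F (p + i) (?z (p + i)) = F (p + i) (block_value n b s k)" by (simp add: test_vector_def)
    qed
    also have "\<dots> = (\<Sum>i=p + k * l..<p + k * l + l. F i (block_value n b s k))"
      using sum.shift_bounds_nat_ivl[of "\<lambda>i. F i (block_value n b s k)" "k * l" p "k * l + l"] by (simp add: add_ac)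
    finally show "(\<Sum>i=k * l..<k * l + l. F (p + i) (?z (p + i))) = (\<Sum>i=p + k * l..<p + k * l + l. F i (block_value n b s k))" .
  qed
  ultimately show ?thesis by simp
qed

lemma sum_alternating: "(\<Sum>i<p. (- 1) ^ i :: real) = 0"
proof -
  obtain q where "p = 2 * q" using p by blast
  moreover have "(\<Sum>i<2 * q. (- 1) ^ i :: real) = 0" by (induction q) auto
  ultimately show ?thesis by simp
qed

lemma sum_block_value: "(\<Sum>k<n. block_value n b s k) = 0"
  using n by (simp add: block_value_def sum_subtractf flip: sum_distrib_left)

lemma test_vector_sum: "(\<Sum>i<N. test_vector p l n b s i) = 0"
  using sum_test_vector[of "\<lambda>_ v. v" s] sum_alternating sum_block_value[of s]
  by (simp flip: sum_distrib_left)

text \<open>Centring the signs can only lower their sum of squares, from n to n - n m^2, where m is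
  their mean.\<close>

lemma test_vector_square_sum:
  assumes s: "s \<in> signs n"
  shows "(\<Sum>i<N. (test_vector p l n b s i)\<^sup>2) \<le> p + b\<^sup>2 * n * l"
proof -
  define m where "m = (\<Sum>k<n. s k) / n"
  have "(\<Sum>k<n. (s k - m)\<^sup>2) = (\<Sum>k<n. (s k)\<^sup>2 - 2 * m * s k + m\<^sup>2)"
    by (intro sum.cong refl) (simp add: power2_eq_square algebra_simps)
  also have "\<dots> = (\<Sum>k<n. (s k)\<^sup>2) - 2 * m * (\<Sum>k<n. s k) + n * m\<^sup>2"
    by (simp add: sum.distrib sum_subtractf sum_distrib_left)
  also have "(\<Sum>k<n. s k) = n * m" using n by (simp add: m_def)
  also have "(\<Sum>k<n. (s k)\<^sup>2) = (\<Sum>k<n. 1)"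
    by (intro sum.cong refl) (use signs_value[OF s] in force)
  finally have "(\<Sum>k<n. (s k - m)\<^sup>2) = n - n * m\<^sup>2" by (simp add: power2_eq_square)
  moreover have "0 \<le> n * m\<^sup>2" by simp
  ultimately have "(\<Sum>k<n. (s k - m)\<^sup>2) \<le> n" by linarith
  then have "l * b\<^sup>2 * (\<Sum>k<n. (s k - m)\<^sup>2) \<le> l * b\<^sup>2 * n" by (intro mult_left_mono) auto
  moreover have "(\<Sum>k<n. \<Sum>i=p + k * l..<p + k * l + l. (block_value n b s k)\<^sup>2) = l * b\<^sup>2 * (\<Sum>k<n. (s k - m)\<^sup>2)"
    by (simp add: block_value_def m_def power_mult_distrib sum_distrib_left mult_ac)
  moreover have "(\<Sum>i<p. ((- 1) ^ i)\<^sup>2 :: real) = p"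
    by (simp flip: power_mult add: mult.commute)
  ultimately show ?thesis
    using sum_test_vector[of "\<lambda>_ v. v\<^sup>2" s] by (simp add: mult_ac)
qed

text \<open>The sign on each block is that of the block sum \<open>G k\<close>. Centring costs b m
  times the total of the block sums, and |m| \<le> 1.\<close>

lemma test_vector_inner_lower:
  fixes g :: "nat \<Rightarrow> real"
  defines "G \<equiv> \<lambda>k. \<Sum>i=p + k * l..<p + k * l + l. g i"
  obtains s where "s \<in> signs n"
    "b * ((\<Sum>k<n. \<bar>G k\<bar>) - \<bar>\<Sum>k<n. G k\<bar>) - \<bar>\<Sum>i<p. (- 1) ^ i * g i\<bar> \<le> (\<Sum>i<N. test_vector p l n b s i * g i)"
proof
  define s where "s = restrict (\<lambda>k. if 0 \<le> G k then 1 else - 1 :: real) {..<n}"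
  show s: "s \<in> signs n" by (auto simp: s_def signs_def)
  define m where "m = (\<Sum>k<n. s k) / n"
  have m: "\<bar>m\<bar> \<le> 1" using signs_mean_bound[OF s] by (simp add: m_def)
  have "(\<Sum>i<N. test_vector p l n b s i * g i) =
      (\<Sum>i<p. (- 1) ^ i * g i) + (\<Sum>k<n. block_value n b s k * G k)"
    using sum_test_vector[of "\<lambda>i v. v * g i" s] by (simp add: G_def flip: sum_distrib_left)
  moreover have "(\<Sum>k<n. block_value n b s k * G k) = (\<Sum>k<n. b * \<bar>G k\<bar> - b * m * G k)"
    by (intro sum.cong refl) (auto simp: block_value_def m_def s_def algebra_simps)
  moreover have "\<dots> = b * (\<Sum>k<n. \<bar>G k\<bar>) - b * (m * (\<Sum>k<n. G k))"
    by (simp add: sum_subtractf sum_distrib_left mult_ac)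
  moreover have "b * (m * (\<Sum>k<n. G k)) \<le> b * \<bar>\<Sum>k<n. G k\<bar>"
  proof (intro mult_left_mono b)
    have "m * (\<Sum>k<n. G k) \<le> \<bar>m\<bar> * \<bar>\<Sum>k<n. G k\<bar>" by (metis abs_ge_self abs_mult)
    also have "\<dots> \<le> 1 * \<bar>\<Sum>k<n. G k\<bar>" using m by (intro mult_right_mono) auto
    finally show "m * (\<Sum>k<n. G k) \<le> \<bar>\<Sum>k<n. G k\<bar>" by simp
  qed
  ultimately show "b * ((\<Sum>k<n. \<bar>G k\<bar>) - \<bar>\<Sum>k<n. G k\<bar>) - \<bar>\<Sum>i<p. (- 1) ^ i * g i\<bar> \<le> (\<Sum>i<N. test_vector p l n b s i * g i)"
    by (simp add: algebra_simps)
qed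

lemma block_value_bound:
  assumes s: "s \<in> signs n"
  shows "\<bar>block_value n b s k\<bar> \<le> 2 * b"
proof (cases "k < n")
  case True
  define m where "m = (\<Sum>k<n. s k) / n"
  have "\<bar>m\<bar> \<le> 1" using signs_mean_bound[OF s] by (simp add: m_def)
  then have "\<bar>s k - m\<bar> \<le> 2"
    using signs_value[OF s True] by (elim disjE) linarith+
  then have "b * \<bar>s k - m\<bar> \<le> b * 2" using b by (rule mult_left_mono)
  then show ?thesis using True b by (simp add: block_value_def m_def abs_mult)
qed (use b in \<open>simp add: block_value_def\<close>)

text \<open>Between two blocks the mean cancels, leaving a jump of at most 2 b. The last block drops
  to the padding value 0, and its own size is at most 2 b.\<close>

lemma block_value_step:
  assumes s: "s \<in> signs n"
  shows "\<bar>block_value n b s (Suc k) - block_value n b s k\<bar> \<le> (if k < n then 2 * b else 0)"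
proof (cases "Suc k < n")
  case True
  then have "block_value n b s (Suc k) - block_value n b s k = b * (s (Suc k) - s k)"
    by (simp add: block_value_def algebra_simps)
  moreover have "\<bar>s (Suc k) - s k\<bar> \<le> 2"
    using signs_value[OF s True] signs_value[OF s, of k] True by auto
  then have "b * \<bar>s (Suc k) - s k\<bar> \<le> b * 2" using b by (rule mult_left_mono)
  ultimately show ?thesis using True b by (simp add: abs_mult)
next
  case False
  then have "block_value n b s (Suc k) = 0" by (simp add: block_value_def)
  moreover have "block_value n b s k = 0" if "\<not> k < n" using that by (simp add: block_value_def)
  ultimately show ?thesis using block_value_bound[OF s, of k] by simp
qed

text \<open>The position p - 1 is the passage from an entry of modulus 1 to the first block, a jump
  of at most 1 + 2 b; the n jumps behind the blocks add at most 2 b each.\<close>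

lemma test_vector_variation:
  assumes s: "s \<in> signs n"
  shows "(\<Sum>i=p - 1..<N - 1. \<bar>test_vector p l n b s (i + 1) - test_vector p l n b s i\<bar>) \<le> 2 * b * (n + 1) + 1"
proof -
  let ?z = "test_vector p l n b s" and ?v = "block_value n b s"
  have pN: "p - 1 < N - 1" 
  proof -
    have "0 < n * l" using l n by simp
    then show ?thesis using p N by linarith
  qed
  then have "{p - 1..<N - 1} = insert (p - 1) {p..<N - 1}" using p by auto
  then have "(\<Sum>i=p - 1..<N - 1. \<bar>?z (i + 1) - ?z i\<bar>) = \<bar>?z p - ?z (p - 1)\<bar> + (\<Sum>i=p..<N - 1. \<bar>?z (i + 1) - ?z i\<bar>)"
    using p by simp
  moreover have "\<bar>?z p - ?z (p - 1)\<bar> \<le> 1 + 2 * b"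
  proof -
    have "\<bar>?z p\<bar> \<le> 2 * b" using block_value_bound[OF s] by (simp add: test_vector_def)
    moreover have "\<bar>?z (p - 1)\<bar> = 1" using p by (simp add: test_vector_def power_abs)
    ultimately show ?thesis by linarith
  qed
  moreover have "(\<Sum>i=p..<N - 1. \<bar>?z (i + 1) - ?z i\<bar>) \<le> 2 * b * n"
  proof -
    have "(\<Sum>i=p..<N - 1. \<bar>?z (i + 1) - ?z i\<bar>) = (\<Sum>i<N - 1 - p. \<bar>?z (p + i + 1) - ?z (p + i)\<bar>)"
      unfolding sum.atLeastLessThan_shift_0[of _ p "N - 1"] o_def atLeast0LessThan ..
    also have "\<dots> = (\<Sum>i<N - 1 - p. \<bar>?v (Suc i div l) - ?v (i div l)\<bar>)"
      by (simp add: test_vector_def)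
    \<comment> \<open>The range is enlarged to a multiple of \<open>l\<close>, so that it splits
      into whole blocks; blocks numbered \<open>n\<close> or higher contribute nothing.\<close>
    also have "\<dots> \<le> (\<Sum>i<N * l. \<bar>?v (Suc i div l) - ?v (i div l)\<bar>)"
    proof (rule sum_mono2)
      have "N - 1 - p \<le> N" by simp
      also have "N \<le> N * l" using l by simp
      finally show "{..<N - 1 - p} \<subseteq> {..<N * l}" by (simp only: lessThan_subset_iff)
    qed auto
    also have "\<dots> = (\<Sum>k<N. \<Sum>i=k * l..<k * l + l. \<bar>?v (Suc i div l) - ?v (i div l)\<bar>)"
      by (rule sum.nat_group[symmetric])
    also have "\<dots> = (\<Sum>k<N. \<bar>?v (Suc k) - ?v k\<bar>)"
    proof (rule sum.cong[OF refl])
      fix k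
      have "(\<Sum>i=k * l..<k * l + l. \<bar>?v (Suc i div l) - ?v (i div l)\<bar>) =
          (\<Sum>i=k * l..<k * l + l. if i = k * l + (l - 1) then \<bar>?v (Suc k) - ?v k\<bar> else 0)"
      proof (rule sum.cong[OF refl])
        fix i assume i: "i \<in> {k * l..<k * l + l}"
        then have 1: "i div l = k" using l by (intro div_nat_eqI) (auto simp: algebra_simps)
        show "\<bar>?v (Suc i div l) - ?v (i div l)\<bar> = (if i = k * l + (l - 1) then \<bar>?v (Suc k) - ?v k\<bar> else 0)"
        \<comment> \<open>Only the last index of a block can carry a jump.\<close>
        proof (cases "i = k * l + (l - 1)")
          case True
          then have "Suc i = Suc k * l" using l by simp
          then have "Suc i div l = Suc k" using div_mult_self_is_m[OF l, of "Suc k"] by simp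
          then show ?thesis using 1 True by simp
        next
          case False
          then have "Suc i div l = k" using l i by (intro div_nat_eqI) (auto simp: algebra_simps)
          then show ?thesis using 1 False by simp
        qed
      qed
      also have "\<dots> = \<bar>?v (Suc k) - ?v k\<bar>" using l by (subst sum.delta) auto
      finally show "(\<Sum>i=k * l..<k * l + l. \<bar>?v (Suc i div l) - ?v (i div l)\<bar>) = \<bar>?v (Suc k) - ?v k\<bar>" .
    qed
    also have "\<dots> \<le> (\<Sum>k<N. if k < n then 2 * b else 0)"
      by (intro sum_mono block_value_step s)
    also have "\<dots> = (\<Sum>k<n. 2 * b)"
    proof (rule sum.mono_neutral_cong_right)
      have "n \<le> n * l" using l by simp
      then have "n \<le> N" using N by linarith
      then show "{..<n} \<subseteq> {..<N}" by simp
    qed auto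
    also have "\<dots> = 2 * b * n" by simp
    finally show ?thesis .
  qed
  ultimately show ?thesis by (simp add: algebra_simps)
qed

text \<open>All test signals share their first \<open>p\<close> entries, so in a convex combination
  the p - 1 jumps of size 2 survive without cancellation, while the remaining variation can only
  shrink by convexity. A combination in the kernel would therefore contradict the condition; it is
  nonzero because its first entry is 1.\<close>

lemma tv_null_space_condition_imp_dual:
  fixes \<omega> x :: "nat \<times> nat \<Rightarrow> real"
  assumes NSC: "tv_null_space_condition K (mat M N \<omega>)"
    and \<omega>: "\<And>j i. j < M \<Longrightarrow> i < N \<Longrightarrow> \<omega> (j, i) = \<mu> + \<sigma> * x (j, i)" and \<sigma>: "0 < \<sigma>"
    and K: "p - 1 \<le> K" and var: "2 * b * (n + 1) + 1 \<le> 2 * (real p - 1)"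
  obtains y where "(\<Sum>j<M. (y j)\<^sup>2) = 1"
    "\<And>s. s \<in> signs n \<Longrightarrow> (\<Sum>j<M. \<Sum>i<N. y j * test_vector p l n b s i * x (j, i)) \<le> 0"
proof (rule gordan_alternative[OF finite_signs signs_nonempty, where M=M and u="\<lambda>s j. \<Sum>i<N. test_vector p l n b s i * x (j, i)"])
  fix y assume "(\<Sum>j<M. (y j)\<^sup>2) = 1"
    "\<And>s. s \<in> signs n \<Longrightarrow> (\<Sum>j<M. y j * (\<Sum>i<N. test_vector p l n b s i * x (j, i))) \<le> 0"
  then show thesis using that by (simp add: sum_distrib_left mult_ac)
next
  fix c :: "(nat \<Rightarrow> real) \<Rightarrow> real"
  assume c: "\<And>s. s \<in> signs n \<Longrightarrow> 0 \<le> c s" "(\<Sum>s\<in>signs n. c s) = 1"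
    and ker: "\<And>j. j < M \<Longrightarrow> (\<Sum>s\<in>signs n. c s * (\<Sum>i<N. test_vector p l n b s i * x (j, i))) = 0"
  define z where "z i = (\<Sum>s\<in>signs n. c s * test_vector p l n b s i)" for i
  have z_sum: "(\<Sum>i<N. z i * w i) = (\<Sum>s\<in>signs n. c s * (\<Sum>i<N. test_vector p l n b s i * w i))" for w
    unfolding z_def sum_distrib_right sum_distrib_left by (subst sum.swap) (simp add: mult_ac)
  have z0: "(\<Sum>i<N. z i) = 0"
    using z_sum[of "\<lambda>_. 1"] by (simp add: test_vector_sum)
  have z_alt: "z i = (- 1) ^ i" if "i < p" for i
    using that c(2) by (simp add: z_def test_vector_def flip: sum_distrib_right)
  let ?z = "vec N z"
  have NSC': "\<forall>z\<in>carrier_vec N. z \<noteq> 0\<^sub>v N \<longrightarrow> mat M N \<omega> *\<^sub>v z = 0\<^sub>v M \<longrightarrow>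
      (\<forall>S. S \<subseteq> {..<N - 1} \<longrightarrow> card S \<le> K \<longrightarrow>
        l1_norm_on S (finite_difference z) < l1_norm_on ({..<N - 1} - S) (finite_difference z))"
    using NSC by (simp add: tv_null_space_condition_def Let_def)
  have pN: "p < N" 
  proof -
    have "0 < n * l" using l n by simp
    then show ?thesis using N by linarith
  qed
  have "mat M N \<omega> *\<^sub>v ?z = 0\<^sub>v M"
  proof (intro eq_vecI)
    fix j assume j: "j < dim_vec (0\<^sub>v M :: real vec)"
    then have "(mat M N \<omega> *\<^sub>v ?z) $ j = (\<Sum>i<N. (\<mu> + \<sigma> * x (j, i)) * z i)"
      using \<omega> by (simp add: scalar_prod_def atLeast0LessThan)
    also have "\<dots> = \<mu> * (\<Sum>i<N. z i) + \<sigma> * (\<Sum>i<N. z i * x (j, i))"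
      by (simp add: algebra_simps sum.distrib sum_distrib_left)
    also have "\<dots> = 0" using z0 z_sum[of "\<lambda>i. x (j, i)"] ker j by simp
    finally show "(mat M N \<omega> *\<^sub>v ?z) $ j = 0\<^sub>v M $ j" using j by simp
  qed simp
  moreover have "?z \<noteq> 0\<^sub>v N"
  proof
    assume "?z = 0\<^sub>v N"
    then have "?z $ 0 = 0\<^sub>v N $ 0" by simp
    then show False using pN p z_alt[of 0] by simp
  qed
  \<comment> \<open>The \<open>p\<close> alternating entries have only p - 1 jumps between them, so
    \<open>p\<close> may exceed \<open>K\<close> by one.\<close>
  moreover have "{..<p - 1} \<subseteq> {..<N - 1}" "card {..<p - 1} \<le> K" using pN K by auto
  ultimately have less: "l1_norm_on {..<p - 1} (finite_difference ?z) <
      l1_norm_on ({..<N - 1} - {..<p - 1}) (finite_difference ?z)"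
    by (intro NSC'[rule_format]) simp_all
  have "l1_norm_on {..<p - 1} (finite_difference ?z) = (\<Sum>i<p - 1. 2)"
    unfolding l1_norm_on_def
  proof (rule sum.cong[OF refl])
    fix i assume i: "i \<in> {..<p - 1}"
    then have "i + 1 < p" "i + 1 < N" using pN by auto
    then have "finite_difference ?z $ i = z (i + 1) - z i"
      by (intro index_finite_difference)
    also have "\<dots> = (- 1) ^ (i + 1) - (- 1) ^ i"
      using \<open>i + 1 < p\<close> z_alt[of i] z_alt[of "i + 1"] by simp
    finally have "finite_difference ?z $ i = (- 1) ^ (i + 1) - (- 1) ^ i" .
    then show "\<bar>finite_difference ?z $ i\<bar> = 2"
      by (cases "even i") simp_all
  qed
  then have S: "l1_norm_on {..<p - 1} (finite_difference ?z) = 2 * (real p - 1)"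
    using p by (simp add: of_nat_diff)
  have "{..<N - 1} - {..<p - 1} = {p - 1..<N - 1}" by auto
  then have "l1_norm_on ({..<N - 1} - {..<p - 1}) (finite_difference ?z) = (\<Sum>i=p - 1..<N - 1. \<bar>z (i + 1) - z i\<bar>)"
    unfolding l1_norm_on_def by (intro sum.cong refl) (auto simp: index_finite_difference)
  also have "\<dots> \<le> (\<Sum>i=p - 1..<N - 1. \<Sum>s\<in>signs n. c s * \<bar>test_vector p l n b s (i + 1) - test_vector p l n b s i\<bar>)"
  proof (rule sum_mono)
    fix i
    have "z (i + 1) - z i = (\<Sum>s\<in>signs n. c s * (test_vector p l n b s (i + 1) - test_vector p l n b s i))"
      by (simp add: z_def algebra_simps sum_subtractf)
    then show "\<bar>z (i + 1) - z i\<bar> \<le> (\<Sum>s\<in>signs n. c s * \<bar>test_vector p l n b s (i + 1) - test_vector p l n b s i\<bar>)"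
      using c(1) by (auto simp: abs_mult intro!: order_trans[OF sum_abs] sum_mono)
  qed
  also have "\<dots> = (\<Sum>s\<in>signs n. c s * (\<Sum>i=p - 1..<N - 1. \<bar>test_vector p l n b s (i + 1) - test_vector p l n b s i\<bar>))"
    by (subst sum.swap) (simp add: sum_distrib_left)
  also have "\<dots> \<le> (\<Sum>s\<in>signs n. c s * (2 * b * (n + 1) + 1))"
    using c(1) by (intro sum_mono mult_left_mono test_vector_variation) auto
  also have "\<dots> = 2 * b * (n + 1) + 1" using c(2) by (simp flip: sum_distrib_right)
  finally show False using less S var by simp
qed

end

section \<open>Probability of the null space condition\<close>

lemma distr_affine_std_normal:
  assumes "0 < \<sigma>"
  shows "distr std_normal_distribution (density lborel (normal_density \<mu> \<sigma>)) (\<lambda>t. \<mu> + \<sigma> * t) =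
    density lborel (normal_density \<mu> \<sigma>)"
proof -
  interpret prob_space std_normal_distribution by (rule prob_space_normal_density) simp
  have "distributed std_normal_distribution lborel (\<lambda>t. t) (normal_density 0 1)"
    unfolding distributed_def by (simp add: distr_id2)
  from normal_density_affine[OF this, of \<sigma> \<mu>] assms
  have "distributed std_normal_distribution lborel (\<lambda>t. \<mu> + \<sigma> * t) (normal_density \<mu> \<sigma>)" by simp
  then have "distr std_normal_distribution lborel (\<lambda>t. \<mu> + \<sigma> * t) = density lborel (normal_density \<mu> \<sigma>)"
    by (simp add: distributed_def)
  moreover have "distr std_normal_distribution lborel (\<lambda>t. \<mu> + \<sigma> * t) =
      distr std_normal_distribution (density lborel (normal_density \<mu> \<sigma>)) (\<lambda>t. \<mu> + \<sigma> * t)"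
    by (rule distr_cong) simp_all
  ultimately show ?thesis by simp
qed

text \<open>Realises the random matrix as an affine image of the inner block of the bordered matrix,
  so that its null space event can be bounded on the space where the comparison takes place.\<close>

lemma gaussian_entries_eq_distr:
  assumes \<sigma>: "0 < \<sigma>"
  shows "gaussian_entries M N \<mu> \<sigma> =
    distr (bordered_normal M N) (gaussian_entries M N \<mu> \<sigma>) (\<lambda>x. \<lambda>e\<in>{..<M} \<times> {..<N}. \<mu> + \<sigma> * x e)"
    and "(\<lambda>x. \<lambda>e\<in>{..<M} \<times> {..<N}. \<mu> + \<sigma> * x e) \<in> measurable (bordered_normal M N) (gaussian_entries M N \<mu> \<sigma>)"
proof -
  let ?J = "{..<M} \<times> {..<N}" and ?D = "density lborel (normal_density \<mu> \<sigma>)" and ?f = "\<lambda>t. \<mu> + \<sigma> * t"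
  have sub: "?J \<subseteq> {..M} \<times> {..N}" by auto
  have m1: "(\<lambda>x. restrict x ?J) \<in> measurable (bordered_normal M N) (PiM ?J (\<lambda>_. std_normal_distribution))"
    by (rule measurable_restrict_subset[OF sub])
  have f: "?f \<in> measurable std_normal_distribution ?D" by simp
  have "compose ?J ?f \<in> measurable (PiM ?J (\<lambda>_. std_normal_distribution)) (PiM ?J (\<lambda>_. ?D))"
    unfolding compose_def[abs_def]
  proof (rule measurable_restrict)
    fix e assume "e \<in> ?J"
    then have "(\<lambda>x. x e) \<in> measurable (PiM ?J (\<lambda>_. std_normal_distribution)) std_normal_distribution"
      by (rule measurable_component_singleton)
    from measurable_compose[OF this f]
    show "(\<lambda>x. \<mu> + \<sigma> * x e) \<in> measurable (PiM ?J (\<lambda>_. std_normal_distribution)) ?D" .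
  qed
  note m2 = this
  have o: "compose ?J ?f \<circ> (\<lambda>x. restrict x ?J) = (\<lambda>x. \<lambda>e\<in>?J. \<mu> + \<sigma> * x e)"
    by (auto simp: compose_def fun_eq_iff)
  show "(\<lambda>x. \<lambda>e\<in>{..<M} \<times> {..<N}. \<mu> + \<sigma> * x e) \<in> measurable (bordered_normal M N) (gaussian_entries M N \<mu> \<sigma>)"
    unfolding gaussian_entries_def o[symmetric] using m1 m2 by (rule measurable_comp)
  have "gaussian_entries M N \<mu> \<sigma> = PiM ?J (\<lambda>_. distr std_normal_distribution ?D ?f)"
    unfolding gaussian_entries_def distr_affine_std_normal[OF \<sigma>] ..
  also have "\<dots> = distr (PiM ?J (\<lambda>_. std_normal_distribution)) (PiM ?J (\<lambda>_. ?D)) (compose ?J ?f)"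
    by (rule distr_PiM_finite_prob_space'[symmetric])
      (use \<sigma> f in \<open>auto intro: prob_space_normal_density\<close>)
  also have "PiM ?J (\<lambda>_. std_normal_distribution) = distr (bordered_normal M N) (PiM ?J (\<lambda>_. std_normal_distribution)) (\<lambda>x. restrict x ?J)"
    by (rule product_prob_space.distr_restrict[OF product_prob_space_std_normal sub]) simp
  also have "distr \<dots> (PiM ?J (\<lambda>_. ?D)) (compose ?J ?f) =
      distr (bordered_normal M N) (PiM ?J (\<lambda>_. ?D)) (compose ?J ?f \<circ> (\<lambda>x. restrict x ?J))"
    by (rule distr_distr[OF m2 m1])
  finally show "gaussian_entries M N \<mu> \<sigma> =
    distr (bordered_normal M N) (gaussian_entries M N \<mu> \<sigma>) (\<lambda>x. \<lambda>e\<in>{..<M} \<times> {..<N}. \<mu> + \<sigma> * x e)"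
    unfolding o gaussian_entries_def .
qed

text \<open>Rounding the coordinates down to multiples of \<epsilon> maps the sphere to finitely
  many patterns. One point of the sphere is kept for each pattern, so the net consists of exact unit
  vectors, as the comparison demands.\<close>

lemma finite_sphere_net:
  fixes \<epsilon> :: real
  assumes \<epsilon>: "0 < \<epsilon>"
  obtains Y :: "(nat \<Rightarrow> real) set" where "finite Y" "\<And>y. y \<in> Y \<Longrightarrow> (\<Sum>j<M. (y j)\<^sup>2) = 1"
    "\<And>y. (\<Sum>j<M. (y j)\<^sup>2) = 1 \<Longrightarrow> \<exists>y'\<in>Y. \<forall>j<M. \<bar>y j - y' j\<bar> \<le> \<epsilon>"
proof -
  define S where "S = {y :: nat \<Rightarrow> real. (\<Sum>j<M. (y j)\<^sup>2) = 1}"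
  define r where "r y = (\<lambda>j\<in>{..<M}. \<lfloor>y j / \<epsilon>\<rfloor>)" for y :: "nat \<Rightarrow> real"
  define Y where "Y = inv_into S r ` (r ` S)"
  have "r ` S \<subseteq> PiE {..<M} (\<lambda>_. {\<lfloor>- 1 / \<epsilon>\<rfloor>..\<lfloor>1 / \<epsilon>\<rfloor>})"
  proof (rule image_subsetI)
    fix y assume y: "y \<in> S"
    have "\<lfloor>- 1 / \<epsilon>\<rfloor> \<le> \<lfloor>y j / \<epsilon>\<rfloor> \<and> \<lfloor>y j / \<epsilon>\<rfloor> \<le> \<lfloor>1 / \<epsilon>\<rfloor>" if j: "j < M" for j
    proof -
      have "(y j)\<^sup>2 \<le> (\<Sum>j<M. (y j)\<^sup>2)" using j by (intro member_le_sum) auto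
      then have "\<bar>y j\<bar> \<le> 1" using y by (simp add: S_def abs_square_le_1)
      then have "- 1 \<le> y j" "y j \<le> 1" by linarith+
      then show ?thesis using \<epsilon> by (intro conjI floor_mono divide_right_mono) auto
    qed
    then show "r y \<in> PiE {..<M} (\<lambda>_. {\<lfloor>- 1 / \<epsilon>\<rfloor>..\<lfloor>1 / \<epsilon>\<rfloor>})" by (simp add: r_def)
  qed
  then have "finite (r ` S)" by (rule finite_subset) (intro finite_PiE, auto)
  then have "finite Y" unfolding Y_def by (rule finite_imageI)
  moreover have "(\<Sum>j<M. (y j)\<^sup>2) = 1" if "y \<in> Y" for y
  proof -
    have "y \<in> S" using that unfolding Y_def by (auto intro: inv_into_into)
    then show ?thesis by (simp add: S_def)
  qed
  moreover have "\<exists>y'\<in>Y. \<forall>j<M. \<bar>y j - y' j\<bar> \<le> \<epsilon>" if "(\<Sum>j<M. (y j)\<^sup>2) = 1" for y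
  proof (intro bexI allI impI)
    let ?y' = "inv_into S r (r y)"
    have yS: "y \<in> S" using that by (simp add: S_def)
    then show "?y' \<in> Y" by (simp add: Y_def)
    fix j assume j: "j < M"
    have "r ?y' = r y" using yS f_inv_into_f[of "r y" r S] by simp
    then have "r ?y' j = r y j" by simp
    then have "\<lfloor>?y' j / \<epsilon>\<rfloor> = \<lfloor>y j / \<epsilon>\<rfloor>" using j by (simp add: r_def)
    then have "\<bar>y j / \<epsilon> - ?y' j / \<epsilon>\<bar> \<le> 1" by linarith
    then have "\<bar>y j - ?y' j\<bar> / \<epsilon> \<le> 1" using \<epsilon> by (simp add: abs_divide flip: diff_divide_distrib)
    then show "\<bar>y j - ?y' j\<bar> \<le> \<epsilon>" using \<epsilon> by (simp add: divide_le_eq)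
  qed
  ultimately show thesis by (rule that)
qed

lemma sum_consecutive_blocks:
  fixes g :: "nat \<Rightarrow> real"
  shows "(\<Sum>k<n. \<Sum>i=p + k * l..<p + k * l + l. g i) = (\<Sum>i=p..<p + n * l. g i)"
  by (induction n) (auto simp: sum.atLeastLessThan_concat add_ac)

lemma sum_singleton_times:
  fixes g :: "'a \<times> 'b \<Rightarrow> real"
  shows "(\<Sum>e\<in>{a} \<times> B. g e) = (\<Sum>i\<in>B. g (a, i))" "(\<Sum>e\<in>A \<times> {b}. g e) = (\<Sum>j\<in>A. g (j, b))"
  by (simp_all add: sum.cartesian_product')

section \<open>From the decoupled process back to the Gaussian matrix\<close>

context
  fixes p l n N M :: nat and b R \<rho> :: real
  assumes l: "0 < l" and n: "0 < n" and p: "even p" "2 \<le> p" and N: "p + n * l \<le> N" and b: "0 \<le> b"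
    and R: "R = sqrt (p + b\<^sup>2 * n * l)" and \<rho>: "0 < \<rho>" "\<rho> \<le> 1"
    and main: "R * (sqrt M + 8 / sqrt \<rho>) \<le> b * n * sqrt (2 * l / pi)"
begin

lemma radius_bounds: "sqrt p \<le> R" "b * sqrt (n * l) \<le> R" "0 < R" "R\<^sup>2 = p + b\<^sup>2 * n * l"
proof -
  have 0: "0 \<le> b\<^sup>2 * n * l" by simp
  show "sqrt p \<le> R" unfolding R using 0 by simp
  then show "0 < R" using p real_sqrt_gt_zero[of p] by linarith
  have "b * sqrt (n * l) = sqrt (b\<^sup>2 * (n * l))" using b by (simp add: real_sqrt_mult)
  then show "b * sqrt (n * l) \<le> R" unfolding R by simp
  show "R\<^sup>2 = p + b\<^sup>2 * n * l" unfolding R using 0 by simp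
qed

text \<open>The signs \<open>s\<close> are chosen from the row \<open>M\<close> of \<open>x\<close>
  alone. In units of \<open>R / sqrt \<rho>\<close>, the blocks lose 2, the alternating entries 1
  and the norm of the column \<open>N\<close> another 1; together with the threshold 3 this makes 7,
  which the 8 in \<open>main\<close> covers.\<close>

lemma decoupled_max_large:
  fixes x :: "nat \<times> nat \<Rightarrow> real"
  defines "G \<equiv> \<lambda>k. \<Sum>i=p + k * l..<p + k * l + l. x (M, i)"
  assumes 1: "\<bar>(\<Sum>k<n. \<bar>G k\<bar>) - n * sqrt (2 * l / pi)\<bar> < sqrt (n * l / \<rho>)"
    and 2: "\<bar>\<Sum>i=p..<p + n * l. x (M, i)\<bar> < sqrt (n * l / \<rho>)"
    and 3: "\<bar>\<Sum>i<p. (- 1) ^ i * x (M, i)\<bar> < sqrt (p / \<rho>)"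
    and 4: "\<bar>(\<Sum>j<M. (x (j, N))\<^sup>2) - M\<bar> < sqrt ((2 * M + 1) / \<rho>)"
    and y: "(\<Sum>j<M. (y j)\<^sup>2) = 1"
  obtains s where "s \<in> signs n" "3 * R / sqrt \<rho> < bordered_process M N R (test_vector p l n b) (pi / 2) x (s, y)"
proof -
  obtain s where s: "s \<in> signs n"
    "b * ((\<Sum>k<n. \<bar>G k\<bar>) - \<bar>\<Sum>k<n. G k\<bar>) - \<bar>\<Sum>i<p. (- 1) ^ i * x (M, i)\<bar> \<le> (\<Sum>i<N. test_vector p l n b s i * x (M, i))"
    using test_vector_inner_lower[OF l n p N b, of "\<lambda>i. x (M, i)"] unfolding G_def by blast
  have sr: "0 < sqrt \<rho>" using \<rho> by simp
  have G: "(\<Sum>k<n. G k) = (\<Sum>i=p..<p + n * l. x (M, i))"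
    unfolding G_def by (rule sum_consecutive_blocks)
  have "b * (n * sqrt (2 * l / pi) - 2 * sqrt (n * l / \<rho>)) \<le> b * ((\<Sum>k<n. \<bar>G k\<bar>) - \<bar>\<Sum>k<n. G k\<bar>)"
    using 1 2 unfolding G by (intro mult_left_mono b) linarith
  moreover have "b * sqrt (n * l / \<rho>) \<le> R / sqrt \<rho>"
    using radius_bounds(2) sr by (simp add: real_sqrt_divide divide_right_mono)
  moreover have "sqrt (p / \<rho>) \<le> R / sqrt \<rho>"
    using radius_bounds(1) sr by (simp add: real_sqrt_divide divide_right_mono)
  moreover have "b * (n * sqrt (2 * l / pi) - 2 * sqrt (n * l / \<rho>)) =
      b * n * sqrt (2 * l / pi) - 2 * (b * sqrt (n * l / \<rho>))"
    by (simp only: right_diff_distrib mult.assoc mult.left_commute[of b 2])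
  moreover have "3 * R / sqrt \<rho> = 3 * (R / sqrt \<rho>)" by simp
  ultimately have z: "b * n * sqrt (2 * l / pi) - 3 * R / sqrt \<rho> < (\<Sum>i<N. test_vector p l n b s i * x (M, i))"
    using s(2) 3 by linarith
  have "(\<Sum>j<M. (x (j, N))\<^sup>2) \<le> (sqrt M + 1 / sqrt \<rho>)\<^sup>2"
  proof -
    \<comment> \<open>The deviation of the squared norm has to fit into the cross term and the last
      term of the squared bound \<open>sqrt M + 1 / sqrt \<rho>\<close>.\<close>
    have "sqrt ((2 * M + 1) / \<rho>) \<le> 2 * sqrt M / sqrt \<rho> + 1 / \<rho>"
    proof -
      have "sqrt (2 * M + 1) \<le> 2 * sqrt M + 1"
      proof (rule real_le_lsqrt)
        have "(2 * sqrt M + 1)\<^sup>2 = 4 * real M + 4 * sqrt M + 1"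
          by (simp add: power2_sum power_mult_distrib)
        then show "real (2 * M + 1) \<le> (2 * sqrt M + 1)\<^sup>2" by simp
      qed simp
      then have "sqrt ((2 * M + 1) / \<rho>) \<le> (2 * sqrt M + 1) / sqrt \<rho>"
        unfolding real_sqrt_divide using sr by (intro divide_right_mono) auto
      also have "\<dots> \<le> 2 * sqrt M / sqrt \<rho> + 1 / \<rho>"
      proof -
        have "\<rho> \<le> sqrt \<rho>" using \<rho> by (intro real_le_rsqrt) (simp add: power2_eq_square mult_le_cancel_left1)
        then have "1 / sqrt \<rho> \<le> 1 / \<rho>" using \<rho> by (intro divide_left_mono) auto
        then show ?thesis by (simp add: add_divide_distrib)
      qed
      finally show ?thesis .
    qed
    moreover have "(sqrt M + 1 / sqrt \<rho>)\<^sup>2 = M + 2 * sqrt M / sqrt \<rho> + 1 / \<rho>"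
      using \<rho> by (simp add: power2_sum power_divide)
    ultimately show ?thesis using 4 by linarith
  qed
  then have "L2_set (\<lambda>j. x (j, N)) {..<M} \<le> sqrt M + 1 / sqrt \<rho>"
    unfolding L2_set_def using sr by (intro real_le_lsqrt) (auto intro: sum_nonneg)
  moreover have "\<bar>\<Sum>j<M. y j * x (j, N)\<bar> \<le> L2_set y {..<M} * L2_set (\<lambda>j. x (j, N)) {..<M}"
    by (rule order_trans[OF sum_abs]) (simp add: abs_mult L2_set_mult_ineq)
  moreover have "L2_set y {..<M} = 1" unfolding L2_set_def y by simp
  ultimately have "\<bar>\<Sum>j<M. y j * x (j, N)\<bar> \<le> sqrt M + 1 / sqrt \<rho>" by simp
  then have "- (sqrt M + 1 / sqrt \<rho>) \<le> (\<Sum>j<M. y j * x (j, N))" by linarith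
  then have "R * - (sqrt M + 1 / sqrt \<rho>) \<le> R * (\<Sum>j<M. y j * x (j, N))"
    using radius_bounds(3) by (intro mult_left_mono) auto
  then have "- (R * (sqrt M + 1 / sqrt \<rho>)) \<le> R * (\<Sum>j<M. y j * x (j, N))"
    by (simp only: mult_minus_right)
  then have "b * n * sqrt (2 * l / pi) - 3 * R / sqrt \<rho> - R * (sqrt M + 1 / sqrt \<rho>) <
      bordered_process M N R (test_vector p l n b) (pi / 2) x (s, y)"
    using z unfolding bordered_process_pi_half by linarith
  moreover have "3 * R / sqrt \<rho> \<le> b * n * sqrt (2 * l / pi) - 3 * R / sqrt \<rho> - R * (sqrt M + 1 / sqrt \<rho>)"
  proof -
    define t where "t = R / sqrt \<rho>"
    have "0 \<le> t" using radius_bounds(3) sr by (simp add: t_def)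
    moreover have "R * sqrt M + 8 * t \<le> b * n * sqrt (2 * l / pi)"
      using main by (simp add: t_def distrib_left mult.commute)
    moreover have "R * (sqrt M + 1 / sqrt \<rho>) = R * sqrt M + t" "3 * R / sqrt \<rho> = 3 * t"
      by (simp_all add: t_def distrib_left)
    ultimately show ?thesis by linarith
  qed
  ultimately show thesis using that[OF s(1)] by linarith
qed

private abbreviation P where "P \<equiv> bordered_normal M N"

text \<open>Four events of probability at most \<rho> each. They concern the added row and column
  but not \<open>y\<close>, so the bound does not depend on the size of \<open>Y\<close>.\<close>

lemma prob_decoupled_small:
  assumes unit: "\<And>y. y \<in> Y \<Longrightarrow> (\<Sum>j<M. (y j)\<^sup>2) = 1"
  shows "measure P {x \<in> space P. \<exists>y\<in>Y. \<forall>s\<in>signs n.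
    bordered_process M N R (test_vector p l n b) (pi / 2) x (s, y) \<le> 3 * R / sqrt \<rho>} \<le> 4 * \<rho>"
proof -
  interpret prob_space P by (rule prob_space_PiM_std_normal)
  let ?I = "{..M} \<times> {..N}"
  have fin: "finite ?I" by simp
  have comp: "(\<lambda>x. x e) \<in> borel_measurable P" if "e \<in> ?I" for e
    by (rule measurable_std_normal_component[OF that])
  define A1 where "A1 = {x \<in> space P. sqrt (n * l / \<rho>) \<le> \<bar>(\<Sum>k<n. \<bar>\<Sum>e\<in>{M} \<times> {p + k * l..<p + k * l + l}. x e\<bar>) - card {..<n} * sqrt (2 * l / pi)\<bar>}"
  define A2 where "A2 = {x \<in> space P. sqrt (n * l / \<rho>) \<le> \<bar>\<Sum>e\<in>{M} \<times> {p..<p + n * l}. 1 * x e\<bar>}"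
  define A3 where "A3 = {x \<in> space P. sqrt (p / \<rho>) \<le> \<bar>\<Sum>e\<in>{M} \<times> {..<p}. (- 1) ^ snd e * x e\<bar>}"
  \<comment> \<open>The 1 in \<open>2 * M + 1\<close> keeps the threshold positive for M =
    0.\<close>
  define A4 where "A4 = {x \<in> space P. sqrt ((2 * M + 1) / \<rho>) \<le> \<bar>(\<Sum>e\<in>{..<M} \<times> {N}. (x e)\<^sup>2 :: real) - real (card ({..<M} \<times> {N}))\<bar>}"
  have sub2: "{M} \<times> {p..<p + n * l} \<subseteq> ?I" and sub3: "{M} \<times> {..<p} \<subseteq> ?I" and sub4: "{..<M} \<times> {N} \<subseteq> ?I"
    using N by auto
  have sub1: "{M} \<times> {p + k * l..<p + k * l + l} \<subseteq> ?I" if "k \<in> {..<n}" for k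
  proof -
    have "k * l + l \<le> n * l" using that mult_le_mono1[of "Suc k" n l] by simp
    then show ?thesis using N by auto
  qed
  have sq: "(sqrt (n * l / \<rho>))\<^sup>2 = n * l / \<rho>" "(sqrt (p / \<rho>))\<^sup>2 = p / \<rho>" "(sqrt ((2 * M + 1) / \<rho>))\<^sup>2 = (2 * M + 1) / \<rho>"
    using \<rho> by auto
  have pos: "0 < sqrt (n * l / \<rho>)" "0 < sqrt (p / \<rho>)" "0 < sqrt ((2 * M + 1) / \<rho>)"
    using \<rho> n l p by (auto intro!: divide_pos_pos)
  have "disjoint_family_on (\<lambda>k. {M} \<times> {p + k * l..<p + k * l + l}) {..<n}"
  proof -
    have "{p + k * l..<p + k * l + l} \<inter> {p + m * l..<p + m * l + l} = {}" if "k < m" for k m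
    proof -
      have "k * l + l \<le> m * l" using that mult_le_mono1[of "Suc k" m l] by simp
      then show ?thesis by auto
    qed
    then show ?thesis unfolding disjoint_family_on_def by (auto elim!: linorder_neqE_nat; fastforce)
  qed
  from PiM_std_normal_block_deviation[where J="\<lambda>k. {M} \<times> {p + k * l..<p + k * l + l}",
      OF fin finite_lessThan sub1 this _ l pos(1)]
  have "prob A1 \<le> card {..<n} * l / (sqrt (n * l / \<rho>))\<^sup>2"
    unfolding A1_def by simp
  then have 1: "prob A1 \<le> \<rho>" unfolding sq using n l \<rho> by simp
  have "prob A2 \<le> (\<Sum>e\<in>{M} \<times> {p..<p + n * l}. 1\<^sup>2) / (sqrt (n * l / \<rho>))\<^sup>2"
    unfolding A2_def by (rule PiM_std_normal_linear_deviation[OF fin sub2 pos(1)])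
  then have 2: "prob A2 \<le> \<rho>" unfolding sq using n l \<rho> by simp
  have "prob A3 \<le> (\<Sum>e\<in>{M} \<times> {..<p}. ((- 1) ^ snd e)\<^sup>2) / (sqrt (p / \<rho>))\<^sup>2"
    unfolding A3_def by (rule PiM_std_normal_linear_deviation[OF fin sub3 pos(2)])
  then have 3: "prob A3 \<le> \<rho>" unfolding sq using p \<rho> by (simp add: power_mult[symmetric] mult.commute[of _ 2])
  have "prob A4 \<le> 2 * card ({..<M} \<times> {N}) / (sqrt ((2 * M + 1) / \<rho>))\<^sup>2"
    unfolding A4_def by (rule PiM_std_normal_squares_deviation[OF fin sub4 pos(3)])
  also have "\<dots> = \<rho> * (2 * M / (2 * M + 1))" unfolding sq using \<rho> by simp
  also have "\<dots> \<le> \<rho> * 1" using \<rho> by (intro mult_left_mono) auto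
  finally have 4: "prob A4 \<le> \<rho>" by simp
  have meas: "A1 \<in> events" "A2 \<in> events" "A3 \<in> events" "A4 \<in> events"
    unfolding A1_def A2_def A3_def A4_def
    by (intro borel_measurable_le borel_measurable_const borel_measurable_abs borel_measurable_diff
        borel_measurable_sum borel_measurable_times borel_measurable_power comp;
        use sub1 sub2 sub3 sub4 in blast)+
  have "{x \<in> space P. \<exists>y\<in>Y. \<forall>s\<in>signs n. bordered_process M N R (test_vector p l n b) (pi / 2) x (s, y) \<le> 3 * R / sqrt \<rho>}
     \<subseteq> A1 \<union> A2 \<union> A3 \<union> A4"
  proof (rule subsetI, rule ccontr)
    fix x assume x: "x \<in> {x \<in> space P. \<exists>y\<in>Y. \<forall>s\<in>signs n. bordered_process M N R (test_vector p l n b) (pi / 2) x (s, y) \<le> 3 * R / sqrt \<rho>}"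
      and no: "x \<notin> A1 \<union> A2 \<union> A3 \<union> A4"
    then obtain y where y: "y \<in> Y" "\<And>s. s \<in> signs n \<Longrightarrow> bordered_process M N R (test_vector p l n b) (pi / 2) x (s, y) \<le> 3 * R / sqrt \<rho>"
      by blast
    from x no obtain s where "s \<in> signs n" "3 * R / sqrt \<rho> < bordered_process M N R (test_vector p l n b) (pi / 2) x (s, y)"
      using decoupled_max_large[of x y] unit[OF y(1)]
      by (auto simp: A1_def A2_def A3_def A4_def sum_singleton_times not_le)
    then show False using y(2)[of s] by linarith
  qed
  then have "prob {x \<in> space P. \<exists>y\<in>Y. \<forall>s\<in>signs n. bordered_process M N R (test_vector p l n b) (pi / 2) x (s, y) \<le> 3 * R / sqrt \<rho>}
      \<le> prob (A1 \<union> A2 \<union> A3 \<union> A4)"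
    using meas by (intro finite_measure_mono) auto
  also have "\<dots> \<le> prob A1 + prob A2 + prob A3 + prob A4"
    using measure_Un_le[of "A1 \<union> A2 \<union> A3" P A4] measure_Un_le[of "A1 \<union> A2" P A3] measure_Un_le[of A1 P A2] meas by auto
  finally show ?thesis using 1 2 3 4 by linarith
qed

text \<open>A measurable set enclosing an event about a continuum of \<open>y\<close>. If all
  entries of \<open>x\<close> are below \<open>D\<close>, moving \<open>y\<close> to a net point
  costs at most \<open>R / sqrt \<rho>\<close>, and the corner term adds at most as much again; this
  gives the threshold in \<open>A3\<close>. The probabilities sum as 1 + 1 + 4.\<close>

lemma prob_dual_small:
  obtains Bad where "Bad \<in> sets P" "measure P Bad \<le> 6 * \<rho>"
    "\<And>x y. x \<in> space P \<Longrightarrow> (\<Sum>j<M. (y j)\<^sup>2) = 1 \<Longrightarrow>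
      (\<And>s. s \<in> signs n \<Longrightarrow> (\<Sum>j<M. \<Sum>i<N. y j * test_vector p l n b s i * x (j, i)) \<le> 0) \<Longrightarrow> x \<in> Bad"
proof -
  interpret prob_space P by (rule prob_space_PiM_std_normal)
  let ?I = "{..M} \<times> {..N}" and ?z = "test_vector p l n b"
  let ?X = "\<lambda>\<theta> x k. bordered_process M N R ?z \<theta> x k"
  have fin: "finite ?I" by simp
  have comp: "(\<lambda>x. x e) \<in> borel_measurable P" if "e \<in> ?I" for e
    by (rule measurable_std_normal_component[OF that])
  have sr: "0 < sqrt \<rho>" using \<rho> by simp
  have R0: "0 < R" by (rule radius_bounds)
  define D where "D = sqrt (card ?I / \<rho>)"
  have "0 < card ?I" by simp
  then have D: "0 < D" unfolding D_def using \<rho> by (metis divide_pos_pos of_nat_0_less_iff real_sqrt_gt_zero)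
  \<comment> \<open>Fine enough that \<open>M * N\<close> summands, each off by at most
    \<open>\<epsilon> * (R * D)\<close>, add up to at most \<open>R / sqrt \<rho>\<close>; the
    summand 1 excludes a zero denominator.\<close>
  define \<epsilon> where "\<epsilon> = 1 / (sqrt \<rho> * (real M * real N * D + 1))"
  have MND: "0 \<le> real M * real N * D" using D by simp
  have \<epsilon>: "0 < \<epsilon>" unfolding \<epsilon>_def using sr MND by (intro divide_pos_pos mult_pos_pos) auto
  have \<epsilon>_le: "real M * real N * (\<epsilon> * (R * D)) \<le> R / sqrt \<rho>"
  proof -
    have "real M * real N * (\<epsilon> * (R * D)) = (R / sqrt \<rho>) * ((real M * real N * D) / (real M * real N * D + 1))"
      by (simp add: \<epsilon>_def)
    also have "\<dots> \<le> (R / sqrt \<rho>) * 1"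
      using MND R0 sr by (intro mult_left_mono) auto
    finally show ?thesis by simp
  qed
  obtain Y :: "(nat \<Rightarrow> real) set" where Y: "finite Y" "\<And>y. y \<in> Y \<Longrightarrow> (\<Sum>j<M. (y j)\<^sup>2) = 1"
    "\<And>y. (\<Sum>j<M. (y j)\<^sup>2) = 1 \<Longrightarrow> \<exists>y'\<in>Y. \<forall>j<M. \<bar>y j - y' j\<bar> \<le> \<epsilon>"
    using finite_sphere_net[OF \<epsilon>, of M] by blast
  define A1 where "A1 = {x \<in> space P. \<exists>e\<in>?I. D \<le> \<bar>x e\<bar>}"
  define A2 where "A2 = {x \<in> space P. 1 / sqrt \<rho> \<le> \<bar>\<Sum>e\<in>{(M, N)}. 1 * x e\<bar>}"
  define A3 where "A3 = {x \<in> space P. \<exists>y\<in>Y. \<forall>s\<in>signs n. ?X 0 x (s, y) \<le> 2 * R / sqrt \<rho>}"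
  have "prob A1 \<le> card ?I / D\<^sup>2"
    unfolding A1_def by (rule PiM_std_normal_max_deviation[OF fin D])
  also have "\<dots> = \<rho>"
  proof -
    have "D\<^sup>2 = card ?I / \<rho>" unfolding D_def using \<rho> by (intro real_sqrt_pow2) auto
    moreover have "real (card ?I) \<noteq> 0" using \<open>0 < card ?I\<close> by linarith
    ultimately show ?thesis using \<rho> by simp
  qed
  finally have 1: "prob A1 \<le> \<rho>" .
  have "prob A2 \<le> (\<Sum>e\<in>{(M, N)}. 1\<^sup>2) / (1 / sqrt \<rho>)\<^sup>2"
    unfolding A2_def by (rule PiM_std_normal_linear_deviation[OF fin]) (use sr in auto)
  then have 2: "prob A2 \<le> \<rho>" using \<rho> by (simp add: power_divide)
  \<comment> \<open>The strict gap between the two levels that the comparison requires.\<close>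
  have "2 * R / sqrt \<rho> < 3 * R / sqrt \<rho>" using R0 sr by (intro divide_strict_right_mono) auto
  then have "prob A3 \<le> prob {x \<in> space P. \<exists>y\<in>Y. \<forall>s\<in>signs n. ?X (pi / 2) x (s, y) \<le> 3 * R / sqrt \<rho>}"
    unfolding A3_def
    by (intro gordon_comparison finite_signs signs_nonempty Y)
      (auto simp: radius_bounds(4) intro: test_vector_square_sum[OF l n p N b])
  also have "\<dots> \<le> 4 * \<rho>" by (rule prob_decoupled_small[OF Y(2)])
  finally have 3: "prob A3 \<le> 4 * \<rho>" .
  have m1: "A1 \<in> events"
    unfolding A1_def by (intro sets.sets_Collect_finite_Ex fin borel_measurable_le borel_measurable_const borel_measurable_abs comp)
  have m2: "A2 \<in> events"
    unfolding A2_def by (intro borel_measurable_le borel_measurable_const borel_measurable_abs borel_measurable_sum borel_measurable_times comp) auto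
  have m3: "A3 \<in> events"
    unfolding A3_def
    by (intro sets.sets_Collect_finite_Ex sets.sets_Collect_finite_All finite_signs Y borel_measurable_le bordered_process_measurable borel_measurable_const)
  show thesis
  proof
    show "A1 \<union> A2 \<union> A3 \<in> events" using m1 m2 m3 by auto
    show "prob (A1 \<union> A2 \<union> A3) \<le> 6 * \<rho>"
      using measure_Un_le[of "A1 \<union> A2" P A3] measure_Un_le[of A1 P A2] m1 m2 m3 1 2 3 by auto
    fix x y
    assume x: "x \<in> space P" and y: "(\<Sum>j<M. (y j)\<^sup>2) = 1"
      and dual: "\<And>s. s \<in> signs n \<Longrightarrow> (\<Sum>j<M. \<Sum>i<N. y j * ?z s i * x (j, i)) \<le> 0"
    show "x \<in> A1 \<union> A2 \<union> A3"
    proof (rule ccontr)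
      assume no: "x \<notin> A1 \<union> A2 \<union> A3"
      have xD: "\<bar>x e\<bar> \<le> D" if "e \<in> ?I" for e using no x that unfolding A1_def by force
      have g: "x (M, N) \<le> 1 / sqrt \<rho>" using no x unfolding A2_def by auto
      obtain y' where y': "y' \<in> Y" "\<And>j. j < M \<Longrightarrow> \<bar>y j - y' j\<bar> \<le> \<epsilon>" using Y(3)[OF y] by blast
      have "?X 0 x (s, y') \<le> 2 * R / sqrt \<rho>" if s: "s \<in> signs n" for s
      proof -
        have zR: "\<bar>?z s i\<bar> \<le> R" if "i < N" for i
        proof -
          have "(?z s i)\<^sup>2 \<le> (\<Sum>i<N. (?z s i)\<^sup>2)" using that by (intro member_le_sum) auto
          also have "\<dots> \<le> R\<^sup>2" using test_vector_square_sum[OF l n p N b s] by (simp add: radius_bounds(4))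
          finally have "\<bar>?z s i\<bar> \<le> \<bar>R\<bar>" by (simp only: abs_le_square_iff)
          then show ?thesis using R0 by simp
        qed
        have "(\<Sum>j<M. \<Sum>i<N. y' j * ?z s i * x (j, i)) - (\<Sum>j<M. \<Sum>i<N. y j * ?z s i * x (j, i))
            = (\<Sum>j<M. \<Sum>i<N. (y' j - y j) * (?z s i * x (j, i)))"
          by (simp add: sum_subtractf algebra_simps)
        also have "\<dots> \<le> (\<Sum>j<M. \<Sum>i<N. \<epsilon> * (R * D))"
        proof (intro sum_mono)
          fix j i assume ji: "j \<in> {..<M}" "i \<in> {..<N}"
          have "(y' j - y j) * (?z s i * x (j, i)) \<le> \<bar>y' j - y j\<bar> * (\<bar>?z s i\<bar> * \<bar>x (j, i)\<bar>)"
            by (metis abs_ge_self abs_mult)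
          also have "\<dots> \<le> \<epsilon> * (R * D)"
            using ji y'(2)[of j] zR[of i] xD[of "(j, i)"] \<epsilon> R0 by (intro mult_mono) (auto simp: abs_minus_commute)
          finally show "(y' j - y j) * (?z s i * x (j, i)) \<le> \<epsilon> * (R * D)" .
        qed
        also have "\<dots> = real M * real N * (\<epsilon> * (R * D))" by simp
        also have "\<dots> \<le> R / sqrt \<rho>" by (rule \<epsilon>_le)
        finally have "(\<Sum>j<M. \<Sum>i<N. y' j * ?z s i * x (j, i)) \<le> R / sqrt \<rho>" using dual[OF s] by linarith
        moreover have "R * x (M, N) \<le> R * (1 / sqrt \<rho>)" using g R0 by (intro mult_left_mono) auto
        ultimately show ?thesis by (simp add: bordered_process_0)
      qed
      then show False using no x y'(1) unfolding A3_def by auto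
    qed
  qed
qed

lemma prob_tv_null_space_condition_small:
  assumes \<sigma>: "0 < \<sigma>" and K: "p - 1 \<le> K" and var: "2 * b * (n + 1) + 1 \<le> 2 * (real p - 1)"
  shows "prob_tv_null_space_condition M N K \<mu> \<sigma> \<le> 6 * \<rho>"
proof -
  interpret prob_space P by (rule prob_space_PiM_std_normal)
  let ?\<Omega> = "gaussian_entries M N \<mu> \<sigma>"
  let ?E = "{\<omega> \<in> space ?\<Omega>. tv_null_space_condition K (mat M N \<omega>)}"
  let ?h = "\<lambda>x. \<lambda>e\<in>{..<M} \<times> {..<N}. \<mu> + \<sigma> * x e"
  obtain Bad where Bad: "Bad \<in> sets P" "measure P Bad \<le> 6 * \<rho>"
    "\<And>x y. x \<in> space P \<Longrightarrow> (\<Sum>j<M. (y j)\<^sup>2) = 1 \<Longrightarrow>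
      (\<And>s. s \<in> signs n \<Longrightarrow> (\<Sum>j<M. \<Sum>i<N. y j * test_vector p l n b s i * x (j, i)) \<le> 0) \<Longrightarrow> x \<in> Bad"
    using prob_dual_small by blast
  show ?thesis
  \<comment> \<open>Case distinction in place of a measurability proof: \<open>measure\<close> is 0
    by default on sets outside the \<sigma>-algebra, and the bound is then trivial.\<close>
  proof (cases "?E \<in> sets ?\<Omega>")
    case True
    have "measure ?\<Omega> ?E = measure (distr P ?\<Omega> ?h) ?E"
      using gaussian_entries_eq_distr(1)[OF \<sigma>, of M N \<mu>] by simp
    also have "\<dots> = prob (?h -` ?E \<inter> space P)"
      by (rule measure_distr[OF gaussian_entries_eq_distr(2)[OF \<sigma>] True])
    also have "\<dots> \<le> prob Bad"
    proof (rule finite_measure_mono[OF _ Bad(1)], rule subsetI)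
      fix x assume x: "x \<in> ?h -` ?E \<inter> space P"
      then have NSC: "tv_null_space_condition K (mat M N (?h x))" by simp
      obtain y where "(\<Sum>j<M. (y j)\<^sup>2) = 1"
        "\<And>s. s \<in> signs n \<Longrightarrow> (\<Sum>j<M. \<Sum>i<N. y j * test_vector p l n b s i * x (j, i)) \<le> 0"
        by (rule tv_null_space_condition_imp_dual[OF l n p N b NSC _ \<sigma> K var, where x=x]) auto
      then show "x \<in> Bad" using Bad(3) x by blast
    qed
    finally show ?thesis using Bad(2) by (simp add: prob_tv_null_space_condition_def)
  next
    case False
    then show ?thesis using \<rho> by (simp add: prob_tv_null_space_condition_def measure_notin_sets)
  qed
qed

end

section \<open>Choice of parameters\<close>

lemma arctan_le_self:
  assumes "0 \<le> x"
  shows "arctan x \<le> x"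
proof -
  have "0 - arctan 0 \<le> x - arctan x"
  proof (rule DERIV_nonneg_imp_nondecreasing[OF assms])
    fix t :: real
    have "((\<lambda>t. t - arctan t) has_real_derivative 1 - inverse (1 + t\<^sup>2)) (at t)"
      by (auto intro!: derivative_eq_intros)
    moreover have "inverse (1 + t\<^sup>2) \<le> 1" by (intro inverse_le_1_iff[THEN iffD2]) auto
    ultimately show "\<exists>y. ((\<lambda>t. t - arctan t) has_real_derivative y) (at t) \<and> 0 \<le> y"
      by (intro exI[of _ "1 - inverse (1 + t\<^sup>2)"]) auto
  qed
  then show ?thesis by simp
qed

text \<open>Euler's formula \<pi> / 4 = 5 arctan (1/7) + 2 arctan (3/79) gives \<pi> \<le> 20/7 +
  24/79. The margin 2 / (3 \<pi>) > \<pi> / 16 amounts to \<pi>^2 < 32/3, so a bound below 3.266 is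
  required.\<close>

lemma pi_upper_bound: "pi \<le> 3162 / 1000"
  using machin_Euler arctan_le_self[of "1 / 7"] arctan_le_self[of "3 / 79"] by simp

text \<open>Put y = sqrt (N / K) and l = x y. With b n about K and n l at least about N / 2, the
  squared radius is at most about K (1 + 2 x^2), and the squared gain is about 2 x y K^2 / \<pi>.
  Their quotient bounds M by (2 / \<pi>) x / (1 + 2 x^2) times sqrt (N K), and x lies in [1/2, 1]
  because \<open>l\<close> is y rounded down.\<close>

lemma parameter_choice:
  fixes N K M :: nat and \<rho> :: real
  assumes K: "2000 \<le> K" "1000 / sqrt \<rho> \<le> sqrt K" and N: "2 * K + 2 \<le> N"
    and \<rho>: "0 < \<rho>" and M: "real M \<le> pi / 16 * sqrt (real N * real K)"
  obtains p l n :: nat and b R :: real where "0 < l" "0 < n" "even p" "2 \<le> p" "p + n * l \<le> N" "0 \<le> b"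
    "R = sqrt (p + b\<^sup>2 * n * l)" "R * (sqrt M + 8 / sqrt \<rho>) \<le> b * n * sqrt (2 * l / pi)"
    "p - 1 \<le> K" "2 * b * (n + 1) + 1 \<le> 2 * (real p - 1)"
proof -
  define k where "k = real K"
  have k: "2000 \<le> k" using K by (simp add: k_def)
  define y where "y = sqrt (N / K)"
  have y2: "y\<^sup>2 = N / k" unfolding y_def k_def by simp
  have Ny: "real N = k * y\<^sup>2" using k by (simp add: y2)
  have "1 \<le> real N / k" using N k by (simp add: k_def)
  then have y1: "1 \<le> y" by (simp add: y_def k_def)
  have sqrtNK: "sqrt (real N * real K) = k * y"
    using k y1 by (intro real_sqrt_unique) (auto simp: Ny power2_eq_square simp flip: k_def)
  define l where "l = nat \<lfloor>y\<rfloor>"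
  have l: "real l \<le> y" "y < real l + 1" "1 \<le> l"
    using y1 unfolding l_def by linarith+
  then have l2: "y \<le> 2 * real l" by linarith
  \<comment> \<open>Rounding up to an even number is permitted, since p - 1 \<le> K is all that is
    asked.\<close>
  define p where "p = (if even K then K else K + 1)"
  have p: "even p" "K \<le> p" "p \<le> K + 1" by (auto simp: p_def)
  define n where "n = (N - p) div l"
  have nl: "n * l \<le> N - p" by (simp add: n_def)
  then have pnl: "p + n * l \<le> N" using p N by linarith
  have Np: "real (N - p) \<ge> N / 2" using N p by (simp add: of_nat_diff)
  have "real (N - p) < (real n + 1) * l"
  proof -
    have "N - p < (n + 1) * l" using dividend_less_div_times[of l "N - p"] l(3) by (simp add: n_def)
    then have "real (N - p) < real ((n + 1) * l)" by (rule of_nat_less_iff[THEN iffD2])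
    then show ?thesis by (simp add: algebra_simps)
  qed
  then have n1: "N / 2 \<le> (real n + 1) * l" using Np by linarith
  have lN: "real l \<le> N / k"
  proof -
    have "y * 1 \<le> y * y" using y1 by (intro mult_left_mono) auto
    then show ?thesis using l(1) y2 by (simp add: power2_eq_square)
  qed
  have Npos: "0 < real N" using Ny k y1 by simp
  \<comment> \<open>The remainder of the division is below \<open>l\<close>, and \<open>l\<close> is
    at most N / k; this is the loss against N / 2.\<close>
  have nl_low: "N * (1 / 2 - 1 / k) \<le> real n * l"
  proof -
    have "N * (1 / 2 - 1 / k) = N / 2 - N / k" by (simp add: right_diff_distrib)
    moreover have "(real n + 1) * l = real n * l + l" by (simp add: distrib_right)
    ultimately show ?thesis using n1 lN by linarith
  qed
  have "0 < N * (1 / 2 - 1 / k)" using Npos k by (intro mult_pos_pos) (auto simp: field_simps)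
  then have "0 < real n * l" using nl_low by linarith
  then have npos: "0 < n" by (cases n) auto
  \<comment> \<open>Then 2 b (n + 1) + 1 = 2 p - 3, just within the allowed variation 2 (p -
    1).\<close>
  define b where "b = (real p - 2) / (n + 1)"
  have p2: "2 \<le> p" using p K by linarith
  have b0: "0 \<le> b" unfolding b_def using p2 by (intro divide_nonneg_nonneg) auto
  have bn1: "b * (n + 1) = real p - 2" unfolding b_def by simp
  define u where "u = b * n"
  have u_upper: "u \<le> k"
  proof -
    have "u \<le> b * (n + 1)" unfolding u_def using b0 by (intro mult_left_mono) auto
    then show ?thesis using bn1 p(3) by (simp add: k_def)
  qed
  have n_large: "k / 2 - 1 \<le> n"
  proof -
    have "(k * y) * l \<le> k * y * y" using l(1) k y1 by (intro mult_left_mono) auto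
    also have "\<dots> = N" by (simp add: Ny power2_eq_square)
    also have "\<dots> \<le> (2 * (real n + 1)) * l" using n1 by (simp add: algebra_simps)
    finally have "(k * y) * l \<le> (2 * (real n + 1)) * l" .
    then have "k * y \<le> 2 * (real n + 1)" by (rule mult_right_le_imp_le) (use l(3) in simp)
    moreover have "k * 1 \<le> k * y" using y1 k by (intro mult_left_mono) auto
    ultimately show ?thesis by simp
  qed
  have u_lower: "k * (1 - 4 / k) \<le> u"
  proof -
    have "u = (real p - 2) * (1 - 1 / (n + 1))" unfolding u_def b_def by (simp add: field_simps)
    moreover have "(k - 2) * (1 - 2 / k) \<le> (real p - 2) * (1 - 1 / (n + 1))"
    proof (rule mult_mono)
      have "1 / (real n + 1) \<le> 1 / (k / 2)" using n_large k by (intro divide_left_mono) auto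
      then show "1 - 2 / k \<le> 1 - 1 / real (n + 1)" by (simp add: add.commute)
    qed (use p k in \<open>auto simp: k_def field_simps\<close>)
    moreover have "k * (1 - 4 / k) \<le> (k - 2) * (1 - 2 / k)" using k by (simp add: field_simps)
    ultimately show ?thesis by linarith
  qed
  define x where "x = l / y"
  have x: "1 / 2 \<le> x" "x \<le> 1" using l l2 y1 by (auto simp: x_def field_simps)
  have lx: "real l = x * y" using y1 by (simp add: x_def)
  define R where "R = sqrt (p + b\<^sup>2 * n * l)"
  have R2: "R\<^sup>2 = p + b\<^sup>2 * n * l" and R0: "0 \<le> R" unfolding R_def by simp_all
  have R_upper: "R\<^sup>2 \<le> 10011 / 10000 * k * (1 + 2 * x\<^sup>2)"
  proof -
    have "b\<^sup>2 * n * l * (N * (1 / 2 - 1 / k)) \<le> b\<^sup>2 * n * l * (real n * l)"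
      by (intro mult_left_mono nl_low) auto
    also have "\<dots> = u\<^sup>2 * (real l)\<^sup>2" by (simp add: u_def power2_eq_square)
    also have "\<dots> \<le> k\<^sup>2 * (real l)\<^sup>2"
      using u_upper b0 by (intro mult_right_mono power_mono) (auto simp: u_def)
    also have "\<dots> = k * x\<^sup>2 * N" by (simp add: lx Ny power2_eq_square)
    finally have "(b\<^sup>2 * n * l * (1 / 2 - 1 / k)) * N \<le> (k * x\<^sup>2) * N" by (simp add: mult_ac)
    then have *: "b\<^sup>2 * n * l * (1 / 2 - 1 / k) \<le> k * x\<^sup>2" using Npos by (rule mult_right_le_imp_le)
    \<comment> \<open>Since 1/2 - 1/2000 = 999/2000, the factor 10011/10000 in
      \<open>R_upper\<close> has to exceed 1000/999; it also covers the rounding p \<le> k +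
      1.\<close>
    have "1 / k \<le> 1 / 2000" using k by (intro divide_left_mono) auto
    then have "b\<^sup>2 * n * l * (999 / 2000) \<le> b\<^sup>2 * n * l * (1 / 2 - 1 / k)"
      by (intro mult_left_mono) auto
    then have "b\<^sup>2 * n * l \<le> (2000 / 999) * (k * x\<^sup>2)" using * by linarith
    moreover have "real p \<le> k + 1" using p(3) by (simp add: k_def)
    moreover have "0 \<le> k * x\<^sup>2" using k by simp
    moreover have "10011 / 10000 * k * (1 + 2 * x\<^sup>2) = 10011 / 10000 * k + 20022 / 10000 * (k * x\<^sup>2)"
      by (simp add: algebra_simps)
    ultimately show ?thesis unfolding R2 using k by linarith
  qed
  \<comment> \<open>This \<open>3\<close> is the one in the threshold \<open>2 / (3 \<pi>) \<surd>(N K)\<close>; both ends of \<open>1/2 \<le> x \<le> 1\<close> attain it.\<close>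
  have quad: "1 + 2 * x\<^sup>2 \<le> 3 * x"
  proof -
    have "(2 * x - 1) * (x - 1) \<le> 0" using x by (intro mult_nonneg_nonpos) auto
    then show ?thesis by (simp add: power2_eq_square algebra_simps)
  qed
  define Q where "Q = sqrt (k * y)"
  have Q2: "Q\<^sup>2 = k * y" and Q0: "0 \<le> Q" unfolding Q_def using k y1 by auto
  have sqM: "sqrt M \<le> 4446 / 10000 * Q"
  proof (rule real_le_lsqrt)
    \<comment> \<open>The constant 4446/10000 is a rational slightly above the square root of
      3.162/16.\<close>
    have "pi / 16 * (k * y) \<le> (3162 / 1000) / 16 * (k * y)"
      using pi_upper_bound k y1 by (intro mult_right_mono divide_right_mono) auto
    also have "\<dots> \<le> (4446 / 10000)\<^sup>2 * (k * y)"
      using k y1 by (intro mult_right_mono) (auto simp: power2_eq_square)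
    also have "\<dots> = (4446 / 10000 * Q)\<^sup>2" by (simp only: power_mult_distrib Q2)
    finally show "real M \<le> (4446 / 10000 * Q)\<^sup>2" using M unfolding sqrtNK by linarith
  qed (use Q0 in auto)
  have "8 / sqrt \<rho> \<le> 8 / 1000 * Q"
  proof -
    have "sqrt k \<le> Q" unfolding Q_def using k y1 mult_left_mono[of 1 y k] by simp
    then have "1000 / sqrt \<rho> \<le> Q" using K(2) by (simp add: k_def)
    then show ?thesis by simp
  qed
  with sqM have "sqrt M + 8 / sqrt \<rho> \<le> 4526 / 10000 * Q" by linarith
  then have "R * (sqrt M + 8 / sqrt \<rho>) \<le> R * (4526 / 10000 * Q)" using R0 by (rule mult_left_mono)
  also have "\<dots> \<le> b * n * sqrt (2 * l / pi)"
  proof (rule power2_le_imp_le)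
    have "(R * (4526 / 10000 * Q))\<^sup>2 = (4526 / 10000)\<^sup>2 * (k * y) * R\<^sup>2"
      by (simp only: power_mult_distrib Q2 mult_ac)
    also have "\<dots> \<le> (4526 / 10000)\<^sup>2 * (k * y) * (10011 / 10000 * k * (3 * x))"
    proof (intro mult_left_mono)
      have "10011 / 10000 * k * (1 + 2 * x\<^sup>2) \<le> 10011 / 10000 * k * (3 * x)"
        using quad k by (intro mult_left_mono) auto
      then show "R\<^sup>2 \<le> 10011 / 10000 * k * (3 * x)" using R_upper by linarith
    qed (use k y1 in auto)
    also have "\<dots> = ((4526 / 10000)\<^sup>2 * (10011 / 10000) * 3) * (k\<^sup>2 * (x * y))"
      by (simp add: power2_eq_square algebra_simps)
    \<comment> \<open>About 0.6152 on the left against 0.6299 on the right: this is where the excess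
      of 2 / (3 \<pi>) over \<pi> / 16 pays for all roundings.\<close>
    also have "\<dots> \<le> ((998 / 1000)\<^sup>2 * (2 / (3162 / 1000))) * (k\<^sup>2 * (x * y))"
      using x y1 by (intro mult_right_mono) (auto simp: power2_eq_square)
    also have "\<dots> = (998 / 1000 * k)\<^sup>2 * (2 * l / (3162 / 1000))"
      by (simp add: lx power2_eq_square)
    also have "\<dots> \<le> u\<^sup>2 * (2 * l / pi)"
    proof (intro mult_mono power_mono)
      have "4 / k \<le> 2 / 1000" using k by (simp add: field_simps)
      then have "998 / 1000 * k \<le> k * (1 - 4 / k)" using k by (simp add: field_simps)
      then show "998 / 1000 * k \<le> u" using u_lower by linarith
      show "2 * l / (3162 / 1000) \<le> 2 * l / pi"
        unfolding of_nat_mult of_nat_numeral using pi_upper_bound by (intro divide_left_mono) auto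
    qed (use k in auto)
    also have "\<dots> = (b * n * sqrt (2 * l / pi))\<^sup>2"
      by (simp add: u_def power_mult_distrib)
    finally show "(R * (4526 / 10000 * Q))\<^sup>2 \<le> (b * n * sqrt (2 * l / pi))\<^sup>2" .
  qed (use b0 in auto)
  finally have main: "R * (sqrt M + 8 / sqrt \<rho>) \<le> b * n * sqrt (2 * l / pi)" .
  show thesis
  proof (rule that[OF _ npos p(1) p2 pnl b0 R_def main])
    show "0 < l" using l by simp
    show "p - 1 \<le> K" using p by simp
    show "2 * b * (n + 1) + 1 \<le> 2 * (real p - 1)" using bn1 by (simp add: algebra_simps)
  qed
qed

theorem theorem3p1:
  fixes \<eta> :: real
  assumes "0 < \<eta>" and "\<eta> < 1"
  shows "\<exists>R :: nat \<Rightarrow> real. R \<in> O(\<lambda>N. sqrt (real N)) \<and>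
    (\<forall>(N::nat) (K::nat) (M::nat) (\<mu>::real) (\<sigma>::real).
       K < N \<longrightarrow> 0 < \<sigma> \<longrightarrow>
       prob_tv_null_space_condition M N K \<mu> \<sigma> \<ge> 1 - \<eta> \<longrightarrow>
       real M \<ge> pi / 16 * sqrt (real N * real K) - R N)"
proof -
  \<comment> \<open>Any \<rho> below (1 - \<eta>) / 6 would make the bound 6 \<rho> contradict the
    assumed success probability.\<close>
  define \<rho> where "\<rho> = (1 - \<eta>) / 7"
  have \<rho>: "0 < \<rho>" "\<rho> \<le> 1" "6 * \<rho> < 1 - \<eta>" using assms by (auto simp: \<rho>_def)
  \<comment> \<open>Beyond this size of \<open>K\<close> the parameters can be chosen. It depends on
    \<eta> alone, so the smaller \<open>K\<close> are absorbed uniformly in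
    \<open>R\<close>.\<close>
  define C where "C = max 2000 ((1000 / sqrt \<rho>)\<^sup>2)"
  define R where "R N = pi / 16 * sqrt C * sqrt (real N)" for N
  have "R \<in> O(\<lambda>N. sqrt (real N))" unfolding R_def by simp
  moreover have "pi / 16 * sqrt (real N * real K) - R N \<le> real M"
    if KN: "K < N" and \<sigma>: "0 < \<sigma>" and prob: "1 - \<eta> \<le> prob_tv_null_space_condition M N K \<mu> \<sigma>"
    for N K M :: nat and \<mu> \<sigma> :: real
  proof (cases "real K \<le> C")
    case True
    then have "sqrt (real N * real K) \<le> sqrt C * sqrt (real N)"
      unfolding real_sqrt_mult mult.commute[of "sqrt N"] by (intro mult_right_mono) auto
    then have "pi / 16 * sqrt (real N * real K) \<le> R N"
      unfolding R_def mult.assoc by (intro mult_left_mono) auto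
    then show ?thesis by linarith
  next
    case False
    have R_nonneg: "0 \<le> R N" by (simp add: R_def C_def)
    show ?thesis
    proof (rule ccontr)
      assume "\<not> ?thesis"
      then have M: "real M \<le> pi / 16 * sqrt (real N * real K)" and strict: "real M < pi / 16 * sqrt (real N * real K)"
        using R_nonneg by linarith+
      show False
      proof (cases "2 * K + 2 \<le> N")
        case True
        have K: "2000 \<le> K" and "(1000 / sqrt \<rho>)\<^sup>2 \<le> real K" using False by (auto simp: C_def)
        then have "1000 / sqrt \<rho> \<le> sqrt K" by (intro real_le_rsqrt)
        from K this True \<rho>(1) M
        obtain p l n :: nat and b r :: real where
          *: "0 < l" "0 < n" "even p" "2 \<le> p" "p + n * l \<le> N" "0 \<le> b" "r = sqrt (p + b\<^sup>2 * n * l)"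
          "r * (sqrt M + 8 / sqrt \<rho>) \<le> b * n * sqrt (2 * l / pi)" "p - 1 \<le> K"
          "2 * b * (n + 1) + 1 \<le> 2 * (real p - 1)"
          by (rule parameter_choice)
        have "prob_tv_null_space_condition M N K \<mu> \<sigma> \<le> 6 * \<rho>"
          by (rule prob_tv_null_space_condition_small[OF *(1-7) \<rho>(1,2) *(8) \<sigma> *(9,10)])
        then show False using prob \<rho>(3) by linarith
      next
        case False
        \<comment> \<open>Positive probability already yields one matrix satisfying the condition,
          and a single one forces N \<le> M.\<close>
        have "measure (gaussian_entries M N \<mu> \<sigma>)
            {\<omega> \<in> space (gaussian_entries M N \<mu> \<sigma>). tv_null_space_condition K (mat M N \<omega>)} \<noteq> 0"
          using prob assms(2) unfolding prob_tv_null_space_condition_def by linarith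
        then obtain \<omega> where "tv_null_space_condition K (mat M N \<omega>)"
          by (metis (mono_tags, lifting) empty_Collect_eq measure_empty)
        then have "N \<le> M"
          by (rule tv_null_space_condition_dim[rotated]) (use False in auto)
        have "sqrt (real N * real K) \<le> sqrt (real N * real N)"
          using KN by (intro real_sqrt_le_mono mult_left_mono) auto
        then have "pi / 16 * sqrt (real N * real K) \<le> 1 * real N"
          using pi_less_4 by (intro mult_mono) auto
        then show False using strict \<open>N \<le> M\<close> by linarith
      qed
    qed
  qed
  ultimately show ?thesis by blast
qed

end
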